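(* Let $F$ be a finite field of characteristic $2$. Let $n\ge m\ge 1$, $k\ge 2$, $l\in\{1,2\}$, $H_1\cong D_8$, $H_2\cong Q_8$, and let $$G_l\cong \bigl(M_2(n+1,1)\mathbin{\mathsf Y}H_l\mathbin{\mathsf Y}D_8^{\mathsf Y(k-2)}\bigr)\times\mathbb{Z}_{2^{m+1}}.$$ Then $|V_*(FG_l)|=2|F|^{\frac{|G_l|+|\Omega_1(G_l)|}{2}-1}$ if $n=m=1$, and $|V_*(FG_l)|=4|F|^{\frac{|G_l|+|\Omega_1(G_l)|}{2}-1}$ if $n\ge 2$.
   Context: $V(FG)=\{\sum_{g}\alpha_g g\in FG:\sum_g\alpha_g=1\}$; $(\sum_g\alpha_g g)^*=\sum_g\alpha_g g^{-1}$; $V_*(FG)=\{x\in V(FG):x^*=x^{-1}\}$. $\Omega_1(G)=\{g\in G:g^2=1\}$. $D_8$, $Q_8$ are the dihedral and quaternion groups of order $8$. $M_2(u,v)=\langle a,b\mid a^{2^u}=b^{2^v}=1,\ a^b=a^{1+2^{u-1}}\rangle$ for $u\ge2,v\ge1$. $H\mathbin{\mathsf Y}K$ denotes the central product; here all central factors have derived subgroup of order $2$, and the central product is formed by identifying these derived subgroups with one common subgroup $\langle c\rangle$, so that factors intersect exactly in $\langle c\rangle$. $D_8^{\mathsf Y j}$ is the central product of $j$ copies of $D_8$ (omitted if $j=0$). *)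

theory Defs
  imports Complex_Main "HOL-Algebra.Algebra"
begin

section \<open>Groups given by generators and relations\<close>

text \<open>A letter \<open>(x, True)\<close> stands for the generator \<open>x\<close>, and \<open>(x, False)\<close> for its inverse.
  The generators are all elements of the type \<open>'x\<close>; a pair \<open>(r, s)\<close> in \<open>R\<close> is the relation
  \<open>r = s\<close>.\<close>

type_synonym 'x word = "('x \<times> bool) list"

inductive word_eq :: "('x word \<times> 'x word) set \<Rightarrow> 'x word \<Rightarrow> 'x word \<Rightarrow> bool"
  for R where
  refl: "word_eq R w w"
| sym: "word_eq R v w \<Longrightarrow> word_eq R w v"
| trans: "word_eq R u v \<Longrightarrow> word_eq R v w \<Longrightarrow> word_eq R u w"
| append: "word_eq R v v' \<Longrightarrow> word_eq R w w' \<Longrightarrow> word_eq R (v @ w) (v' @ w')"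
| cancel: "word_eq R [(x, e), (x, \<not> e)] []"
| relation: "(r, s) \<in> R \<Longrightarrow> word_eq R r s"

definition word_class :: "('x word \<times> 'x word) set \<Rightarrow> 'x word \<Rightarrow> 'x word set" where
  "word_class R w = {v. word_eq R w v}"

definition presented_group :: "('x word \<times> 'x word) set \<Rightarrow> 'x word set monoid" where
  "presented_group R =
     \<lparr>carrier = range (word_class R),
      monoid.mult = (\<lambda>A B. {w. \<exists>u\<in>A. \<exists>v\<in>B. word_eq R (u @ v) w}),
      one = word_class R []\<rparr>"

lemma word_class_eq_iff: "word_class R v = word_class R w \<longleftrightarrow> word_eq R v w"
  unfolding word_class_def using word_eq.refl word_eq.sym word_eq.trans by blast

lemma presented_group_mult [simp]:
  "word_class R v \<otimes>\<^bsub>presented_group R\<^esub> word_class R w = word_class R (v @ w)"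
proof -
  have "(\<exists>v'\<in>word_class R v. \<exists>w'\<in>word_class R w. word_eq R (v' @ w') u) \<longleftrightarrow> word_eq R (v @ w) u"
    for u
    unfolding word_class_def mem_Collect_eq Bex_def
    by (meson word_eq.append word_eq.refl word_eq.trans)
  then show ?thesis
    by (simp add: presented_group_def) (simp add: word_class_def)
qed

lemma group_presented_group:
  fixes R :: "('x word \<times> 'x word) set"
  shows "group (presented_group R)"
proof -
  define inv_word :: "'x word \<Rightarrow> 'x word" where "inv_word w = rev (map (\<lambda>(x, e). (x, \<not> e)) w)" for w
  have inv_word: "word_eq R (inv_word w @ w) []" for w
  proof (induction w)
    case Nil
    show ?case by (simp add: inv_word_def word_eq.refl)
  next
    case (Cons a w)
    obtain x e where a: "a = (x, e)" by force
    have "word_eq R ([(x, \<not> e), (x, e)] @ w) ([] @ w)"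
      using word_eq.cancel[of R x "\<not> e"] by (intro word_eq.append word_eq.refl) auto
    then have "word_eq R (inv_word w @ ([(x, \<not> e), (x, e)] @ w)) (inv_word w @ w)"
      by (intro word_eq.append word_eq.refl) auto
    then show ?case
      using word_eq.trans[OF _ Cons] by (simp add: a inv_word_def)
  qed
  have carrier: "carrier (presented_group R) = range (word_class R)"
    and one: "\<one>\<^bsub>presented_group R\<^esub> = word_class R []"
    by (simp_all add: presented_group_def)
  show ?thesis
  proof (rule groupI)
    fix A assume "A \<in> carrier (presented_group R)"
    then obtain w where "A = word_class R w" by (auto simp: carrier)
    then show "\<exists>B\<in>carrier (presented_group R). B \<otimes>\<^bsub>presented_group R\<^esub> A = \<one>\<^bsub>presented_group R\<^esub>"
      using inv_word by (auto simp: carrier one word_class_eq_iff)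
  qed (auto simp: carrier one)
qed

datatype gen2 = gen_a | gen_b

definition wpow :: "'x \<Rightarrow> nat \<Rightarrow> 'x word" where
  "wpow x i = replicate i (x, True)"

text \<open>The word \<open>a\<^sup>b = b\<^sup>-\<^sup>1 a b\<close>.\<close>

definition conj_ab :: "gen2 word" where
  "conj_ab = [(gen_b, False), (gen_a, True), (gen_b, True)]"

definition M2 :: "nat \<Rightarrow> nat \<Rightarrow> gen2 word set monoid" where
  "M2 u v = presented_group
     {(wpow gen_a (2 ^ u), []), (wpow gen_b (2 ^ v), []),
      (conj_ab, wpow gen_a (1 + 2 ^ (u - 1)))}"

definition D8 :: "gen2 word set monoid" where
  "D8 = presented_group
     {(wpow gen_a 4, []), (wpow gen_b 2, []), (conj_ab, [(gen_a, False)])}"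

definition Q8 :: "gen2 word set monoid" where
  "Q8 = presented_group
     {(wpow gen_a 4, []), (wpow gen_b 2, wpow gen_a 2), (conj_ab, [(gen_a, False)])}"

section \<open>Central products of groups whose derived subgroup has order 2\<close>

definition embed_factor :: "'a monoid list \<Rightarrow> nat \<Rightarrow> 'a \<Rightarrow> nat \<Rightarrow> 'a" where
  "embed_factor Hs i x = (\<lambda>j\<in>{..<length Hs}. if j = i then x else \<one>\<^bsub>Hs ! j\<^esub>)"

text \<open>The quotient of the direct product by the subgroup that identifies, for all \<open>i\<close> and \<open>j\<close>, the
  non-trivial element of the derived subgroup of the \<open>i\<close>-th factor with that of the \<open>j\<close>-th factor.
  All derived subgroups are assumed to be central of order 2, so this identification is the only
  possible one. As the derived subgroup of such a product is again the common subgroup of order 2,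
  the product of a list agrees with the iterated binary product.\<close>

definition central_product :: "'a monoid list \<Rightarrow> (nat \<Rightarrow> 'a) set monoid" where
  "central_product Hs =
     (let P = product_group {..<length Hs} (\<lambda>i. Hs ! i) in
      P Mod generate P
        {embed_factor Hs i c \<otimes>\<^bsub>P\<^esub> inv\<^bsub>P\<^esub> (embed_factor Hs j d) | i j c d.
           i < length Hs \<and> j < length Hs \<and>
           c \<in> derived (Hs ! i) (carrier (Hs ! i)) - {\<one>\<^bsub>Hs ! i\<^esub>} \<and>
           d \<in> derived (Hs ! j) (carrier (Hs ! j)) - {\<one>\<^bsub>Hs ! j\<^esub>}})"

section \<open>The group algebra of a finite group and its unitary subgroup\<close>

text \<open>An element \<open>\<Sum> \<alpha>\<^sub>g g\<close> of the group algebra of a finite group \<open>G\<close> is the coefficient function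
  \<open>g \<mapsto> \<alpha>\<^sub>g\<close>, which is required to vanish outside the carrier of \<open>G\<close>.\<close>

definition group_algebra :: "('a, 'b) monoid_scheme \<Rightarrow> ('a \<Rightarrow> 'f::field) ring" where
  "group_algebra G =
     \<lparr>carrier = {x. \<forall>g. g \<notin> carrier G \<longrightarrow> x g = 0},
      monoid.mult = (\<lambda>x y g. if g \<in> carrier G
                      then \<Sum>h\<in>carrier G. x h * y (inv\<^bsub>G\<^esub> h \<otimes>\<^bsub>G\<^esub> g) else 0),
      one = (\<lambda>g. if g = \<one>\<^bsub>G\<^esub> then 1 else 0),
      ring.zero = (\<lambda>g. 0),
      ring.add = (\<lambda>x y g. x g + y g)\<rparr>"

definition normalized_elements :: "('a, 'b) monoid_scheme \<Rightarrow> ('a \<Rightarrow> 'f::field) set" where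
  "normalized_elements G = {x \<in> carrier (group_algebra G). (\<Sum>g\<in>carrier G. x g) = 1}"

definition involution :: "('a, 'b) monoid_scheme \<Rightarrow> ('a \<Rightarrow> 'f::field) \<Rightarrow> 'a \<Rightarrow> 'f" where
  "involution G x = (\<lambda>g. if g \<in> carrier G then x (inv\<^bsub>G\<^esub> g) else 0)"

text \<open>The equation \<open>x\<^sup>* = x\<^sup>-\<^sup>1\<close> presupposes that \<open>x\<close> is invertible; the value of \<^const>\<open>m_inv\<close> on
  a non-unit is unspecified.\<close>

definition unitary_subgroup :: "('a, 'b) monoid_scheme \<Rightarrow> ('a \<Rightarrow> 'f::field) set" where
  "unitary_subgroup G =
     {x \<in> normalized_elements G.
        x \<in> Units (group_algebra G) \<and> involution G x = inv\<^bsub>group_algebra G\<^esub> x}"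

definition Omega1 :: "('a, 'b) monoid_scheme \<Rightarrow> 'a set" where
  "Omega1 G = {g \<in> carrier G. g [^]\<^bsub>G\<^esub> (2::nat) = \<one>\<^bsub>G\<^esub>}"

end

theory Submission
  imports Defs "HOL-Library.Function_Algebras"
begin

text \<open>Two elements of \<open>V(FG)\<close> have the same norm \<open>x x\<^sup>*\<close> iff they differ by a unitary factor, so
  \<open>|V\<^sub>*(FG)|\<close> is \<open>|V(FG)|\<close> divided by the number of norms. All norms lie in \<open>1 + T\<close>, where \<open>T\<close> is the
  space of symmetric elements vanishing on \<open>\<Omega>\<^sub>1(G)\<close>, and one has to see that they fill exactly the
  fraction \<open>1/2\<close> or \<open>1/4\<close> of it.

  Upper bound on the number of norms: for a homomorphism \<open>f\<close> from \<open>G\<close> to \<open>\<int>/4\<close>, the coefficients of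
  \<open>x x\<^sup>*\<close> on \<open>f = 1\<close> add up to a value \<open>t\<^sup>2 + t\<close>, and such values form a subgroup of index 2 in \<open>F\<close>
  (Artin-Schreier).

  Lower bound: let \<open>c\<close> be a central involution with \<open>G/c\<close> abelian. If \<open>x\<close> and \<open>y\<close> are unitary modulo \<open>c\<close>, then
  \<open>x x\<^sup>* + 1\<close> is invariant under \<open>c\<close>, and \<open>x \<mapsto> x x\<^sup>* + 1\<close> turns \<open>x y\<close> into a sum. Its image contains many
  elements because \<open>x = 1 + \<alpha> y + \<alpha> g y\<close> is sent to \<open>[\<alpha>, y] + [\<alpha>, g y] + [\<alpha>\<^sup>2, g]\<close> with
  \<open>[\<alpha>, g] = \<alpha> g + \<alpha> g\<^sup>-\<^sup>1\<close>. It is everything allowed if \<open>c\<close> is a fourth power or not a square, or if every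
  \<open>g\<close> with \<open>g\<^sup>2 = c\<close> lies in a dihedral subgroup of order 8; it has index at most 2 if \<open>c\<close> is the square
  of a central element. Dividing out central involutions one by one bounds \<open>|V\<^sub>*(FA)|\<close> for an abelian
  2-group \<open>A\<close> in terms of \<open>|A\<^sup>2 : A\<^sup>4|\<close>, and one more step leads from \<open>G/c\<close> to \<open>G\<close>.\<close>

section \<open>The group algebra in characteristic 2\<close>

text \<open>Write q = |F|. Since |\<open>symmetric\<close>| = q^((|G| +
  |\<open>Omega1 G\<close>|)/2), the theorem says that q times the number of unitary elements is r
  |\<open>symmetric\<close>| with r = 2 or 4; both inequalities are proved in this form, without
  division. The constant r appears from two sides. Above, it bounds |A^2 : A^4| for A = G/z, where z
  is the common involution of the derived subgroups. Below, it counts combinations of independent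
  characters of G into \<int>/4. For n \<ge> 2 the first factor and the cyclic factor contribute one
  character each; for n = 1 the generator a of the first factor has a^2 = z, which every character
  kills, so only the cyclic factor is left. The obstacle is that taking norms is not multiplicative
  and the set of norms carries no evident structure. Restricting to elements unitary modulo c puts
  the deviation from 1 into the ideal generated by 1 + c, which is central with square zero, and
  there the deviation is additive. Hence one involution is divided out at a time, beginning with z
  so that all later groups are abelian. The same quotients supply the inverses of normalized
  elements on which the lower bound rests.\<close>

definition single :: "'f::zero \<Rightarrow> 'a \<Rightarrow> 'a \<Rightarrow> 'f" where
  "single \<alpha> g = (\<lambda>h. if h = g then \<alpha> else 0)"

text \<open>The terms at x and t x are equal and cancel in characteristic 2; removing a pair {a, t
  a} leaves a smaller set that is still stable under t.\<close>

lemma sum_involution_char2: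
  fixes f :: "'a \<Rightarrow> 'f::field"
  assumes "finite A" "CHAR('f) = 2"
    and "\<And>x. x \<in> A \<Longrightarrow> t x \<in> A \<and> t (t x) = x \<and> t x \<noteq> x \<and> f (t x) = f x"
  shows "sum f A = 0"
  using assms(1,3)
proof (induction A rule: finite_psubset_induct)
  case (psubset A)
  show ?case
  proof (cases "A = {}")
    case False
    then obtain a where a: "a \<in> A" by blast
    let ?B = "A - {a, t a}"
    have ta: "t a \<in> A" "t (t a) = a" "t a \<noteq> a" "f (t a) = f a" using psubset.prems[OF a] by auto
    have "sum f ?B = 0"
    proof (rule psubset.IH)
      show "?B \<subset> A" using a by blast
    next
      fix x assume "x \<in> ?B"
      then show "t x \<in> ?B \<and> t (t x) = x \<and> t x \<noteq> x \<and> f (t x) = f x"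
        using psubset.prems[of x] ta by auto
    qed
    moreover have "sum f A = sum f ?B + sum f {a, t a}"
      using sum.subset_diff[of "{a, t a}" A f] a ta psubset.hyps by auto
    moreover have "f a + f a = 0"
      using of_nat_CHAR[where 'a='f] assms(2) by (metis mult_zero_left mult_2 of_nat_numeral)
    ultimately show ?thesis using ta by simp
  qed simp
qed

lemma card_le_fibres:
  assumes "finite S" "f ` S \<subseteq> Y" "finite Y" "\<And>y. y \<in> Y \<Longrightarrow> card {x \<in> S. f x = y} \<le> n"
  shows "card S \<le> card Y * n"
proof -
  have "S = (\<Union>y\<in>Y. {x \<in> S. f x = y})" using assms(2) by auto
  then have "card S \<le> (\<Sum>y\<in>Y. card {x \<in> S. f x = y})"
    by (metis card_UN_le assms(3))
  also have "\<dots> \<le> (\<Sum>y\<in>Y. n)" using assms(4) by (intro sum_mono) auto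
  finally show ?thesis by simp
qed

lemma card_ge_fibres:
  assumes "finite S" "Y \<subseteq> f ` S" "\<And>y. y \<in> Y \<Longrightarrow> n \<le> card {x \<in> S. f x = y}"
  shows "card Y * n \<le> card S"
proof -
  have fin: "finite Y" using assms(1,2) finite_surj by blast
  have "card Y * n = (\<Sum>y\<in>Y. n)" by simp
  also have "\<dots> \<le> (\<Sum>y\<in>Y. card {x \<in> S. f x = y})" using assms(3) by (intro sum_mono) auto
  also have "\<dots> = card (\<Union>y\<in>Y. {x \<in> S. f x = y})"
    using assms(1) fin by (subst card_UN_disjoint) auto
  also have "\<dots> \<le> card S" using assms(1) by (intro card_mono) auto
  finally show ?thesis .
qed

lemma card_functions_supported_on:
  assumes "finite A"
  shows "card {x :: 'a \<Rightarrow> 'f::{zero,finite}. \<forall>g. g \<notin> A \<longrightarrow> x g = 0} = card (UNIV :: 'f set) ^ card A"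
    and "finite {x :: 'a \<Rightarrow> 'f::{zero,finite}. \<forall>g. g \<notin> A \<longrightarrow> x g = 0}"
proof -
  let ?S = "{x :: 'a \<Rightarrow> 'f. \<forall>g. g \<notin> A \<longrightarrow> x g = 0}"
  have b: "bij_betw (\<lambda>x. restrict x A) ?S (A \<rightarrow>\<^sub>E (UNIV :: 'f set))"
  proof (rule bij_betw_byWitness[where f' = "\<lambda>x g. if g \<in> A then x g else 0"])
    show "\<forall>x\<in>A \<rightarrow>\<^sub>E UNIV. restrict (\<lambda>g. if g \<in> A then x g else 0) A = x"
      by (auto simp: fun_eq_iff restrict_def PiE_def extensional_def)
  qed (auto simp: fun_eq_iff)
  show "card ?S = card (UNIV :: 'f set) ^ card A"
    using bij_betw_same_card[OF b] card_funcsetE[OF assms] by auto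
  show "finite ?S"
    using bij_betw_finite[OF b] assms by (simp add: finite_PiE)
qed

text \<open>The parameter \<open>F\<close> carries no data; it only fixes the type of the
  coefficients.\<close>

locale char2_group_algebra = group G for G :: "('a, 'b) monoid_scheme" (structure) +
  fixes F :: "'f::{field,finite} itself"
  assumes finG: "finite (carrier G)" and char2: "CHAR('f) = 2"
begin

abbreviation FG :: "('a \<Rightarrow> 'f) set" where "FG \<equiv> carrier (group_algebra G)"
abbreviation V :: "('a \<Rightarrow> 'f) set" where "V \<equiv> normalized_elements G"
abbreviation mul :: "('a \<Rightarrow> 'f) \<Rightarrow> ('a \<Rightarrow> 'f) \<Rightarrow> 'a \<Rightarrow> 'f" (infixl "\<star>" 70) where
  "x \<star> y \<equiv> x \<otimes>\<^bsub>group_algebra G\<^esub> y"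
abbreviation star :: "('a \<Rightarrow> 'f) \<Rightarrow> 'a \<Rightarrow> 'f" where "star \<equiv> involution G"
abbreviation unit :: "'a \<Rightarrow> 'f" where "unit \<equiv> single 1 \<one>"

text \<open>The linear extension of \<phi> to the group algebra, evaluated at x. Identities are
  verified against all test functions \<phi>: multiplication becomes a double sum,
  \<open>star\<close> a substitution, and the augmentation is the test function 1.\<close>

definition pair :: "('a \<Rightarrow> 'f) \<Rightarrow> ('a \<Rightarrow> 'f) \<Rightarrow> 'f" where
  "pair x \<phi> = (\<Sum>k\<in>carrier G. x k * \<phi> k)"

definition symmetric :: "('a \<Rightarrow> 'f) set" where
  "symmetric = {x \<in> FG. star x = x}"

text \<open>The space T of possible deviations of norms from 1. As with alternating bilinear forms
  in characteristic 2, symmetry has to be supplemented by vanishing on a diagonal, here on the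
  self-inverse elements.\<close>

definition alternating :: "('a \<Rightarrow> 'f) set" where
  "alternating = {x \<in> symmetric. \<forall>g\<in>carrier G. g \<otimes> g = \<one> \<longrightarrow> x g = 0}"

lemma FG_def: "FG = {x. \<forall>g. g \<notin> carrier G \<longrightarrow> x g = 0}"
  by (simp add: group_algebra_def)

lemma one_eq: "\<one>\<^bsub>group_algebra G\<^esub> = unit"
  by (simp add: group_algebra_def single_def)

lemma double_zero [simp]: "(\<alpha>::'f) + \<alpha> = 0"
  using of_nat_CHAR[where 'a='f] char2 by (metis mult_zero_left mult_2 of_nat_numeral)

lemma double_zero_left [simp]: "(\<alpha>::'f) + (\<alpha> + \<beta>) = \<beta>"
  by (metis add.assoc add_0 double_zero)

lemma uminus_eq [simp]: "- (\<alpha>::'f) = \<alpha>"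
  using double_zero by (metis add_eq_0_iff)

lemma fun_double_zero [simp]: "(x :: 'c \<Rightarrow> 'f) + x = 0" "(x :: 'c \<Rightarrow> 'f) + (x + y) = y"
  by (rule ext, simp add: plus_fun_def zero_fun_def)+

lemma two_eq_zero [simp]: "(2 :: 'f) = 0" "(2 :: 'c \<Rightarrow> 'f) = 0"
  using double_zero[of 1] fun_double_zero(1)[of "1 :: 'c \<Rightarrow> 'f"] one_add_one
  by metis+

lemma finite_FG: "finite FG" and card_FG: "card FG = card (UNIV :: 'f set) ^ card (carrier G)"
  unfolding FG_def using card_functions_supported_on[OF finG] by auto

lemma FG_add [simp, intro]: "x \<in> FG \<Longrightarrow> y \<in> FG \<Longrightarrow> x + y \<in> FG"
  and FG_zero [simp, intro]: "0 \<in> FG"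
  and FG_single [simp, intro]: "g \<in> carrier G \<Longrightarrow> single \<alpha> g \<in> FG"
  and FG_mul [simp, intro]: "x \<star> y \<in> FG"
  and FG_star [simp, intro]: "star x \<in> FG"
  and V_FG: "x \<in> V \<Longrightarrow> x \<in> FG"
  by (auto simp: group_algebra_def single_def involution_def normalized_elements_def)

lemma pair_cong [cong]:
  "(\<And>h. h \<in> carrier G \<Longrightarrow> \<phi> h = \<psi> h) \<Longrightarrow> pair x \<phi> = pair x \<psi>"
  unfolding pair_def by (intro sum.cong) auto

lemma pair_reindex:
  assumes "bij_betw f (carrier G) (carrier G)" "\<And>h. h \<in> carrier G \<Longrightarrow> x (f h) = y h"
  shows "pair x \<phi> = pair y (\<lambda>h. \<phi> (f h))"
  unfolding pair_def using assms(2) sum.reindex_bij_betw[OF assms(1), of "\<lambda>k. x k * \<phi> k"]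
  by (metis (no_types, lifting) sum.cong)

lemma pair_coeff: "k \<in> carrier G \<Longrightarrow> pair x (single 1 k) = x k"
  unfolding pair_def single_def using finG by (simp add: if_distrib cong: if_cong)

lemma FG_eqI:
  assumes "x \<in> FG" "y \<in> FG" "\<And>\<phi>. pair x \<phi> = pair y \<phi>"
  shows "x = y"
proof
  fix g show "x g = y g"
    using assms pair_coeff[of g x] pair_coeff[of g y] by (cases "g \<in> carrier G") (auto simp: FG_def)
qed

lemma inv_mult_cancel: "a \<in> carrier G \<Longrightarrow> b \<in> carrier G \<Longrightarrow> inv a \<otimes> (a \<otimes> b) = b"
  and mult_inv_cancel: "a \<in> carrier G \<Longrightarrow> b \<in> carrier G \<Longrightarrow> a \<otimes> (inv a \<otimes> b) = b"
  by (simp_all add: m_assoc[symmetric])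

lemma bij_left: "a \<in> carrier G \<Longrightarrow> bij_betw (\<lambda>h. a \<otimes> h) (carrier G) (carrier G)"
  by (rule bij_betw_byWitness[where f' = "\<lambda>h. inv a \<otimes> h"]) (auto simp: m_assoc[symmetric])

lemma bij_inv: "bij_betw (\<lambda>h. inv h) (carrier G) (carrier G)"
  by (rule bij_betw_byWitness[where f' = "\<lambda>h. inv h"]) auto

lemma bij_conj: "a \<in> carrier G \<Longrightarrow> bij_betw (\<lambda>h. a \<otimes> h \<otimes> inv a) (carrier G) (carrier G)"
  by (rule bij_betw_byWitness[where f' = "\<lambda>h. inv a \<otimes> h \<otimes> a"])
     (auto simp: m_assoc inv_mult_cancel mult_inv_cancel)

lemma mul_coeff: "k \<in> carrier G \<Longrightarrow> (x \<star> y) k = (\<Sum>h\<in>carrier G. x h * y (inv h \<otimes> k))"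
  by (simp add: group_algebra_def)

lemma pair_mul: "pair (x \<star> y) \<phi> = pair x (\<lambda>a. pair y (\<lambda>b. \<phi> (a \<otimes> b)))"
proof -
  have "pair (x \<star> y) \<phi> = (\<Sum>k\<in>carrier G. \<Sum>h\<in>carrier G. x h * y (inv h \<otimes> k) * \<phi> k)"
    by (simp add: pair_def mul_coeff sum_distrib_right)
  also have "\<dots> = (\<Sum>h\<in>carrier G. \<Sum>k\<in>carrier G. x h * y (inv h \<otimes> k) * \<phi> k)"
    by (rule sum.swap)
  \<comment> \<open>Substitute k = h b in the inner sum.\<close>
  also have "\<dots> = (\<Sum>h\<in>carrier G. \<Sum>b\<in>carrier G. x h * y b * \<phi> (h \<otimes> b))"
  proof (rule sum.cong[OF HOL.refl])
    fix h assume h: "h \<in> carrier G"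
    show "(\<Sum>k\<in>carrier G. x h * y (inv h \<otimes> k) * \<phi> k) = (\<Sum>b\<in>carrier G. x h * y b * \<phi> (h \<otimes> b))"
      using sum.reindex_bij_betw[OF bij_left[OF h], of "\<lambda>k. x h * y (inv h \<otimes> k) * \<phi> k"] h
      by (simp add: m_assoc[symmetric])
  qed
  finally show ?thesis by (simp add: pair_def sum_distrib_left mult.assoc)
qed

lemma pair_swap: "pair x (\<lambda>a. pair y (\<lambda>b. \<phi> a b)) = pair y (\<lambda>b. pair x (\<lambda>a. \<phi> a b))"
  unfolding pair_def sum_distrib_left by (subst sum.swap) (simp add: mult.left_commute)

lemma pair_add: "pair (x + y) \<phi> = pair x \<phi> + pair y \<phi>"
  by (simp add: pair_def sum.distrib distrib_right)

lemma pair_add_right: "pair x (\<lambda>h. \<phi> h + \<psi> h) = pair x \<phi> + pair x \<psi>"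
  by (simp add: pair_def sum.distrib distrib_left)

lemma pair_scale: "pair x (\<lambda>h. \<alpha> * \<phi> h) = \<alpha> * pair x \<phi>"
  by (simp add: pair_def sum_distrib_left mult.left_commute)

lemma pair_star: "pair (star x) \<phi> = pair x (\<lambda>h. \<phi> (inv h))"
  by (rule pair_reindex[OF bij_inv]) (simp add: involution_def)

lemma pair_single: "g \<in> carrier G \<Longrightarrow> pair (single \<alpha> g) \<phi> = \<alpha> * \<phi> g"
proof -
  assume g: "g \<in> carrier G"
  have "pair (single \<alpha> g) \<phi> = (\<Sum>k\<in>carrier G. if k = g then \<alpha> * \<phi> g else 0)"
    unfolding pair_def single_def by (intro sum.cong) auto
  then show ?thesis using g finG by simp
qed

lemma mul_assoc: "x \<star> y \<star> z = x \<star> (y \<star> z)"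
  by (rule FG_eqI) (auto simp: pair_mul m_assoc)

lemma star_mul: "star (x \<star> y) = star y \<star> star x"
  by (rule FG_eqI) (auto simp: pair_mul pair_star inv_mult_group pair_swap[of x])

lemma star_star: "x \<in> FG \<Longrightarrow> star (star x) = x"
  by (rule FG_eqI) (auto simp: pair_star)

lemma star_add: "star (x + y) = star x + star y"
  by (auto simp: involution_def fun_eq_iff)

lemma star_single: "g \<in> carrier G \<Longrightarrow> star (single \<alpha> g) = single \<alpha> (inv g)"
  by (rule FG_eqI) (auto simp: pair_star pair_single)

lemma mul_single:
  "g \<in> carrier G \<Longrightarrow> h \<in> carrier G \<Longrightarrow> single \<alpha> g \<star> single \<beta> h = single (\<alpha> * \<beta>) (g \<otimes> h)"
  by (rule FG_eqI) (auto simp: pair_mul pair_single)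

lemma unit_mul: "x \<in> FG \<Longrightarrow> unit \<star> x = x" and mul_unit: "x \<in> FG \<Longrightarrow> x \<star> unit = x"
  by (rule FG_eqI; auto simp: pair_mul pair_single)+

lemma mul_add: "x \<star> (y + z) = x \<star> y + x \<star> z" and add_mul: "(x + y) \<star> z = x \<star> z + y \<star> z"
  by (rule FG_eqI; auto simp: pair_mul pair_add pair_add_right)+

lemma star_unit: "star unit = unit"
  by (simp add: star_single)

lemma V_iff: "x \<in> V \<longleftrightarrow> x \<in> FG \<and> pair x (\<lambda>_. 1) = 1"
  by (simp add: normalized_elements_def pair_def)

lemma aug_mul: "pair (x \<star> y) (\<lambda>_. 1) = pair x (\<lambda>_. 1) * pair y (\<lambda>_. 1)"
  using pair_scale[of x "pair y (\<lambda>_. 1)" "\<lambda>_. 1"] by (simp add: pair_mul mult.commute)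

lemma V_mul: "x \<in> V \<Longrightarrow> y \<in> V \<Longrightarrow> x \<star> y \<in> V"
  by (simp add: V_iff aug_mul)

lemma V_unit: "unit \<in> V"
  by (simp add: V_iff pair_single)

lemma monoid_algebra: "monoid (group_algebra G :: ('a \<Rightarrow> 'f) ring)"
  by (rule monoidI) (auto simp: one_eq mul_assoc unit_mul mul_unit)

text \<open>Multiplication by y from the left is injective, being undone by x, hence onto the finite
  algebra. So y has a right inverse z, and z = x by associativity.\<close>

lemma left_inverse_if_right_inverse:
  assumes "x \<in> FG" "y \<in> FG" "x \<star> y = unit"
  shows "y \<star> x = unit"
proof -
  have "inj_on (\<lambda>z. y \<star> z) FG"
  proof (rule inj_onI)
    fix z w assume z: "z \<in> FG" "w \<in> FG" "y \<star> z = y \<star> w"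
    then have "x \<star> y \<star> z = x \<star> y \<star> w" unfolding mul_assoc by simp
    then show "z = w" using z assms(3) by (simp add: unit_mul)
  qed
  then have "(\<lambda>z. y \<star> z) ` FG = FG"
    using finite_FG by (intro endo_inj_surj) auto
  moreover have "unit \<in> FG" by simp
  ultimately have "unit \<in> (\<lambda>z. y \<star> z) ` FG" by simp
  then obtain z where z: "z \<in> FG" "y \<star> z = unit" by (elim imageE) simp
  have "x \<star> y \<star> z = x" unfolding mul_assoc z(2) using assms by (simp add: mul_unit)
  then have "z = x" using assms z by (simp add: unit_mul)
  then show ?thesis using z by simp
qed

text \<open>Replaces the unit condition and the inverse by a single equation; invertibility comes
  for free because one-sided inverses are two-sided.\<close>

lemma unitary_subgroup_eq: "unitary_subgroup G = {x \<in> V. x \<star> star x = unit}"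
proof -
  interpret A: monoid "group_algebra G :: ('a \<Rightarrow> 'f) ring" by (rule monoid_algebra)
  have Units: "x \<in> Units (group_algebra G) \<and> star x = inv\<^bsub>group_algebra G\<^esub> x"
    if x: "x \<in> FG" "x \<star> star x = unit" for x
  proof -
    have l: "star x \<star> x = unit" using left_inverse_if_right_inverse[OF x(1) _ x(2)] by simp
    then have "x \<in> Units (group_algebra G)"
      unfolding Units_def one_eq mem_Collect_eq using x FG_star[of x] by blast
    then show ?thesis using A.inv_char[OF x(1) FG_star] x(2) l by (simp add: one_eq)
  qed
  have "x \<star> star x = unit"
    if "x \<in> Units (group_algebra G)" "star x = inv\<^bsub>group_algebra G\<^esub> x" for x
    using A.Units_r_inv[OF that(1)] that(2) by (simp add: one_eq)
  then show ?thesis using Units V_FG unfolding unitary_subgroup_def by blast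
qed

end

section \<open>Symmetric and alternating elements, norms, and the lower bound from
  characters\<close>

context char2_group_algebra
begin

text \<open>This is [\<alpha>, g]. It vanishes when g is its own inverse, since then the two
  summands cancel.\<close>

definition alt :: "'f \<Rightarrow> 'a \<Rightarrow> 'a \<Rightarrow> 'f" where
  "alt \<alpha> g = single \<alpha> g + single \<alpha> (inv g)"

lemma star_coeff: "g \<in> carrier G \<Longrightarrow> star x g = x (inv g)"
  by (simp add: involution_def)

lemma symmetric_coeff: "x \<in> symmetric \<Longrightarrow> g \<in> carrier G \<Longrightarrow> x (inv g) = x g"
  using star_coeff[of g x] by (simp add: symmetric_def)

lemma symmetricI: "x \<in> FG \<Longrightarrow> (\<And>g. g \<in> carrier G \<Longrightarrow> x (inv g) = x g) \<Longrightarrow> x \<in> symmetric"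
  by (auto simp: symmetric_def involution_def FG_def fun_eq_iff)

lemma inv_eq_iff_square: "g \<in> carrier G \<Longrightarrow> inv g = g \<longleftrightarrow> g \<otimes> g = \<one>"
  by (metis inv_equality r_inv)

lemma symmetric_add: "x \<in> symmetric \<Longrightarrow> y \<in> symmetric \<Longrightarrow> x + y \<in> symmetric"
  by (simp add: symmetric_def star_add)

lemma alternating_add: "x \<in> alternating \<Longrightarrow> y \<in> alternating \<Longrightarrow> x + y \<in> alternating"
  by (auto simp: alternating_def symmetric_add)

lemma symmetrization_alternating: "x \<in> FG \<Longrightarrow> x + star x \<in> alternating"
  by (auto simp: alternating_def symmetric_def star_add star_star add.commute star_coeff
      inv_eq_iff_square[symmetric])

lemma alt_eq: "g \<in> carrier G \<Longrightarrow> alt \<alpha> g = single \<alpha> g + star (single \<alpha> g)"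
  by (simp add: alt_def star_single)

lemma alt_alternating: "g \<in> carrier G \<Longrightarrow> alt \<alpha> g \<in> alternating"
  by (simp add: alt_eq symmetrization_alternating)

lemma alt_inv: "g \<in> carrier G \<Longrightarrow> alt \<alpha> (inv g) = alt \<alpha> g"
  by (simp add: alt_def add.commute)

lemma alt_square_one: "g \<in> carrier G \<Longrightarrow> g \<otimes> g = \<one> \<Longrightarrow> alt \<alpha> g = 0"
  using inv_eq_iff_square[of g] by (simp add: alt_def)

lemma alt_add: "alt (\<alpha> + \<beta>) g = alt \<alpha> g + alt \<beta> g"
  by (auto simp: alt_def single_def fun_eq_iff)

lemma alternating_subset: "alternating \<subseteq> FG" "symmetric \<subseteq> FG" "finite alternating" "finite symmetric"
  using finite_subset[OF _ finite_FG] by (auto simp: alternating_def symmetric_def)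

text \<open>The elements \<open>alt \<alpha> g\<close> span \<open>alternating\<close>: adding
  \<open>alt (s g) g\<close> clears the coefficients at g and inv g, which are different places
  because s vanishes on self-inverse elements. The support shrinks.\<close>

lemma alternating_induct [consumes 1, case_names zero add alt]:
  assumes "s \<in> alternating" "P 0" "\<And>x y. P x \<Longrightarrow> P y \<Longrightarrow> P (x + y)"
    "\<And>\<alpha> g. g \<in> carrier G \<Longrightarrow> P (alt \<alpha> g)"
  shows "P s"
  using assms(1)
proof (induction "card {g. s g \<noteq> 0}" arbitrary: s rule: less_induct)
  case less
  show ?case
  proof (cases "s = 0")
    case True
    then show ?thesis using assms(2) by simp
  next
    case False
    then obtain g where g: "s g \<noteq> 0" by (auto simp: fun_eq_iff)
    have sFG: "s \<in> FG" and sym: "s \<in> symmetric" using less.prems by (auto simp: alternating_def symmetric_def)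
    have gG: "g \<in> carrier G" using g sFG by (auto simp: FG_def)
    have "inv g \<noteq> g" using less.prems g gG inv_eq_iff_square[OF gG] by (auto simp: alternating_def)
    let ?t = "s + alt (s g) g"
    have t: "?t \<in> alternating" using less.prems gG by (intro alternating_add alt_alternating)
    have t0: "?t h = (if h = g \<or> h = inv g then 0 else s h)" for h
      using \<open>inv g \<noteq> g\<close> symmetric_coeff[OF sym gG] by (auto simp: alt_def single_def)
    have "finite {g. s g \<noteq> 0}"
      by (rule finite_subset[OF _ finG]) (use sFG in \<open>auto simp: FG_def\<close>)
    then have "card {h. ?t h \<noteq> 0} < card {h. s h \<noteq> 0}"
      unfolding t0 using g by (intro psubset_card_mono) auto
    then have "P ?t" using less.hyps t by blast
    then have "P (?t + alt (s g) g)" using assms(3,4) gG by blast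
    then show ?thesis by (simp add: add.assoc)
  qed
qed

text \<open>The homomorphism theorem as a count. Because x + x = 0, closure under addition makes a
  nonempty S a group, and adding x0 exchanges the fibre through x0 with the kernel.\<close>

lemma card_kernel_image:
  fixes f :: "('a \<Rightarrow> 'f) \<Rightarrow> ('c \<Rightarrow> 'f)"
  assumes "finite S" "\<And>x y. x \<in> S \<Longrightarrow> y \<in> S \<Longrightarrow> x + y \<in> S"
    and "\<And>x y. x \<in> S \<Longrightarrow> y \<in> S \<Longrightarrow> f (x + y) = f x + f y"
  shows "card S = card (f ` S) * card {x \<in> S. f x = 0}"
proof -
  have fd: "(u :: 'c \<Rightarrow> 'f) + v = 0 \<longleftrightarrow> u = v" for u v
    by (auto simp: fun_eq_iff) (metis add_eq_0_iff uminus_eq)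
  have fibre: "card {x \<in> S. f x = y} = card {x \<in> S. f x = 0}" if "y \<in> f ` S" for y
  proof -
    from that obtain x0 where x0: "x0 \<in> S" "y = f x0" by blast
    have "bij_betw (\<lambda>x. x0 + x) {x \<in> S. f x = y} {x \<in> S. f x = 0}"
      by (rule bij_betw_byWitness[where f' = "\<lambda>x. x0 + x"])
         (use x0 assms(2,3) fd in auto)
    then show ?thesis by (rule bij_betw_same_card)
  qed
  show ?thesis
    using card_le_fibres[OF assms(1), of f "f ` S" "card {x \<in> S. f x = 0}"]
      card_ge_fibres[OF assms(1), of "f ` S" f "card {x \<in> S. f x = 0}"] fibre assms(1)
    by (intro antisym) auto
qed

lemma alternating_eq_image: "alternating = (\<lambda>x. x + star x) ` FG"
proof
  show "alternating \<subseteq> (\<lambda>x. x + star x) ` FG"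
  proof
    fix s assume "s \<in> alternating"
    then have "\<exists>x\<in>FG. s = x + star x"
    proof (induction rule: alternating_induct)
      case zero
      then show ?case by (rule bexI[of _ 0]) (auto simp: involution_def fun_eq_iff)
    next
      case (add x y)
      then obtain u v where uv: "u \<in> FG" "x = u + star u" "v \<in> FG" "y = v + star v" by blast
      have "x + y = (u + v) + star (u + v)"
        unfolding uv star_add by (simp only: add.assoc add.left_commute)
      moreover have "u + v \<in> FG" using uv by blast
      ultimately show ?case by (rule bexI)
    next
      case (alt \<alpha> g)
      then show ?case by (intro bexI[of _ "single \<alpha> g"]) (auto simp: alt_eq)
    qed
    then show "s \<in> (\<lambda>x. x + star x) ` FG" by blast
  qed
qed (auto simp: symmetrization_alternating)

text \<open>The two spaces are image and kernel of the same additive map x + star x on the group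
  algebra.\<close>

lemma card_alternating_symmetric: "card alternating * card symmetric = card FG"
proof -
  have "{x \<in> FG. x + star x = 0} = symmetric"
    by (auto simp: symmetric_def fun_eq_iff) (metis add_eq_0_iff uminus_eq)
  then show ?thesis
    using card_kernel_image[of FG "\<lambda>x. x + star x"] finite_FG
    by (simp add: alternating_eq_image star_add add_ac)
qed

text \<open>Source of the exponent in the theorem. Restriction of symmetric elements to the
  self-inverse g is onto all functions there and has kernel \<open>alternating\<close>; multiplying
  by |\<open>symmetric\<close>| brings in |\<open>alternating\<close>| |\<open>symmetric\<close>| =
  |FG|. Stating the square avoids halving an exponent.\<close>

lemma card_symmetric_square:
  "card symmetric ^ 2 = card (UNIV :: 'f set) ^ (card (carrier G) + card {g \<in> carrier G. g \<otimes> g = \<one>})"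
proof -
  let ?\<Omega> = "{g \<in> carrier G. g \<otimes> g = \<one>}"
  let ?r = "\<lambda>x g. if g \<in> ?\<Omega> then x g else (0::'f)"
  have "?r ` symmetric = {x. \<forall>g. g \<notin> ?\<Omega> \<longrightarrow> x g = 0}"
  proof
    show "{x. \<forall>g. g \<notin> ?\<Omega> \<longrightarrow> x g = 0} \<subseteq> ?r ` symmetric"
    proof
      fix x :: "'a \<Rightarrow> 'f" assume x: "x \<in> {x. \<forall>g. g \<notin> ?\<Omega> \<longrightarrow> x g = 0}"
      have "x \<in> symmetric"
      proof (rule symmetricI)
        show "x \<in> FG" using x by (auto simp: FG_def)
        fix g assume g: "g \<in> carrier G"
        show "x (inv g) = x g"
          using x g inv_eq_iff_square[of g] inv_eq_iff_square[of "inv g"] by (cases "g \<in> ?\<Omega>") auto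
      qed
      moreover have "x = ?r x" using x by (auto simp: fun_eq_iff)
      ultimately show "x \<in> ?r ` symmetric" by blast
    qed
  qed auto
  moreover have "{x \<in> symmetric. ?r x = 0} = alternating"
    by (auto simp: alternating_def fun_eq_iff)
  moreover have "card symmetric = card (?r ` symmetric) * card {x \<in> symmetric. ?r x = 0}"
    by (rule card_kernel_image) (auto simp: alternating_subset symmetric_add fun_eq_iff)
  ultimately have "card symmetric = card (UNIV :: 'f set) ^ card ?\<Omega> * card alternating"
    using card_functions_supported_on(1)[where 'f='f, of ?\<Omega>] finG by simp
  then have "card symmetric ^ 2 = card (UNIV :: 'f set) ^ card ?\<Omega> * (card alternating * card symmetric)"
    by (simp add: power2_eq_square)
  then show ?thesis
    by (simp add: card_alternating_symmetric card_FG power_add)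
qed

lemma sum_square: "finite A \<Longrightarrow> (\<Sum>h\<in>A. (x h :: 'f) * x h) = (\<Sum>h\<in>A. x h) * (\<Sum>h\<in>A. x h)"
  by (induction A rule: finite_induct) (auto simp: algebra_simps)

text \<open>The deviation of the norm from 1, with plus for minus in characteristic 2; it is zero
  exactly for unitary x.\<close>

definition defect :: "('a \<Rightarrow> 'f) \<Rightarrow> 'a \<Rightarrow> 'f" where
  "defect x = x \<star> star x + unit"

lemma defect_zero_iff: "defect x = 0 \<longleftrightarrow> x \<star> star x = unit"
  unfolding defect_def by (metis add_0_right fun_double_zero(2) add.commute)

lemma norm_eq_defect: "x \<star> star x = unit + defect x"
  by (simp add: defect_def add.left_commute)

text \<open>At the identity the norm has the sum of the squared coefficients, which is the squared
  augmentation 1 and is cancelled by \<open>unit\<close>. At an involution g the terms belonging to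
  h and g h are equal and cancel.\<close>

lemma defect_alternating:
  assumes "x \<in> V"
  shows "defect x \<in> alternating"
proof -
  have x: "x \<in> FG" "pair x (\<lambda>_. 1) = 1" using assms by (auto simp: V_iff)
  have "defect x \<in> symmetric"
    using x by (simp add: symmetric_def defect_def star_add star_mul star_star star_unit)
  moreover have "defect x g = 0" if g: "g \<in> carrier G" "g \<otimes> g = \<one>" for g
  proof -
    have ig: "inv g = g" using g inv_eq_iff_square by blast
    have c: "(x \<star> star x) g = (\<Sum>h\<in>carrier G. x h * x (g \<otimes> h))"
      using g by (subst mul_coeff) (auto intro!: sum.cong simp: star_coeff inv_mult_group ig)
    show ?thesis
    proof (cases "g = \<one>")
      case True
      have "(x \<star> star x) g = (\<Sum>h\<in>carrier G. x h * x h)" using c True by simp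
      then show ?thesis
        using x(2) True finG by (simp add: sum_square pair_def defect_def single_def)
    next
      case False
      have gg: "g \<otimes> (g \<otimes> h) = h" if "h \<in> carrier G" for h
        using g that by (simp add: m_assoc[symmetric])
      have "(x \<star> star x) g = 0" unfolding c
        by (rule sum_involution_char2[where t = "\<lambda>h. g \<otimes> h"])
           (use finG char2 g gg False r_cancel_one in \<open>auto simp: mult.commute\<close>)
      then show ?thesis using False by (simp add: defect_def single_def)
    qed
  qed
  ultimately show ?thesis by (auto simp: alternating_def)
qed

text \<open>Of the four products with coefficient \<alpha>^2, two land on the identity and cancel;
  the other two are g and inv g.\<close>

lemma defect_trinomial:
  fixes \<alpha> :: 'f
  assumes g: "g \<in> carrier G" and y: "y \<in> carrier G"
  defines "x \<equiv> unit + single \<alpha> y + single \<alpha> (g \<otimes> y)"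
  shows "x \<in> V" and "defect x = alt \<alpha> y + alt \<alpha> (g \<otimes> y) + alt (\<alpha> * \<alpha>) g"
proof -
  show "x \<in> V" using g y by (auto simp: V_iff x_def pair_add pair_single)
  have 1: "g \<otimes> y \<otimes> inv y = g" "y \<otimes> (inv y \<otimes> inv g) = inv g"
    "g \<otimes> y \<otimes> (inv y \<otimes> inv g) = \<one>"
    using g y by (auto simp: m_assoc inv_solve_left) (simp add: m_assoc[symmetric])+
  show "defect x = alt \<alpha> y + alt \<alpha> (g \<otimes> y) + alt (\<alpha> * \<alpha>) g"
    using g y 1
    by (simp add: defect_def x_def star_add star_single mul_add add_mul mul_single alt_def
        inv_mult_group add_ac)
qed

text \<open>Fix x with defect s and let w be its inverse. Every y with defect s has the same norm as
  x, so w y has norm w (x star x) (star w) = 1. Thus no fibre of \<open>defect\<close> is larger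
  than the unitary subgroup.\<close>

lemma card_unitary_lower_fibre:
  assumes "\<And>x. x \<in> V \<Longrightarrow> \<exists>y\<in>V. y \<star> x = unit"
  shows "card V \<le> card (defect ` V) * card (unitary_subgroup G :: ('a \<Rightarrow> 'f) set)"
proof (rule card_le_fibres[where f = defect])
  have finV: "finite V" using finite_FG V_FG finite_subset[of V FG] by blast
  then show "finite V" "finite (defect ` V)" by auto
  fix s assume "s \<in> defect ` V"
  then obtain x where x: "x \<in> V" "s = defect x" by blast
  obtain w where w: "w \<in> V" "w \<star> x = unit" using assms x by blast
  have xw: "x \<star> w = unit" using left_inverse_if_right_inverse w x V_FG by blast
  show "card {y \<in> V. defect y = s} \<le> card (unitary_subgroup G :: ('a \<Rightarrow> 'f) set)"
  proof (rule card_inj_on_le)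
    show "inj_on (\<lambda>y. w \<star> y) {y \<in> V. defect y = s}"
    proof (rule inj_onI)
      fix y z assume yz: "y \<in> {y \<in> V. defect y = s}" "z \<in> {y \<in> V. defect y = s}" "w \<star> y = w \<star> z"
      then have "x \<star> w \<star> y = x \<star> w \<star> z" unfolding mul_assoc by simp
      then show "y = z" using yz xw by (simp add: unit_mul V_FG)
    qed
    show "(\<lambda>y. w \<star> y) ` {y \<in> V. defect y = s} \<subseteq> unitary_subgroup G"
    proof (rule image_subsetI)
      fix y assume "y \<in> {y \<in> V. defect y = s}"
      then have y: "y \<in> V" "defect y = s" by auto
      then have "y \<star> star y = x \<star> star x" using x by (metis norm_eq_defect)
      have "w \<star> y \<star> star (w \<star> y) = w \<star> (y \<star> star y) \<star> star w"
        by (simp add: star_mul mul_assoc)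
      also have "\<dots> = w \<star> (x \<star> star x) \<star> star w"
        by (simp only: \<open>y \<star> star y = x \<star> star x\<close>)
      also have "\<dots> = w \<star> x \<star> star (w \<star> x)" by (simp add: star_mul mul_assoc)
      also have "\<dots> = unit" using w by (simp add: star_unit unit_mul)
      finally show "w \<star> y \<in> unitary_subgroup G" using w y by (simp add: unitary_subgroup_eq V_mul)
    qed
    show "finite (unitary_subgroup G :: ('a \<Rightarrow> 'f) set)"
      using finV by (simp add: unitary_subgroup_eq)
  qed
qed auto

lemma card_FG_le_V: "card FG \<le> card (UNIV :: 'f set) * card V"
proof (rule card_le_fibres[where f = "\<lambda>x. pair x (\<lambda>_. 1)"])
  fix \<alpha> :: 'f
  show "card {x \<in> FG. pair x (\<lambda>_. 1) = \<alpha>} \<le> card V"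
  proof (rule card_inj_on_le[where f = "\<lambda>x. single (\<alpha> + 1) \<one> + x"])
    show "inj_on (\<lambda>x. single (\<alpha> + 1) \<one> + x) {x \<in> FG. pair x (\<lambda>_. 1) = \<alpha>}" by (rule inj_onI) simp
    show "finite V" using finite_FG V_FG finite_subset[of V FG] by blast
  qed (auto simp: V_iff pair_add pair_single add_ac)
qed (auto simp: finite_FG)

text \<open>Let C j be the sum of the coefficients of x on f = j. On f = 1 the coefficients of the
  norm add up to the sum of C i C j over i - j = 1 mod 4, which factors as (C 1 + C 3)(C 0 + C 2).
  Augmentation 1 turns the second factor into t + 1 with t = C 1 + C 3. The summand
  \<open>unit\<close> of the defect sits on f = 0 and does not contribute.\<close>

lemma pair_char_defect:
  assumes x: "x \<in> V" and f: "\<And>g h. g \<in> carrier G \<Longrightarrow> h \<in> carrier G \<Longrightarrow> f (g \<otimes> h) = (f g + f h) mod (4::int)"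
  shows "pair (defect x) (\<lambda>k. if f k = 1 then 1 else 0) \<in> range (\<lambda>t. t * t + t)"
proof -
  define C where "C j = pair x (\<lambda>h. if f h = j then 1 else 0)" for j
  have range: "f g \<in> {0, 1, 2, 3}" if "g \<in> carrier G" for g
  proof -
    have "f g = (f g + f \<one>) mod 4" using f[of g \<one>] that by simp
    then have "0 \<le> f g \<and> f g < 4" by (metis pos_mod_bound pos_mod_sign zero_less_numeral)
    then show ?thesis by auto
  qed
  have f1: "f \<one> = 0" using f[of \<one> \<one>] range[of \<one>] by auto
  have inv: "f (inv g) = (- f g) mod 4" if "g \<in> carrier G" for g
    using f[of g "inv g"] f1 range[of "inv g"] range[of g] that by auto
  have *: "(if f (a \<otimes> inv b) = 1 then 1 else (0::'f)) =
      (if f a = 1 then 1 else 0) * (if f b = 0 then 1 else 0) + ((if f a = 2 then 1 else 0) * (if f b = 1 then 1 else 0)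
    + ((if f a = 3 then 1 else 0) * (if f b = 2 then 1 else 0) + (if f a = 0 then 1 else 0) * (if f b = 3 then 1 else 0)))"
    if "a \<in> carrier G" "b \<in> carrier G" for a b
    using range[OF that(1)] range[OF that(2)] by (auto simp: f inv that)
  have comm: "pair x (\<lambda>a. \<psi> a * \<alpha>) = \<alpha> * pair x \<psi>" for \<psi> \<alpha>
    using pair_scale[of x \<alpha> \<psi>] by (simp add: mult.commute)
  have "pair (x \<star> star x) (\<lambda>k. if f k = 1 then 1 else 0) = C 0 * C 1 + (C 1 * C 2 + (C 2 * C 3 + C 3 * C 0))"
    by (simp add: pair_mul pair_star * pair_add_right pair_scale comm C_def[symmetric] del: mult_zero_left)
  also have "\<dots> = (C 1 + C 3) * (C 0 + C 2)" by (simp add: algebra_simps)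
  also have "C 0 + C 2 = 1 + (C 1 + C 3)"
  proof -
    have "pair x (\<lambda>h. (1::'f)) = pair x (\<lambda>h. (if f h = 0 then 1 else 0) + ((if f h = 1 then 1 else 0)
       + ((if f h = 2 then 1 else 0) + (if f h = 3 then 1 else 0))))"
      by (rule pair_cong) (use range in auto)
    then have "1 = C 0 + (C 1 + (C 2 + C 3))"
      using x by (simp add: V_iff pair_add_right C_def)
    moreover have "C 0 + C 2 = C 0 + (C 1 + (C 2 + C 3)) + (C 1 + C 3)" by (simp add: add_ac)
    ultimately show ?thesis by simp
  qed
  finally have "pair (x \<star> star x) (\<lambda>k. if f k = 1 then 1 else 0) = (C 1 + C 3) * (C 1 + C 3) + (C 1 + C 3)"
    by (simp add: algebra_simps)
  then have "pair (defect x) (\<lambda>k. if f k = 1 then 1 else 0) = (C 1 + C 3) * (C 1 + C 3) + (C 1 + C 3)"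
    unfolding defect_def pair_add by (subst pair_single) (simp_all add: f1)
  then show ?thesis by blast
qed

lemma range_square_add: "u \<in> range (\<lambda>t. t * t + t) \<Longrightarrow> v \<in> range (\<lambda>t. t * t + t) \<Longrightarrow> (u::'f) + v \<in> range (\<lambda>t. t * t + t)"
proof clarify
  fix s t :: 'f
  have "s * s + s + (t * t + t) = (s + t) * (s + t) + (s + t)" by (simp add: algebra_simps)
  then show "s * s + s + (t * t + t) \<in> range (\<lambda>t. t * t + t)" by blast
qed

text \<open>If e + defect x = e' + defect x' with e \<noteq> e', then e + e' is a sum of two
  defects, so each character into \<int>/4 assigns to it a value t^2 + t, contrary to
  \<open>sep\<close>. Hence the translates of the set of defects by W are disjoint subsets of
  \<open>alternating\<close>, which bounds the number of defects from above and the size of their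
  fibres from below.\<close>

lemma card_unitary_lower:
  assumes units: "\<And>x. x \<in> V \<Longrightarrow> \<exists>y\<in>V. y \<star> x = unit"
    and W: "W \<subseteq> alternating"
    and sep: "\<And>e e'. e \<in> W \<Longrightarrow> e' \<in> W \<Longrightarrow> e \<noteq> e' \<Longrightarrow>
      \<exists>f. (\<forall>g\<in>carrier G. \<forall>h\<in>carrier G. f (g \<otimes> h) = (f g + f h) mod (4::int)) \<and>
        pair (e + e') (\<lambda>k. if f k = 1 then 1 else 0) \<notin> range (\<lambda>t. t * t + t)"
  shows "card W * card symmetric \<le> card (UNIV :: 'f set) * card (unitary_subgroup G :: ('a \<Rightarrow> 'f) set)"
proof -
  have "card (W \<times> defect ` V) \<le> card alternating"
  proof (rule card_inj_on_le[where f = "\<lambda>(e, s). e + s"])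
    show "(\<lambda>(e, s). e + s) ` (W \<times> defect ` V) \<subseteq> alternating"
      using W defect_alternating alternating_add by auto
    show "inj_on (\<lambda>(e, s). e + s) (W \<times> defect ` V)"
    proof (rule inj_onI, clarify)
      fix e x e' x' assume e: "e \<in> W" "e' \<in> W" and x: "x \<in> V" "x' \<in> V" and eq: "e + defect x = e' + defect x'"
      have eq': "e + e' = defect x + defect x'"
        using arg_cong[OF eq, of "\<lambda>u. u + defect x + e'"] by (simp add: add_ac)
      show "e = e' \<and> defect x = defect x'"
      proof (cases "e = e'")
        case False
        from sep[OF e False] obtain f
          where f: "\<forall>g\<in>carrier G. \<forall>h\<in>carrier G. f (g \<otimes> h) = (f g + f h) mod (4::int)"
          and n: "pair (e + e') (\<lambda>k. if f k = 1 then 1 else 0) \<notin> range (\<lambda>t. t * t + t)" by blast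
        have "pair (e + e') (\<lambda>k. if f k = 1 then 1 else 0) \<in> range (\<lambda>t. t * t + t)"
          unfolding eq' pair_add using f x by (intro range_square_add pair_char_defect) auto
        then show ?thesis using n by simp
      qed (use eq in simp)
    qed
  qed (simp add: alternating_subset)
  then have 1: "card W * card (defect ` V) \<le> card alternating" by (simp add: card_cartesian_product)
  let ?S = "card (defect ` V)" and ?U = "card (unitary_subgroup G :: ('a \<Rightarrow> 'f) set)" and ?q = "card (UNIV :: 'f set)"
  have "?S * (card W * card symmetric) \<le> card alternating * card symmetric"
    using mult_right_mono[OF 1, of "card symmetric"] by (simp add: mult.assoc mult.left_commute)
  also have "\<dots> \<le> ?q * card V" using card_alternating_symmetric card_FG_le_V by simp
  also have "\<dots> \<le> ?q * (?S * ?U)" using card_unitary_lower_fibre[OF units] by simp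
  finally have "?S * (card W * card symmetric) \<le> ?S * (?q * ?U)" by (simp add: mult.left_commute)
  moreover have "?S > 0"
    using V_unit finite_FG V_FG finite_subset[of V FG] by (subst card_gt_0_iff) blast
  ultimately show ?thesis by simp
qed

end

section \<open>Central involutions\<close>

context char2_group_algebra
begin

text \<open>Squaring is additive with trivial kernel in characteristic 2, hence bijective on a
  finite field.\<close>

lemma exists_sqrt: "\<exists>\<beta>::'f. \<alpha> = \<beta> * \<beta>"
proof -
  have "inj (\<lambda>\<beta>::'f. \<beta> * \<beta>)"
  proof (rule injI)
    fix \<beta> \<gamma> :: 'f assume "\<beta> * \<beta> = \<gamma> * \<gamma>"
    then have "(\<beta> + \<gamma>) * (\<beta> + \<gamma>) = 0" by (simp add: algebra_simps)
    then show "\<beta> = \<gamma>" by (metis add_eq_0_iff mult_eq_0_iff uminus_eq)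
  qed
  then have "surj (\<lambda>\<beta>::'f. \<beta> * \<beta>)" by (simp add: finite_UNIV_inj_surj)
  then show ?thesis by (metis surjD)
qed

lemma add_eq_zero_iff: "(\<alpha>::'f) + \<beta> = 0 \<longleftrightarrow> \<alpha> = \<beta>"
  by (auto simp: add_eq_0_iff)

text \<open>Each value of t^2 + t is taken exactly at some s and s + 1, so the range has half the
  size of the field. It is closed under addition, and therefore its translate by any missing
  \<gamma> is the other half.\<close>

lemma artin_schreier_complement:
  obtains \<gamma> :: 'f where "\<gamma> \<notin> range (\<lambda>t. t * t + t)"
    "\<And>\<beta>. \<beta> \<in> range (\<lambda>t. t * t + t) \<or> \<beta> + \<gamma> \<in> range (\<lambda>t. t * t + t)"
proof -
  let ?p = "\<lambda>t::'f. t * t + t"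
  let ?P = "range ?p"
  have fib: "card {x \<in> UNIV. ?p x = y} = 2" if y: "y \<in> ?P" for y
  proof -
    obtain s where s: "y = ?p s" using y by blast
    have "?p x = ?p s \<longleftrightarrow> x = s \<or> x = s + 1" for x
    proof -
      have "?p x + ?p s = (x + s) * (x + (s + 1))" by (simp add: algebra_simps)
      then have "?p x = ?p s \<longleftrightarrow> (x + s) * (x + (s + 1)) = 0"
        by (simp only: add_eq_zero_iff[of "?p x", symmetric])
      then show ?thesis by (simp only: mult_eq_0_iff add_eq_zero_iff)
    qed
    then have "{x \<in> UNIV. ?p x = y} = {s, s + 1}" using s by auto
    then show ?thesis by simp
  qed
  have le: "card (UNIV :: 'f set) \<le> card ?P * 2"
    by (rule card_le_fibres[OF finite _ finite eq_refl[OF fib]]) simp_all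
  have ge: "card ?P * 2 \<le> card (UNIV :: 'f set)"
    by (rule card_ge_fibres[OF finite order.refl eq_refl[OF fib[symmetric]]])
  have pos: "card ?P > 0" by (subst card_gt_0_iff) simp
  have "?P \<noteq> UNIV"
  proof
    assume "?P = UNIV"
    then have "card ?P = card (UNIV :: 'f set)" by (rule arg_cong)
    then show False using ge pos by linarith
  qed
  then obtain \<gamma> where \<gamma>: "\<gamma> \<notin> ?P" by blast
  let ?Q = "(\<lambda>v. v + \<gamma>) ` ?P"
  have disj: "?P \<inter> ?Q = {}"
  proof (rule ccontr)
    assume "?P \<inter> ?Q \<noteq> {}"
    then obtain u where u: "u \<in> ?P" "u \<in> ?Q" by (elim ex_in_conv[THEN iffD2, THEN exE] IntE)
    from u(2) obtain v where v: "u = v + \<gamma>" "v \<in> ?P" by (rule imageE)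
    have "v + (v + \<gamma>) \<in> ?P" by (rule range_square_add[OF v(2) u(1)[unfolded v(1)]])
    then show False using \<gamma> by (simp only: double_zero_left)
  qed
  have "card ?Q = card ?P" by (rule card_image) (simp add: inj_on_def)
  then have "card (?P \<union> ?Q) = card ?P * 2" using card_Un_disjoint[OF _ _ disj] by simp
  then have U: "?P \<union> ?Q = UNIV" using le by (intro card_seteq) auto
  show thesis
  proof (rule that[OF \<gamma>])
    fix \<beta>
    have "\<beta> \<in> ?P \<or> \<beta> \<in> ?Q" using U by blast
    then show "\<beta> \<in> ?P \<or> \<beta> + \<gamma> \<in> ?P"
    proof
      assume "\<beta> \<in> ?Q"
      then obtain v where "\<beta> = v + \<gamma>" "v \<in> ?P" by (rule imageE)
      then have "\<beta> + \<gamma> \<in> ?P" by (simp only: add.assoc double_zero add_0_right)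
      then show ?thesis ..
    qed blast
  qed
qed

end

text \<open>The last assumption says that G modulo c is abelian; that c is central follows from
  it.\<close>

locale char2_central_involution = char2_group_algebra G F
  for G :: "('a, 'b) monoid_scheme" (structure) and F :: "'f::{field,finite} itself" +
  fixes c :: 'a
  assumes c: "c \<in> carrier G" "c \<otimes> c = \<one>" "c \<noteq> \<one>"
    and commutators: "\<And>g h. g \<in> carrier G \<Longrightarrow> h \<in> carrier G \<Longrightarrow> g \<otimes> h = h \<otimes> g \<or> g \<otimes> h = c \<otimes> (h \<otimes> g)"
begin

text \<open>The alternative c g = c (g c) would cancel to c = 1.\<close>

lemma c_central: "g \<in> carrier G \<Longrightarrow> c \<otimes> g = g \<otimes> c"
  using commutators[OF c(1), of g] r_cancel_one[of "g \<otimes> c" c] c by auto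

lemma c_cancel: "g \<in> carrier G \<Longrightarrow> c \<otimes> (c \<otimes> g) = g"
  using c by (simp add: m_assoc[symmetric])

lemma c_left_commute: "g \<in> carrier G \<Longrightarrow> h \<in> carrier G \<Longrightarrow> g \<otimes> (c \<otimes> h) = c \<otimes> (g \<otimes> h)"
  using c c_central[of g] by (simp add: m_assoc[symmetric])

lemma c_neq: "g \<in> carrier G \<Longrightarrow> c \<otimes> g \<noteq> g"
  using c r_cancel_one[of g c] by blast

lemma inv_c: "inv c = c"
  using c inv_eq_iff_square[of c] by simp

lemma inv_c_mult: "g \<in> carrier G \<Longrightarrow> inv (c \<otimes> g) = c \<otimes> inv g"
  using c c_central[of "inv g"] by (simp add: inv_mult_group inv_c)

text \<open>Moving g past t twice produces the factor c either never or twice, and c c = 1.\<close>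

lemma square_central:
  assumes t: "t \<in> carrier G" and g: "g \<in> carrier G"
  shows "g \<otimes> (t \<otimes> t) = t \<otimes> t \<otimes> g"
  using commutators[OF g t]
proof
  assume e: "g \<otimes> t = t \<otimes> g"
  have "g \<otimes> (t \<otimes> t) = t \<otimes> g \<otimes> t" using t g by (simp add: m_assoc[symmetric] e)
  then show ?thesis using t g by (simp add: e m_assoc)
next
  assume e: "g \<otimes> t = c \<otimes> (t \<otimes> g)"
  have "g \<otimes> (t \<otimes> t) = g \<otimes> t \<otimes> t" using t g by (simp add: m_assoc)
  also have "\<dots> = c \<otimes> (t \<otimes> g) \<otimes> t" by (simp only: e)
  also have "\<dots> = c \<otimes> (t \<otimes> (g \<otimes> t))" using t g c by (simp add: m_assoc)
  also have "\<dots> = t \<otimes> t \<otimes> g" using t g c by (simp add: e c_left_commute[of t] c_cancel m_assoc)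
  finally show ?thesis .
qed

text \<open>The ideal generated by 1 + c, which is the kernel of the projection to the group algebra
  of G modulo c; see \<open>push_zero_iff\<close>.\<close>

definition invariant :: "('a \<Rightarrow> 'f) set" where
  "invariant = {e \<in> FG. \<forall>g\<in>carrier G. e (c \<otimes> g) = e g}"

text \<open>The normalized elements whose image modulo c is unitary.\<close>

definition lifts :: "('a \<Rightarrow> 'f) set" where
  "lifts = {x \<in> V. defect x \<in> invariant}"

lemma invariant_FG: "e \<in> invariant \<Longrightarrow> e \<in> FG"
  by (simp add: invariant_def)

lemma invariant_coeff: "e \<in> invariant \<Longrightarrow> g \<in> carrier G \<Longrightarrow> e (c \<otimes> g) = e g"
  by (simp add: invariant_def)

lemma invariant_add: "e \<in> invariant \<Longrightarrow> e' \<in> invariant \<Longrightarrow> e + e' \<in> invariant"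
  by (auto simp: invariant_def)

lemma invariant_zero: "0 \<in> invariant"
  by (simp add: invariant_def)

lemma pair_invariant_zero:
  assumes "e \<in> invariant" "\<And>g. g \<in> carrier G \<Longrightarrow> \<phi> (c \<otimes> g) = \<phi> g"
  shows "pair e \<phi> = 0"
  unfolding pair_def
  by (rule sum_involution_char2[where t = "\<lambda>h. c \<otimes> h"])
     (use assms finG char2 c c_cancel c_neq in \<open>auto simp: invariant_coeff\<close>)

lemma pair_invariant_shift: "e \<in> invariant \<Longrightarrow> pair e (\<lambda>g. \<phi> (c \<otimes> g)) = pair e \<phi>"
  using pair_reindex[OF bij_left[OF c(1)], of e e \<phi>] by (simp add: invariant_coeff)

text \<open>This is (1 + c)^2 = 0. In terms of sums, the inner sum does not change when the outer
  variable a is replaced by c a, so the terms for a and c a cancel.\<close>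

lemma invariant_mul_invariant:
  assumes "e \<in> invariant" "e' \<in> invariant"
  shows "e \<star> e' = 0"
proof (rule FG_eqI)
  fix \<phi>
  have "pair e (\<lambda>a. pair e' (\<lambda>b. \<phi> (a \<otimes> b))) = 0"
  proof (rule pair_invariant_zero[OF assms(1)])
    fix g assume g: "g \<in> carrier G"
    have "pair e' (\<lambda>b. \<phi> (c \<otimes> g \<otimes> b)) = pair e' (\<lambda>b. \<phi> (g \<otimes> (c \<otimes> b)))"
      by (rule pair_cong) (use g c c_left_commute in \<open>simp add: m_assoc\<close>)
    also have "\<dots> = pair e' (\<lambda>b. \<phi> (g \<otimes> b))"
      by (rule pair_invariant_shift[OF assms(2), of "\<lambda>b. \<phi> (g \<otimes> b)"])
    finally show "pair e' (\<lambda>b. \<phi> (c \<otimes> g \<otimes> b)) = pair e' (\<lambda>b. \<phi> (g \<otimes> b))" .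
  qed
  then show "pair (e \<star> e') \<phi> = pair 0 \<phi>" unfolding pair_mul by (simp add: pair_def)
qed auto

lemma invariant_conj:
  assumes e: "e \<in> invariant" and a: "a \<in> carrier G" and h: "h \<in> carrier G"
  shows "e (a \<otimes> h \<otimes> inv a) = e h"
proof -
  have "a \<otimes> h \<otimes> inv a = h \<or> a \<otimes> h \<otimes> inv a = c \<otimes> h"
    using commutators[OF a h] a h c by (metis inv_closed m_assoc m_closed r_inv r_one)
  then show ?thesis using invariant_coeff[OF e h] by auto
qed

text \<open>Conjugation sends h to h or c h, where an invariant element has equal coefficients; so
  invariant elements are central in the group algebra.\<close>

lemma invariant_commute:
  assumes e: "e \<in> invariant"
  shows "x \<star> e = e \<star> x"
proof (rule FG_eqI)
  fix \<phi>
  have "pair e (\<lambda>b. \<phi> (a \<otimes> b)) = pair e (\<lambda>b. \<phi> (b \<otimes> a))" if a: "a \<in> carrier G" for a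
  proof -
    have "pair e (\<lambda>b. \<phi> (b \<otimes> a)) = pair e (\<lambda>h. \<phi> (a \<otimes> h \<otimes> inv a \<otimes> a))"
      by (rule pair_reindex[OF bij_conj[OF a], of e e]) (use e a invariant_conj in auto)
    also have "\<dots> = pair e (\<lambda>b. \<phi> (a \<otimes> b))"
      by (rule pair_cong) (use a in \<open>simp add: m_assoc\<close>)
    finally show ?thesis by simp
  qed
  then have "pair (x \<star> e) \<phi> = pair x (\<lambda>a. pair e (\<lambda>b. \<phi> (b \<otimes> a)))"
    unfolding pair_mul by (rule pair_cong)
  then show "pair (x \<star> e) \<phi> = pair (e \<star> x) \<phi>" unfolding pair_mul[of e] pair_swap[of e] .
qed auto

lemma lifts_V: "x \<in> lifts \<Longrightarrow> x \<in> V" "x \<in> lifts \<Longrightarrow> x \<in> FG" "finite lifts"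
proof -
  show "finite lifts" by (rule finite_subset[OF _ finite_FG]) (auto simp: lifts_def V_FG)
qed (auto simp: lifts_def V_FG)

text \<open>Since e is central, the product is e (1 + defect x), and e times the invariant element
  defect x is zero.\<close>

lemma lifts_conj: "x \<in> lifts \<Longrightarrow> e \<in> invariant \<Longrightarrow> x \<star> e \<star> star x = e"
proof -
  assume x: "x \<in> lifts" and e: "e \<in> invariant"
  have "x \<star> e \<star> star x = e \<star> (unit + defect x)"
    unfolding invariant_commute[OF e] mul_assoc norm_eq_defect ..
  also have "\<dots> = e + e \<star> defect x" using e by (simp add: mul_add mul_unit invariant_FG)
  also have "e \<star> defect x = 0" using x e by (intro invariant_mul_invariant) (auto simp: lifts_def)
  finally show ?thesis by simp
qed

text \<open>The gain from restricting to \<open>lifts\<close>: in x (1 + defect y) (star x) the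
  conjugation leaves defect y unchanged.\<close>

lemma defect_mul:
  assumes x: "x \<in> lifts" and y: "y \<in> lifts"
  shows "defect (x \<star> y) = defect x + defect y" and "x \<star> y \<in> lifts"
proof -
  have "x \<star> y \<star> star (x \<star> y) = x \<star> (y \<star> star y) \<star> star x" by (simp add: star_mul mul_assoc)
  also have "\<dots> = x \<star> star x + x \<star> defect y \<star> star x"
    unfolding norm_eq_defect[of y] using x by (simp add: mul_add add_mul mul_unit lifts_V)
  also have "x \<star> defect y \<star> star x = defect y" using x y by (intro lifts_conj) (auto simp: lifts_def)
  finally have n: "x \<star> y \<star> star (x \<star> y) = x \<star> star x + defect y" .
  show d: "defect (x \<star> y) = defect x + defect y"
    unfolding defect_def[of "x \<star> y"] n defect_def[of x] by (simp only: add_ac)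
  show "x \<star> y \<in> lifts" using x y by (auto simp: lifts_def V_mul d invariant_add)
qed

definition defects :: "('a \<Rightarrow> 'f) set" where
  "defects = defect ` lifts"

lemma defects_add: "s \<in> defects \<Longrightarrow> t \<in> defects \<Longrightarrow> s + t \<in> defects"
proof -
  assume "s \<in> defects" "t \<in> defects"
  then obtain x y where xy: "x \<in> lifts" "s = defect x" "y \<in> lifts" "t = defect y"
    unfolding defects_def by blast
  have "s + t = defect (x \<star> y)" using defect_mul(1)[OF xy(1,3)] xy(2,4) by simp
  then show "s + t \<in> defects" unfolding defects_def using defect_mul(2)[OF xy(1,3)] by (rule image_eqI)
qed

lemma defects_zero: "0 \<in> defects"
proof -
  have d: "defect unit = 0" by (simp add: defect_zero_iff star_unit unit_mul)
  have "unit \<in> lifts" unfolding lifts_def by (simp add: d V_unit invariant_zero)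
  then show ?thesis unfolding defects_def using d by (metis imageI)
qed

lemma defectsI: "x \<in> V \<Longrightarrow> defect x = s \<Longrightarrow> s \<in> invariant \<Longrightarrow> s \<in> defects"
  unfolding defects_def lifts_def by blast

text \<open>The norm 1 + defect x is its own inverse because invariant elements square to zero, so
  \<open>star x\<close> times the norm is a right inverse of x.\<close>

lemma lifts_inverse:
  assumes "x \<in> lifts"
  obtains w where "w \<in> FG" "w \<star> x = unit"
proof -
  have d: "defect x \<in> invariant" "defect x \<in> FG" and xF: "x \<in> FG"
    using assms by (auto simp: lifts_def invariant_FG V_FG)
  have "x \<star> (star x \<star> (unit + defect x)) = (unit + defect x) \<star> (unit + defect x)"
    by (simp only: mul_assoc[symmetric] norm_eq_defect)
  also have "\<dots> = unit + defect x + (defect x + defect x \<star> defect x)"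
    unfolding mul_add add_mul using d by (simp add: mul_unit unit_mul)
  also have "\<dots> = unit" using invariant_mul_invariant[OF d(1) d(1)] by (simp add: add.assoc)
  finally have r: "x \<star> (star x \<star> (unit + defect x)) = unit" .
  have "star x \<star> (unit + defect x) \<star> x = unit"
    by (rule left_inverse_if_right_inverse[OF xF FG_mul r])
  then show thesis using that by blast
qed

text \<open>Unitary elements have defect 0, so the fibre of \<open>defect\<close> through a lift x
  contains all x v with v unitary. Fibres are bounded from below here, which yields an upper bound
  for the unitary subgroup.\<close>

lemma card_unitary_defects:
  "card defects * card (unitary_subgroup G :: ('a \<Rightarrow> 'f) set) \<le> card lifts"
proof (rule card_ge_fibres[where f = defect])
  fix s assume "s \<in> defects"
  then obtain x where x: "x \<in> lifts" "s = defect x" by (auto simp: defects_def)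
  obtain w where w: "w \<star> x = unit" using lifts_inverse[OF x(1)] by blast
  show "card (unitary_subgroup G :: ('a \<Rightarrow> 'f) set) \<le> card {y \<in> lifts. defect y = s}"
  proof (rule card_inj_on_le[where f = "\<lambda>v. x \<star> v"])
    show "inj_on (\<lambda>v. x \<star> v) (unitary_subgroup G :: ('a \<Rightarrow> 'f) set)"
    proof (rule inj_onI)
      fix y z :: "'a \<Rightarrow> 'f" assume yz: "y \<in> unitary_subgroup G" "z \<in> unitary_subgroup G" "x \<star> y = x \<star> z"
      then have "w \<star> x \<star> y = w \<star> x \<star> z" unfolding mul_assoc by simp
      then show "y = z" using yz w by (simp add: unit_mul V_FG unitary_subgroup_eq)
    qed
    show "(\<lambda>v. x \<star> v) ` (unitary_subgroup G :: ('a \<Rightarrow> 'f) set) \<subseteq> {y \<in> lifts. defect y = s}"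
    proof (rule image_subsetI)
      fix v :: "'a \<Rightarrow> 'f" assume "v \<in> unitary_subgroup G"
      then have v: "v \<in> V" "defect v = 0" by (auto simp: unitary_subgroup_eq defect_zero_iff)
      then have "v \<in> lifts" by (simp add: lifts_def invariant_zero)
      then show "x \<star> v \<in> {y \<in> lifts. defect y = s}" using defect_mul[OF x(1)] x v by simp
    qed
  qed (simp add: lifts_V)
qed (auto simp: lifts_V defects_def)

section \<open>Generators of the admissible defects modulo c, and which of them are attained\<close>

lemma alt_invariant:
  assumes g: "g \<in> carrier G" and gg: "g \<otimes> g = c"
  shows "alt \<alpha> g \<in> invariant" and "inv g = c \<otimes> g"
proof -
  have "c \<otimes> g \<otimes> g = \<one>" using g gg c by (simp add: m_assoc)
  then show i: "inv g = c \<otimes> g" using g c by (simp add: inv_equality)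
  have "c \<otimes> h = g \<longleftrightarrow> h = c \<otimes> g" "c \<otimes> h = c \<otimes> g \<longleftrightarrow> h = g" if "h \<in> carrier G" for h
    using that g c c_cancel by auto
  then show "alt \<alpha> g \<in> invariant"
    using g c by (auto simp: invariant_def alt_def i) (auto simp: single_def)
qed

text \<open>The excluded values of g g are exactly those for which two of the four elements g, inv
  g, c g, c inv g coincide.\<close>

lemma alt_pair_coeff:
  assumes g: "g \<in> carrier G" and gg: "g \<otimes> g \<noteq> c" "g \<otimes> g \<noteq> \<one>"
  shows "(alt \<alpha> g + alt \<alpha> (c \<otimes> g)) h = (if h \<in> {g, inv g, c \<otimes> g, c \<otimes> inv g} then \<alpha> else 0)"
proof -
  have 1: "inv g \<noteq> g" using inv_eq_iff_square[OF g] gg by auto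
  have 2: "inv g \<noteq> c \<otimes> g"
  proof
    assume "inv g = c \<otimes> g"
    then have "c \<otimes> (g \<otimes> g) = \<one>" using l_inv[OF g] g c by (simp add: m_assoc)
    then have "c \<otimes> (c \<otimes> (g \<otimes> g)) = c" using c by simp
    then show False using gg g by (simp add: c_cancel)
  qed
  have 3: "c \<otimes> inv g \<noteq> g"
  proof
    assume "c \<otimes> inv g = g"
    then have "c \<otimes> (c \<otimes> inv g) = c \<otimes> g" by simp
    then show False using 2 g by (simp add: c_cancel)
  qed
  have 4: "c \<otimes> g \<noteq> g" "c \<otimes> inv g \<noteq> inv g" "c \<otimes> inv g \<noteq> c \<otimes> g"
    using g c 1 c_neq by auto
  have "(single \<alpha> p + single \<alpha> q + (single \<alpha> r + single \<alpha> s)) h = (if h \<in> {p, q, r, s} then \<alpha> else 0)"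
    if "q \<noteq> p" "r \<noteq> p" "s \<noteq> p" "q \<noteq> r" "s \<noteq> q" "s \<noteq> r" for p q r s :: 'a
    using that by (simp add: single_def)
  from this[OF 1 4(1) 3 2 4(2,3)] show ?thesis unfolding alt_def inv_c_mult[OF g] .
qed

lemma alt_pair_invariant:
  assumes g: "g \<in> carrier G"
  shows "alt \<alpha> g + alt \<alpha> (c \<otimes> g) \<in> invariant"
proof -
  have eq: "alt \<alpha> g + alt \<alpha> (c \<otimes> g) =
      single \<alpha> g + single \<alpha> (c \<otimes> g) + (single \<alpha> (inv g) + single \<alpha> (c \<otimes> inv g))"
    unfolding alt_def inv_c_mult[OF g] by (rule ext) (simp add: add_ac)
  have "single \<alpha> k + single \<alpha> (c \<otimes> k) \<in> invariant" if k: "k \<in> carrier G" for k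
  proof -
    have "c \<otimes> h = k \<longleftrightarrow> h = c \<otimes> k" "c \<otimes> h = c \<otimes> k \<longleftrightarrow> h = k" if "h \<in> carrier G" for h
      using that k c c_cancel by auto
    then have "(single \<alpha> k + single \<alpha> (c \<otimes> k)) (c \<otimes> h) = (single \<alpha> k + single \<alpha> (c \<otimes> k)) h" if "h \<in> carrier G" for h
      using that by (simp add: single_def add.commute)
    moreover have "single \<alpha> k + single \<alpha> (c \<otimes> k) \<in> FG" using k c by (intro FG_add FG_single) auto
    ultimately show ?thesis unfolding invariant_def by blast
  qed
  from invariant_add[OF this[OF g] this[OF inv_closed[OF g]]] show ?thesis unfolding eq .
qed

text \<open>A symmetric invariant element is constant on the set made of g, inv g and their shifts
  by c. If g g = c this set has two elements and a single \<open>alt\<close> clears it; otherwise it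
  has four, cleared by a sum of two. The support shrinks as in
  \<open>alternating_induct\<close>.\<close>

lemma alternating_invariant_induct [consumes 2, case_names zero add alt pair]:
  assumes "s \<in> alternating" "s \<in> invariant" "P 0" "\<And>x y. P x \<Longrightarrow> P y \<Longrightarrow> P (x + y)"
    "\<And>\<alpha> g. g \<in> carrier G \<Longrightarrow> g \<otimes> g = c \<Longrightarrow> P (alt \<alpha> g)"
    "\<And>\<alpha> g. g \<in> carrier G \<Longrightarrow> P (alt \<alpha> g + alt \<alpha> (c \<otimes> g))"
  shows "P s"
  using assms(1,2)
proof (induction "card {g. s g \<noteq> 0}" arbitrary: s rule: less_induct)
  case less
  show ?case
  proof (cases "s = 0")
    case True
    then show ?thesis using assms(3) by simp
  next
    case False
    then obtain g where g: "s g \<noteq> 0" by (auto simp: fun_eq_iff)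
    have sFG: "s \<in> FG" and sym: "s \<in> symmetric" using less.prems by (auto simp: alternating_def symmetric_def)
    have gG: "g \<in> carrier G" using g sFG by (auto simp: FG_def)
    have gg: "g \<otimes> g \<noteq> \<one>" using less.prems g gG by (auto simp: alternating_def)
    have fin: "finite {g. s g \<noteq> 0}"
      by (rule finite_subset[OF _ finG]) (use sFG in \<open>auto simp: FG_def\<close>)
    have remove: "P s" if "P u" "u \<in> alternating" "u \<in> invariant" and u: "\<And>h. u h = (if h \<in> A then s h else 0)" "g \<in> A" for u A
    proof -
      have "s h + u h = (if h \<in> A then 0 else s h)" for h by (simp add: u)
      then have "card {h. (s + u) h \<noteq> 0} < card {h. s h \<noteq> 0}"
        using fin g \<open>g \<in> A\<close> by (intro psubset_card_mono) auto
      then have "P (s + u)"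
        using less that by (intro less.hyps alternating_add invariant_add) auto
      then have "P (s + u + u)" using assms(4) \<open>P u\<close> by blast
      then show ?thesis by (simp add: add.assoc)
    qed
    have sc: "s (inv g) = s g" "s (c \<otimes> g) = s g" "s (c \<otimes> inv g) = s g"
      using symmetric_coeff[OF sym gG] invariant_coeff[OF less.prems(2)] gG by auto
    show ?thesis
    proof (cases "g \<otimes> g = c")
      case True
      show ?thesis
      proof (rule remove[of "alt (s g) g" "{g, c \<otimes> g}"])
        show "alt (s g) g h = (if h \<in> {g, c \<otimes> g} then s h else 0)" for h
          using sc c_neq[OF gG] by (auto simp: alt_def single_def alt_invariant(2)[OF gG True])
        show "P (alt (s g) g)" by (rule assms(5)[OF gG True])
        show "alt (s g) g \<in> alternating" by (rule alt_alternating[OF gG])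
        show "alt (s g) g \<in> invariant" by (rule alt_invariant(1)[OF gG True])
      qed simp
    next
      case False
      show ?thesis
      proof (rule remove[of "alt (s g) g + alt (s g) (c \<otimes> g)" "{g, inv g, c \<otimes> g, c \<otimes> inv g}"])
        show "(alt (s g) g + alt (s g) (c \<otimes> g)) h = (if h \<in> {g, inv g, c \<otimes> g, c \<otimes> inv g} then s h else 0)" for h
          using sc unfolding alt_pair_coeff[OF gG False gg] by auto
        show "P (alt (s g) g + alt (s g) (c \<otimes> g))" by (rule assms(6)[OF gG])
        show "alt (s g) g + alt (s g) (c \<otimes> g) \<in> alternating"
          using gG c by (intro alternating_add alt_alternating) simp_all
        show "alt (s g) g + alt (s g) (c \<otimes> g) \<in> invariant" by (rule alt_pair_invariant[OF gG])
      qed simp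
    qed
  qed
qed

lemma alt_trinomial_defects:
  assumes "g \<in> carrier G" "y \<in> carrier G" "alt \<alpha> y + alt \<alpha> (g \<otimes> y) + alt (\<alpha> * \<alpha>) g \<in> invariant"
  shows "alt \<alpha> y + alt \<alpha> (g \<otimes> y) + alt (\<alpha> * \<alpha>) g \<in> defects"
  by (rule defectsI[OF defect_trinomial[OF assms(1,2), of \<alpha>] assms(3)])

text \<open>The trinomial with g = c, where the third term vanishes because c is an
  involution.\<close>

lemma alt_pair_defects:
  assumes y: "y \<in> carrier G"
  shows "alt \<alpha> y + alt \<alpha> (c \<otimes> y) \<in> defects"
  using alt_trinomial_defects[OF c(1) y, of \<alpha>] alt_pair_invariant[OF y, of \<alpha>]
  by (simp add: alt_square_one[OF c(1,2)])

text \<open>Here g and y generate a dihedral group of order 8. As y and g y are involutions, only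
  the term [\<beta>^2, g] of the trinomial survives, and every coefficient is a square.\<close>

lemma alt_defects_noncommuting:
  assumes g: "g \<in> carrier G" "g \<otimes> g = c" and y: "y \<in> carrier G" "y \<otimes> y = \<one>" "g \<otimes> y \<otimes> (g \<otimes> y) = \<one>"
  shows "alt \<alpha> g \<in> defects"
proof -
  obtain \<beta> where \<beta>: "\<alpha> = \<beta> * \<beta>" using exists_sqrt by blast
  have "alt \<beta> y = 0" "alt \<beta> (g \<otimes> y) = 0" using g y by (simp_all add: alt_square_one)
  then show ?thesis
    using alt_trinomial_defects[OF g(1) y(1), of \<beta>] alt_invariant(1)[OF g] by (simp add: \<beta>)
qed

text \<open>Two commuting square roots g and z of c have an involution as their product, which kills
  the middle term of the trinomial with y = z.\<close>

lemma alt_defects_central: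
  assumes z: "z \<in> carrier G" "z \<otimes> z = c" "\<And>g. g \<in> carrier G \<Longrightarrow> g \<otimes> z = z \<otimes> g"
    and g: "g \<in> carrier G" "g \<otimes> g = c"
  shows "alt \<alpha> z + alt (\<alpha> * \<alpha>) g \<in> defects"
proof -
  have "g \<otimes> z \<otimes> (g \<otimes> z) = g \<otimes> (z \<otimes> g) \<otimes> z" using z(1) g(1) by (simp add: m_assoc)
  also have "\<dots> = g \<otimes> (g \<otimes> z) \<otimes> z" by (simp only: z(3)[OF g(1)])
  also have "\<dots> = g \<otimes> g \<otimes> (z \<otimes> z)" using z(1) g(1) by (simp add: m_assoc)
  finally have "g \<otimes> z \<otimes> (g \<otimes> z) = \<one>" using z(2) g(2) c by simp
  then have "alt \<alpha> (g \<otimes> z) = 0" using g(1) z(1) by (simp add: alt_square_one)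
  then show ?thesis
    using alt_trinomial_defects[OF g(1) z(1), of \<alpha>]
      invariant_add[OF alt_invariant(1)[OF z(1,2)] alt_invariant(1)[OF g]] by simp
qed

text \<open>The trinomial with g = t t and y = t has its middle term at t^3 = c t^-1, which is the
  same as the term at c t. The first two terms are then a pair already known to be a defect, and
  subtracting it isolates [\<alpha>, t t].\<close>

lemma alt_defects_fourth_power:
  assumes t: "t \<in> carrier G" "t \<otimes> t \<otimes> (t \<otimes> t) = c"
  shows "alt \<alpha> (t \<otimes> t) \<in> defects"
proof -
  obtain \<beta> where \<beta>: "\<alpha> = \<beta> * \<beta>" using exists_sqrt by blast
  have "c \<otimes> inv t = t \<otimes> t \<otimes> t" using t(1) by (simp add: t(2)[symmetric] m_assoc)
  then have eq: "alt \<beta> (t \<otimes> t \<otimes> t) = alt \<beta> (c \<otimes> t)"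
    using alt_inv[of "c \<otimes> t" \<beta>] t c by (simp add: inv_c_mult)
  have K: "alt \<beta> t + alt \<beta> (c \<otimes> t) \<in> defects" by (rule alt_pair_defects[OF t(1)])
  have tt: "t \<otimes> t \<in> carrier G" using t by simp
  have "alt \<beta> t + alt \<beta> (c \<otimes> t) + alt \<alpha> (t \<otimes> t) \<in> defects"
    using alt_trinomial_defects[OF tt t(1), of \<beta>]
      invariant_add[OF alt_pair_invariant[OF t(1), of \<beta>] alt_invariant(1)[OF tt t(2), of \<alpha>]]
    by (simp only: eq \<beta>)
  from defects_add[OF K this] show ?thesis by (simp only: fun_double_zero(2))
qed

text \<open>A central root z of c only yields the sums [\<beta>, z] + [\<beta>^2, g]. For z = t t
  the first summand is itself a defect and can be removed.\<close>

lemma alt_defects_of_fourth_power: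
  assumes t: "t \<in> carrier G" "t \<otimes> t \<otimes> (t \<otimes> t) = c" and g: "g \<in> carrier G" "g \<otimes> g = c"
  shows "alt \<alpha> g \<in> defects"
proof -
  obtain \<beta> where \<beta>: "\<alpha> = \<beta> * \<beta>" using exists_sqrt by blast
  have tt: "t \<otimes> t \<in> carrier G" using t by simp
  have "alt \<beta> (t \<otimes> t) + alt \<alpha> g \<in> defects"
    unfolding \<beta> by (rule alt_defects_central[OF tt t(2) square_central[OF t(1)] g])
  from defects_add[OF alt_defects_fourth_power[OF t, of \<beta>] this] show ?thesis
    by (simp only: fun_double_zero(2))
qed

lemma alternating_invariant_subset_defects:
  assumes "\<And>\<alpha> g. g \<in> carrier G \<Longrightarrow> g \<otimes> g = c \<Longrightarrow> alt \<alpha> g \<in> defects"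
  shows "alternating \<inter> invariant \<subseteq> defects"
proof
  fix s assume "s \<in> alternating \<inter> invariant"
  then have "s \<in> alternating" "s \<in> invariant" by auto
  then show "s \<in> defects"
  proof (induction rule: alternating_invariant_induct)
    case zero
    show ?case by (rule defects_zero)
  next
    case (add x y)
    then show ?case by (rule defects_add)
  next
    case (alt \<alpha> g)
    then show ?case by (rule assms)
  next
    case (pair \<alpha> g)
    then show ?case by (rule alt_pair_defects)
  qed
qed

lemma finite_defects: "finite defects"
  by (simp add: defects_def lifts_V)

text \<open>Modulo \<open>defects\<close> every generator equals some \<open>alt \<beta> z\<close>,
  with \<beta> the square root of the coefficient or 0. Those with \<beta> = t^2 + t are defects,
  and such \<beta> form half of the field, so one further coset, that of
  \<open>alt \<gamma> z\<close>, covers everything.\<close>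

lemma card_le_defects_square:
  assumes z: "z \<in> carrier G" "z \<otimes> z = c" "\<And>g. g \<in> carrier G \<Longrightarrow> g \<otimes> z = z \<otimes> g"
  shows "card (alternating \<inter> invariant) \<le> 2 * card defects"
proof -
  obtain \<gamma> :: 'f where "\<gamma> \<notin> range (\<lambda>t. t * t + t)"
    and \<gamma>: "\<And>\<beta>. \<beta> \<in> range (\<lambda>t. t * t + t) \<or> \<beta> + \<gamma> \<in> range (\<lambda>t. t * t + t)"
    by (rule artin_schreier_complement, rule that)
  \<comment> \<open>The case g = z of \<open>alt_defects_central\<close>.\<close>
  have AS: "alt \<beta> z \<in> defects" if "\<beta> \<in> range (\<lambda>t. t * t + t)" for \<beta>
    using that alt_defects_central[OF z z(1,2)] by (auto simp: alt_add add.commute)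
  have "alternating \<inter> invariant \<subseteq> defects \<union> (\<lambda>e. e + alt \<gamma> z) ` defects"
  proof
    fix s assume "s \<in> alternating \<inter> invariant"
    then have "s \<in> alternating" "s \<in> invariant" by auto
    then have "\<exists>\<beta>. s + alt \<beta> z \<in> defects"
    proof (induction rule: alternating_invariant_induct)
      case zero
      have "alt 0 z = 0" by (auto simp: alt_def single_def fun_eq_iff)
      then have "0 + alt 0 z \<in> defects" using defects_zero by simp
      then show ?case by (rule exI)
    next
      case (add x y)
      then obtain \<beta> \<beta>' where "x + alt \<beta> z \<in> defects" "y + alt \<beta>' z \<in> defects" by blast
      then have "x + alt \<beta> z + (y + alt \<beta>' z) \<in> defects" by (rule defects_add)
      then have "x + y + alt (\<beta> + \<beta>') z \<in> defects" by (simp only: alt_add add_ac)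
      then show ?case by blast
    next
      case (alt \<alpha> g)
      obtain \<beta> where "\<alpha> = \<beta> * \<beta>" using exists_sqrt by blast
      then have "alt \<alpha> g + alt \<beta> z \<in> defects"
        using alt_defects_central[OF z alt, of \<beta>] by (simp add: add.commute)
      then show ?case by blast
    next
      case (pair \<alpha> g)
      have "alt 0 z = 0" by (auto simp: alt_def single_def fun_eq_iff)
      then have "alt \<alpha> g + alt \<alpha> (c \<otimes> g) + alt 0 z \<in> defects"
        using alt_pair_defects[OF pair] by simp
      then show ?case by (rule exI)
    qed
    then obtain \<beta> where \<beta>: "s + alt \<beta> z \<in> defects" by blast
    from \<gamma>[of \<beta>] show "s \<in> defects \<union> (\<lambda>e. e + alt \<gamma> z) ` defects"
    proof
      assume "\<beta> \<in> range (\<lambda>t. t * t + t)"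
      from defects_add[OF \<beta> AS[OF this]] show ?thesis by (simp add: add.assoc)
    next
      assume "\<beta> + \<gamma> \<in> range (\<lambda>t. t * t + t)"
      from defects_add[OF \<beta> AS[OF this]] have "s + alt \<gamma> z \<in> defects"
        by (simp add: add.assoc alt_add)
      then show ?thesis by (intro UnI2 image_eqI[of _ _ "s + alt \<gamma> z"]) (simp_all add: add.assoc)
    qed
  qed
  then have "card (alternating \<inter> invariant) \<le> card (defects \<union> (\<lambda>e. e + alt \<gamma> z) ` defects)"
    by (rule card_mono[rotated]) (simp add: finite_defects)
  also have "\<dots> \<le> card defects + card ((\<lambda>e. e + alt \<gamma> z) ` defects)" by (rule card_Un_le)
  also have "\<dots> \<le> 2 * card defects" using card_image_le[OF finite_defects, of "\<lambda>e. e + alt \<gamma> z"] by simp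
  finally show ?thesis .
qed

end

section \<open>Quotients by a central involution\<close>

locale char2_quotient =
  G: char2_central_involution G F c + B: char2_group_algebra B F
  for G :: "('a, 'b) monoid_scheme" and B :: "('c, 'd) monoid_scheme"
    and F :: "'f::{field,finite} itself" and c +
  fixes \<pi> :: "'a \<Rightarrow> 'c"
  assumes hom: "\<pi> \<in> hom G B" and surj: "\<pi> ` carrier G = carrier B"
    and \<pi>_eq_iff: "\<And>g h. g \<in> carrier G \<Longrightarrow> h \<in> carrier G \<Longrightarrow> \<pi> g = \<pi> h \<longleftrightarrow> h = g \<or> h = c \<otimes>\<^bsub>G\<^esub> g"
begin

lemma \<pi>_closed: "g \<in> carrier G \<Longrightarrow> \<pi> g \<in> carrier B"
  using surj by blast

lemma \<pi>_mult: "g \<in> carrier G \<Longrightarrow> h \<in> carrier G \<Longrightarrow> \<pi> (g \<otimes>\<^bsub>G\<^esub> h) = \<pi> g \<otimes>\<^bsub>B\<^esub> \<pi> h"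
  using hom by (rule hom_mult)

interpretation \<pi>: group_hom G B \<pi>
  by unfold_locales (rule hom)

text \<open>The homomorphism of group algebras induced by \<pi>.\<close>

definition push :: "('a \<Rightarrow> 'f) \<Rightarrow> 'c \<Rightarrow> 'f" where
  "push x b = (if b \<in> carrier B then G.pair x (\<lambda>g. if \<pi> g = b then 1 else 0) else 0)"

lemma push_FG: "push x \<in> B.FG"
  by (simp add: B.FG_def push_def)

lemma push_pair: "B.pair (push x) \<phi> = G.pair x (\<lambda>g. \<phi> (\<pi> g))"
proof -
  have "B.pair (push x) \<phi> = (\<Sum>b\<in>carrier B. \<Sum>g\<in>carrier G. x g * (if \<pi> g = b then 1 else 0) * \<phi> b)"
    by (simp add: B.pair_def G.pair_def push_def sum_distrib_right)
  also have "\<dots> = (\<Sum>g\<in>carrier G. \<Sum>b\<in>carrier B. x g * (if \<pi> g = b then 1 else 0) * \<phi> b)"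
    by (rule sum.swap)
  also have "\<dots> = (\<Sum>g\<in>carrier G. x g * \<phi> (\<pi> g))"
  proof (rule sum.cong[OF HOL.refl])
    fix g assume g: "g \<in> carrier G"
    have "(\<Sum>b\<in>carrier B. x g * (if \<pi> g = b then 1 else 0) * \<phi> b)
        = (\<Sum>b\<in>carrier B. if b = \<pi> g then x g * \<phi> b else 0)"
      by (intro sum.cong) auto
    then show "(\<Sum>b\<in>carrier B. x g * (if \<pi> g = b then 1 else 0) * \<phi> b) = x g * \<phi> (\<pi> g)"
      using g B.finG \<pi>_closed by simp
  qed
  finally show ?thesis by (simp add: G.pair_def)
qed

lemma push_mul: "push (x \<otimes>\<^bsub>group_algebra G\<^esub> y) = push x \<otimes>\<^bsub>group_algebra B\<^esub> push y"
proof (rule B.FG_eqI)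
  fix \<phi>
  show "B.pair (push (x \<otimes>\<^bsub>group_algebra G\<^esub> y)) \<phi> = B.pair (push x \<otimes>\<^bsub>group_algebra B\<^esub> push y) \<phi>"
    unfolding push_pair B.pair_mul G.pair_mul
    by (intro G.pair_cong) (simp add: \<pi>_mult)
qed (auto simp: push_FG)

lemma push_star: "push (involution G x) = involution B (push x)"
proof (rule B.FG_eqI)
  fix \<phi>
  show "B.pair (push (involution G x)) \<phi> = B.pair (involution B (push x)) \<phi>"
    unfolding push_pair B.pair_star G.pair_star by (intro G.pair_cong) simp
qed (auto simp: push_FG)

lemma push_single: "g \<in> carrier G \<Longrightarrow> push (single \<alpha> g) = single \<alpha> (\<pi> g)"
  by (rule B.FG_eqI) (simp_all add: push_FG push_pair G.pair_single B.pair_single \<pi>_closed)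

lemma push_unit: "push G.unit = B.unit"
  by (simp add: push_single)

lemma push_add: "push (x + y) = push x + push y"
  by (rule ext) (simp add: push_def G.pair_add)

lemma push_coeff:
  assumes g: "g \<in> carrier G"
  shows "push x (\<pi> g) = x g + x (c \<otimes>\<^bsub>G\<^esub> g)"
proof -
  have "G.pair x (\<lambda>k. if \<pi> k = \<pi> g then 1 else 0) = (\<Sum>k\<in>{g, c \<otimes>\<^bsub>G\<^esub> g}. x k)"
  proof -
    have "G.pair x (\<lambda>k. if \<pi> k = \<pi> g then 1 else 0) = (\<Sum>k\<in>carrier G. if k \<in> {g, c \<otimes>\<^bsub>G\<^esub> g} then x k else 0)"
      unfolding G.pair_def
    proof (rule sum.cong[OF HOL.refl])
      fix k assume "k \<in> carrier G"
      then have "\<pi> k = \<pi> g \<longleftrightarrow> k \<in> {g, c \<otimes>\<^bsub>G\<^esub> g}" using \<pi>_eq_iff[OF g, of k] by auto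
      then show "x k * (if \<pi> k = \<pi> g then 1 else 0) = (if k \<in> {g, c \<otimes>\<^bsub>G\<^esub> g} then x k else 0)" by simp
    qed
    also have "\<dots> = (\<Sum>k\<in>{k \<in> carrier G. k \<in> {g, c \<otimes>\<^bsub>G\<^esub> g}}. x k)"
      by (rule sum.inter_filter[OF G.finG, symmetric])
    also have "{k \<in> carrier G. k \<in> {g, c \<otimes>\<^bsub>G\<^esub> g}} = {g, c \<otimes>\<^bsub>G\<^esub> g}" using g G.c by auto
    finally show ?thesis .
  qed
  also have "\<dots> = x g + x (c \<otimes>\<^bsub>G\<^esub> g)" using G.c_neq[OF g] by simp
  finally show ?thesis using g \<pi>_closed by (simp add: push_def)
qed

text \<open>The coefficients of the image are x g + x (c g), and in characteristic 2 such a sum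
  vanishes iff the two terms agree.\<close>

lemma push_zero_iff:
  assumes x: "x \<in> G.FG"
  shows "push x = 0 \<longleftrightarrow> x \<in> G.invariant"
proof -
  have "push x = 0 \<longleftrightarrow> (\<forall>b\<in>carrier B. push x b = 0)"
    by (auto simp: fun_eq_iff push_def)
  also have "\<dots> \<longleftrightarrow> (\<forall>g\<in>carrier G. push x (\<pi> g) = 0)" unfolding surj[symmetric] by simp
  also have "\<dots> \<longleftrightarrow> (\<forall>g\<in>carrier G. x (c \<otimes>\<^bsub>G\<^esub> g) = x g)"
    by (intro ball_cong) (auto simp: push_coeff G.add_eq_zero_iff)
  finally show ?thesis using x by (simp add: G.invariant_def)
qed

lemma push_surj: "push ` G.FG = B.FG"
proof
  show "B.FG \<subseteq> push ` G.FG"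
  proof
    fix y assume y: "y \<in> B.FG"
    define r where "r = inv_into (carrier G) \<pi>"
    have r: "r b \<in> carrier G" "\<pi> (r b) = b" if "b \<in> carrier B" for b
      using that surj unfolding r_def by (auto intro: inv_into_into f_inv_into_f)
    define x where "x g = (if g \<in> r ` carrier B then y (\<pi> g) else 0)" for g
    have "push x = y"
    proof
      fix b
      show "push x b = y b"
      proof (cases "b \<in> carrier B")
        case True
        \<comment> \<open>Only one of the two preimages of b is a chosen representative, so a single
          coefficient of x contributes to the image at b.\<close>
        have "c \<otimes>\<^bsub>G\<^esub> r b \<notin> r ` carrier B"
        proof
          assume "c \<otimes>\<^bsub>G\<^esub> r b \<in> r ` carrier B"
          then obtain b' where b': "b' \<in> carrier B" "c \<otimes>\<^bsub>G\<^esub> r b = r b'" by blast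
          have "\<pi> (r b) = \<pi> (r b')"
            using \<pi>_eq_iff[OF r(1)[OF True] r(1)[OF b'(1)]] b'(2) by simp
          then have "b = b'" unfolding r(2)[OF True] r(2)[OF b'(1)] .
          then show False using b' G.c_neq r True by auto
        qed
        then have "x (r b) + x (c \<otimes>\<^bsub>G\<^esub> r b) = y b" using True r by (simp add: x_def)
        then show ?thesis using push_coeff[OF r(1)[OF True], of x] r True by simp
      next
        case False
        then show ?thesis using y by (simp add: push_def B.FG_def)
      qed
    qed
    moreover have "x \<in> G.FG" using r by (auto simp: G.FG_def x_def)
    ultimately show "y \<in> push ` G.FG" by blast
  qed
qed (auto simp: push_FG)

lemma push_V: "x \<in> G.FG \<Longrightarrow> push x \<in> B.V \<longleftrightarrow> x \<in> G.V"
  by (simp add: B.V_iff G.V_iff push_FG push_pair)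

lemma card_FG_invariant: "card G.FG = card B.FG * card G.invariant"
proof -
  have "{x \<in> G.FG. push x = 0} = G.invariant"
    using push_zero_iff G.invariant_FG by blast
  then show ?thesis
    using G.card_kernel_image[of G.FG push] G.finite_FG push_surj by (simp add: push_add)
qed

lemma finite_invariant: "finite G.invariant"
  by (rule finite_subset[OF _ G.finite_FG]) (auto simp: G.invariant_FG)

text \<open>The projection respects the form x + star x, and its kernel on
  \<open>alternating\<close> is the invariant part.\<close>

lemma card_alternating_le: "card G.alternating \<le> card B.alternating * card (G.alternating \<inter> G.invariant)"
proof -
  have "{x \<in> G.alternating. push x = 0} = G.alternating \<inter> G.invariant"
    using push_zero_iff G.alternating_subset by blast
  moreover have "push ` G.alternating \<subseteq> B.alternating"
  proof (rule image_subsetI)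
    fix s assume "s \<in> G.alternating"
    then obtain x where "s = x + involution G x" unfolding G.alternating_eq_image by blast
    then have "push s = push x + involution B (push x)" by (simp only: push_add push_star)
    then show "push s \<in> B.alternating" using B.symmetrization_alternating push_FG by simp
  qed
  then have "card (push ` G.alternating) \<le> card B.alternating"
    by (intro card_mono B.alternating_subset)
  moreover have "card G.alternating = card (push ` G.alternating) * card {x \<in> G.alternating. push x = 0}"
    by (rule G.card_kernel_image) (auto simp: G.alternating_subset G.alternating_add push_add)
  ultimately show ?thesis by simp
qed

text \<open>Lifts have unitary images, and two lifts with the same image differ by an invariant
  element.\<close>

lemma card_lifts_le:
  "card G.lifts \<le> card (unitary_subgroup B :: ('c \<Rightarrow> 'f) set) * card G.invariant"
proof (rule card_le_fibres[where f = push])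
  show "push ` G.lifts \<subseteq> unitary_subgroup B"
  proof (rule image_subsetI)
    fix x assume x: "x \<in> G.lifts"
    have "push (G.defect x) = 0" using x push_zero_iff G.invariant_FG by (auto simp: G.lifts_def)
    moreover have "push x \<otimes>\<^bsub>group_algebra B\<^esub> involution B (push x) = push (G.unit + G.defect x)"
      by (simp only: push_mul[symmetric] push_star[symmetric] G.norm_eq_defect)
    ultimately have "push x \<otimes>\<^bsub>group_algebra B\<^esub> involution B (push x) = B.unit"
      by (simp add: push_add push_unit)
    then show "push x \<in> unitary_subgroup B"
      using x push_V by (simp add: B.unitary_subgroup_eq G.lifts_V)
  qed
  show "finite (unitary_subgroup B :: ('c \<Rightarrow> 'f) set)"
    by (rule finite_subset[OF _ B.finite_FG]) (auto simp: B.unitary_subgroup_eq B.V_FG)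
  fix y :: "'c \<Rightarrow> 'f"
  show "card {x \<in> G.lifts. push x = y} \<le> card G.invariant"
  proof (cases "{x \<in> G.lifts. push x = y} = {}")
    case False
    then obtain x0 where x0: "x0 \<in> G.lifts" "push x0 = y" by blast
    show ?thesis
    proof (rule card_inj_on_le[where f = "\<lambda>x. x0 + x"])
      show "(\<lambda>x. x0 + x) ` {x \<in> G.lifts. push x = y} \<subseteq> G.invariant"
      proof (rule image_subsetI)
        fix x assume "x \<in> {x \<in> G.lifts. push x = y}"
        then have x: "x \<in> G.lifts" "push x = y" by auto
        have "push (x0 + x) = 0" unfolding push_add x x0 by (rule B.fun_double_zero(1))
        moreover have "x0 + x \<in> G.FG" using x x0 G.lifts_V(2) G.FG_add by blast
        ultimately show "x0 + x \<in> G.invariant" using push_zero_iff by blast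
      qed
      show "inj_on (\<lambda>x. x0 + x) {x \<in> G.lifts. push x = y}" by (rule inj_onI) simp
    qed (rule finite_invariant)
  next
    case True
    show ?thesis unfolding True by simp
  qed
qed (rule G.lifts_V(3))

text \<open>The factor \<iota> bounds the index of the attained defects among the admissible ones.
  Read as fractions, the number of unitary elements divided by |\<open>symmetric\<close>| grows at
  most by \<iota> from B to G. The bounds for \<open>alternating\<close>, \<open>defects\<close> and
  \<open>lifts\<close> are multiplied, \<open>alternating\<close> is eliminated through
  |\<open>alternating\<close>| |\<open>symmetric\<close>| = |FG|, and |FG| is cancelled.\<close>

lemma card_unitary_step:
  assumes "card (G.alternating \<inter> G.invariant) \<le> \<iota> * card G.defects"
  shows "card (unitary_subgroup G :: ('a \<Rightarrow> 'f) set) * card B.symmetric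
    \<le> \<iota> * card (unitary_subgroup B :: ('c \<Rightarrow> 'f) set) * card G.symmetric"
proof -
  let ?v = "card (unitary_subgroup G :: ('a \<Rightarrow> 'f) set)" and ?w = "card (unitary_subgroup B :: ('c \<Rightarrow> 'f) set)"
  let ?D = "card (G.alternating \<inter> G.invariant)" and ?SG = "card G.symmetric" and ?SB = "card B.symmetric"
  let ?TG = "card G.alternating" and ?TB = "card B.alternating" and ?I = "card G.invariant"
  let ?E = "card G.defects"
  have "?v * ?SB * card G.FG = ?v * ?SB * (?TG * ?SG)" by (simp add: G.card_alternating_symmetric)
  also have "\<dots> \<le> ?v * ?SB * (?TB * ?D * ?SG)" using card_alternating_le by (intro mult_le_mono) auto
  also have "\<dots> = ?v * (?TB * ?SB) * ?SG * ?D" by (simp add: ac_simps)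
  also have "\<dots> \<le> ?v * card B.FG * ?SG * (\<iota> * ?E)"
    unfolding B.card_alternating_symmetric using assms by (intro mult_le_mono) auto
  also have "\<dots> = \<iota> * card B.FG * ?SG * (?E * ?v)" by (simp add: ac_simps)
  also have "\<dots> \<le> \<iota> * card B.FG * ?SG * (?w * ?I)"
    by (rule mult_le_mono[OF order.refl order.trans[OF G.card_unitary_defects card_lifts_le]])
  also have "\<dots> = \<iota> * ?w * ?SG * card G.FG" unfolding card_FG_invariant by (simp add: ac_simps)
  finally have "?v * ?SB * card G.FG \<le> \<iota> * ?w * ?SG * card G.FG" .
  moreover have "card G.FG > 0" using G.finite_FG G.FG_zero by (subst card_gt_0_iff) blast
  ultimately show ?thesis by simp
qed

text \<open>An inverse modulo c lifts to some y with y x = 1 + e and e invariant. Since e e = 0, the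
  element 1 + e is its own inverse and (1 + e) y is the inverse sought.\<close>

lemma units_step:
  assumes "\<And>y. y \<in> B.V \<Longrightarrow> \<exists>z\<in>B.V. z \<otimes>\<^bsub>group_algebra B\<^esub> y = B.unit" and x: "x \<in> G.V"
  shows "\<exists>z\<in>G.V. z \<otimes>\<^bsub>group_algebra G\<^esub> x = G.unit"
proof -
  have xF: "x \<in> G.FG" using x by (rule G.V_FG)
  obtain z where z: "z \<in> B.V" "z \<otimes>\<^bsub>group_algebra B\<^esub> push x = B.unit"
    using assms(1)[of "push x"] x push_V xF by blast
  have "z \<in> push ` G.FG" unfolding push_surj using z(1) by (rule B.V_FG)
  then obtain y where y: "z = push y" "y \<in> G.FG" by (rule imageE)
  then have yV: "y \<in> G.V" using z push_V by simp
  define e where "e = y \<otimes>\<^bsub>group_algebra G\<^esub> x + G.unit"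
  have eF: "e \<in> G.FG" unfolding e_def by (intro G.FG_add G.FG_mul G.FG_single) simp
  have "push e = 0" unfolding e_def push_add push_mul push_unit y(1)[symmetric] z(2) by (rule B.fun_double_zero(1))
  then have e: "e \<in> G.invariant" using push_zero_iff eF by blast
  have yx: "y \<otimes>\<^bsub>group_algebra G\<^esub> x = G.unit + e"
    unfolding e_def by (simp add: add.left_commute)
  have "(G.unit + e) \<otimes>\<^bsub>group_algebra G\<^esub> (G.unit + e) = G.unit + e + (e + 0)"
    unfolding G.mul_add G.add_mul G.invariant_mul_invariant[OF e e]
    using eF by (simp add: G.mul_unit G.unit_mul)
  also have "\<dots> = G.unit" by (simp add: add.assoc)
  finally have "(G.unit + e) \<otimes>\<^bsub>group_algebra G\<^esub> y \<otimes>\<^bsub>group_algebra G\<^esub> x = G.unit"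
    by (simp only: G.mul_assoc yx)
  moreover have "G.unit + e \<in> G.V" unfolding yx[symmetric] by (rule G.V_mul[OF yV x])
  ultimately show ?thesis using G.V_mul yV by blast
qed

end

text \<open>Quotients by a central involution are realised on the same type by choosing a representative
  in every coset, so that one can argue by induction on the order of the group.\<close>

lemma (in char2_central_involution) exists_quotient:
  obtains B :: "'a monoid" and \<pi> where "comm_group B" "char2_quotient TYPE('f) G B c \<pi>"
    "card (carrier B) < card (carrier G)"
proof -
  define r where "r g = (SOME x. x = g \<or> x = c \<otimes> g)" for g
  have r_cases: "r g = g \<or> r g = c \<otimes> g" for g unfolding r_def by (rule someI_ex) blast
  have r_in: "g \<in> carrier G \<Longrightarrow> r g \<in> carrier G" for g using r_cases[of g] c by auto
  \<comment> \<open>For g and for c g the choice is made from the same predicate, up to the order of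
    the disjuncts, so r is constant on cosets.\<close>
  have r_c: "r (c \<otimes> g) = r g" if "g \<in> carrier G" for g
    unfolding r_def using that by (simp add: c_cancel disj_commute)
  have r_eq: "r g = r h \<longleftrightarrow> h = g \<or> h = c \<otimes> g" if "g \<in> carrier G" "h \<in> carrier G" for g h
    using that r_cases[of g] r_cases[of h] r_c[of g] r_c[of h] c c_cancel by (metis l_cancel)
  have r_mult: "r (r g \<otimes> r h) = r (g \<otimes> h)" if g: "g \<in> carrier G" and h: "h \<in> carrier G" for g h
  proof -
    have 1: "r (g \<otimes> (c \<otimes> h)) = r (g \<otimes> h)" using g h by (simp add: c_left_commute r_c)
    have 2: "r (c \<otimes> g \<otimes> k) = r (g \<otimes> k)" if "k \<in> carrier G" for k
      using g that c by (simp add: m_assoc r_c)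
    show ?thesis using r_cases[of g] r_cases[of h] 1 2 h c by fastforce
  qed
  have r_r: "r (r g) = r g" if "g \<in> carrier G" for g
    using r_cases[of g] r_c[OF that] by auto
  define B where "B = \<lparr>carrier = r ` carrier G, monoid.mult = (\<lambda>x y. r (x \<otimes> y)), one = r \<one>\<rparr>"
  have B_simps: "carrier B = r ` carrier G" "x \<otimes>\<^bsub>B\<^esub> y = r (x \<otimes> y)" "\<one>\<^bsub>B\<^esub> = r \<one>" for x y
    by (simp_all add: B_def)
  have rl: "r (r x \<otimes> y) = r (x \<otimes> y)" "r (y \<otimes> r x) = r (y \<otimes> x)" if "x \<in> carrier G" "y \<in> carrier G" for x y
    using r_mult[of "r x" y] r_mult[of x y] r_mult[of y "r x"] r_mult[of y x] that r_in r_r by simp_all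
  have comm: "comm_group B"
  proof (rule comm_groupI)
    fix x assume "x \<in> carrier B"
    then obtain g where "g \<in> carrier G" "x = r g" by (auto simp: B_simps)
    then have "r (inv g) \<otimes>\<^bsub>B\<^esub> x = \<one>\<^bsub>B\<^esub>" by (simp add: B_simps r_mult)
    then show "\<exists>y\<in>carrier B. y \<otimes>\<^bsub>B\<^esub> x = \<one>\<^bsub>B\<^esub>"
      using \<open>g \<in> carrier G\<close> by (auto simp: B_simps)
  next
    fix x y assume "x \<in> carrier B" "y \<in> carrier B"
    then obtain g h where g: "g \<in> carrier G" "x = r g" and h: "h \<in> carrier G" "y = r h" by (auto simp: B_simps)
    have "r (g \<otimes> h) = r (h \<otimes> g)" using commutators[OF g(1) h(1)] g h r_c by auto
    then show "x \<otimes>\<^bsub>B\<^esub> y = y \<otimes>\<^bsub>B\<^esub> x" using g h by (simp add: B_simps r_mult)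
  qed (auto simp: B_simps r_in rl m_assoc)
  then interpret B: comm_group B .
  have "card (r ` carrier G) < card (carrier G)"
  proof -
    have "r c = r \<one>" using r_c[of \<one>] c by simp
    then have "\<not> inj_on r (carrier G)" using c by (auto dest: inj_onD)
    then have "card (r ` carrier G) \<noteq> card (carrier G)" using finG eq_card_imp_inj_on by blast
    then show ?thesis using card_image_le[OF finG, of r] by linarith
  qed
  moreover have "char2_quotient TYPE('f) G B c r"
  proof unfold_locales
    show "finite (carrier B)" using finG by (simp add: B_simps)
    show "r \<in> hom G B" by (rule homI) (auto simp: B_simps r_mult)
    show "r ` carrier G = carrier B" by (simp add: B_simps)
    show "r g = r h \<longleftrightarrow> h = g \<or> h = c \<otimes> g" if "g \<in> carrier G" "h \<in> carrier G" for g h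
      by (rule r_eq[OF that])
  qed (rule char2)
  ultimately show thesis using that comm by (simp add: B_simps)
qed

section \<open>An upper bound by induction along quotients\<close>

definition squares :: "('a, 'b) monoid_scheme \<Rightarrow> 'a set" where
  "squares G = (\<lambda>g. g \<otimes>\<^bsub>G\<^esub> g) ` carrier G"

definition fourth_powers :: "('a, 'b) monoid_scheme \<Rightarrow> 'a set" where
  "fourth_powers G = (\<lambda>g. g \<otimes>\<^bsub>G\<^esub> g \<otimes>\<^bsub>G\<^esub> (g \<otimes>\<^bsub>G\<^esub> g)) ` carrier G"

text \<open>The last nontrivial term of the sequence g, g^2, g^4, ... is an involution.\<close>

lemma (in group) exists_involution:
  assumes g: "g \<in> carrier G" "g \<noteq> \<one>" "g [^] ((2::nat) ^ N) = \<one>"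
  shows "\<exists>c\<in>carrier G. c \<otimes> c = \<one> \<and> c \<noteq> \<one>"
proof -
  define j where "j = (LEAST j. g [^] ((2::nat) ^ j) = \<one>)"
  have j: "g [^] ((2::nat) ^ j) = \<one>" unfolding j_def using g(3) by (rule LeastI)
  then have "j \<noteq> 0" using g by (intro notI) simp
  then obtain i where i: "j = Suc i" using not0_implies_Suc by blast
  have "g [^] ((2::nat) ^ i) \<noteq> \<one>" using not_less_Least[of i "\<lambda>j. g [^] ((2::nat) ^ j) = \<one>"] i
    unfolding j_def by auto
  moreover have "g [^] ((2::nat) ^ i) \<otimes> g [^] ((2::nat) ^ i) = \<one>"
    using j g(1) by (simp add: nat_pow_mult i mult_2)
  ultimately show ?thesis using g(1) by blast
qed

context char2_quotient
begin

text \<open>S is a subgroup, to be taken as the squares or the fourth powers of an abelian group;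
  the fibres of \<pi> on it have two elements or one according to whether c belongs to S.\<close>

lemma card_image_\<pi>:
  assumes S: "S \<subseteq> carrier G" "\<And>x y. x \<in> S \<Longrightarrow> y \<in> S \<Longrightarrow> x \<otimes>\<^bsub>G\<^esub> inv\<^bsub>G\<^esub> y \<in> S" "S \<noteq> {}"
  shows "c \<notin> S \<Longrightarrow> card (\<pi> ` S) = card S" and "c \<in> S \<Longrightarrow> card S = 2 * card (\<pi> ` S)"
proof -
  have fin: "finite S" using S(1) G.finG by (rule finite_subset)
  show "card (\<pi> ` S) = card S" if cS: "c \<notin> S"
  proof (rule card_image, rule inj_onI)
    fix x y assume xy: "x \<in> S" "y \<in> S" "\<pi> x = \<pi> y"
    then have "y = x \<or> y = c \<otimes>\<^bsub>G\<^esub> x" using \<pi>_eq_iff S(1) by blast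
    moreover have "y \<noteq> c \<otimes>\<^bsub>G\<^esub> x"
    proof
      assume "y = c \<otimes>\<^bsub>G\<^esub> x"
      then have "y \<otimes>\<^bsub>G\<^esub> inv\<^bsub>G\<^esub> x = c" using xy S(1) G.c by (auto simp: G.m_assoc)
      then show False using S(2)[OF xy(2,1)] cS by simp
    qed
    ultimately show "x = y" by simp
  qed
  show "card S = 2 * card (\<pi> ` S)" if cS: "c \<in> S"
  proof -
    have one: "\<one>\<^bsub>G\<^esub> \<in> S" using S(2)[OF cS cS] G.c by simp
    have cx: "c \<otimes>\<^bsub>G\<^esub> x \<in> S" if x: "x \<in> S" for x
    proof -
      have "x \<in> carrier G" using x S(1) by blast
      then show ?thesis using S(2)[OF cS S(2)[OF one x]] by simp
    qed
    have fibre: "card {x \<in> S. \<pi> x = y} = 2" if y: "y \<in> \<pi> ` S" for y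
    proof -
      from y obtain x where x: "y = \<pi> x" "x \<in> S" by (rule imageE)
      have xG: "x \<in> carrier G" using x(2) S(1) by (rule rev_subsetD)
      have "\<pi> u = y \<longleftrightarrow> u = x \<or> u = c \<otimes>\<^bsub>G\<^esub> x" if "u \<in> S" for u
        unfolding x(1) eq_commute[of "\<pi> u"] using that S(1) by (intro \<pi>_eq_iff[OF xG]) (rule subsetD)
      then have "{u \<in> S. \<pi> u = y} = {x, c \<otimes>\<^bsub>G\<^esub> x}"
        using x(2) cx[OF x(2)] by blast
      then show ?thesis using G.c_neq[OF xG, symmetric] by simp
    qed
    have "card S \<le> card (\<pi> ` S) * 2"
      by (rule card_le_fibres[OF fin order.refl _ eq_refl[OF fibre]]) (use fin in simp)
    moreover have "card (\<pi> ` S) * 2 \<le> card S"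
      by (rule card_ge_fibres[OF fin order.refl eq_refl[OF fibre[symmetric]]])
    ultimately show ?thesis by simp
  qed
qed

lemma exponent_image:
  assumes "\<And>g. g \<in> carrier G \<Longrightarrow> g [^]\<^bsub>G\<^esub> (N::nat) = \<one>\<^bsub>G\<^esub>" and b: "b \<in> carrier B"
  shows "b [^]\<^bsub>B\<^esub> N = \<one>\<^bsub>B\<^esub>"
proof -
  interpret \<pi>: group_hom G B \<pi> by unfold_locales (rule hom)
  have "b \<in> \<pi> ` carrier G" unfolding surj by (rule b)
  then obtain a where a: "b = \<pi> a" "a \<in> carrier G" by (rule imageE)
  show ?thesis unfolding a(1) using assms(1)[OF a(2)] \<pi>.hom_nat_pow[OF a(2), of N] by simp
qed

lemma squares_image: "squares B = \<pi> ` squares G"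
  unfolding squares_def surj[symmetric] image_image using \<pi>_mult by (intro image_cong) auto

lemma fourth_powers_image: "fourth_powers B = \<pi> ` fourth_powers G"
  unfolding fourth_powers_def surj[symmetric] image_image using \<pi>_mult by (intro image_cong) auto

text \<open>Passes a bound from B to G at the cost of the factor \<iota>. In the applications u is
  the number of fourth powers of B and v bounds its number of squares.\<close>

lemma unitary_bound_step:
  assumes "card (G.alternating \<inter> G.invariant) \<le> \<iota> * card G.defects"
    and "card (unitary_subgroup B :: ('c \<Rightarrow> 'f) set) * q * u \<le> v * card B.symmetric"
  shows "card (unitary_subgroup G :: ('a \<Rightarrow> 'f) set) * q * u \<le> \<iota> * v * card G.symmetric"
proof -
  let ?v = "card (unitary_subgroup G :: ('a \<Rightarrow> 'f) set)" and ?w = "card (unitary_subgroup B :: ('c \<Rightarrow> 'f) set)"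
  have "card B.symmetric * (?v * q * u) = ?v * card B.symmetric * (q * u)" by (simp add: ac_simps)
  also have "\<dots> \<le> \<iota> * ?w * card G.symmetric * (q * u)"
    by (rule mult_le_mono1[OF card_unitary_step[OF assms(1)]])
  also have "\<dots> = \<iota> * card G.symmetric * (?w * q * u)" by (simp add: ac_simps)
  also have "\<dots> \<le> \<iota> * card G.symmetric * (v * card B.symmetric)" by (rule mult_le_mono2[OF assms(2)])
  also have "\<dots> = card B.symmetric * (\<iota> * v * card G.symmetric)" by (simp add: ac_simps)
  finally have "card B.symmetric * (?v * q * u) \<le> card B.symmetric * (\<iota> * v * card G.symmetric)" .
  moreover have "0 \<in> B.symmetric"
    unfolding B.symmetric_def by (auto simp: involution_def fun_eq_iff)
  then have "card B.symmetric > 0" using B.alternating_subset(4) by (subst card_gt_0_iff) blast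
  ultimately show ?thesis by simp
qed

end

text \<open>Induction over quotients A/c. The ratio |squares| / |fourth powers| pays for the factor
  \<iota>: it is unchanged if c is not a square, since neither number changes, and if c is a fourth
  power, since both halve; in both cases \<iota> = 1. In the remaining case only the number of
  squares halves, matching \<iota> = 2. Existence of inverses is carried through the same
  induction.\<close>

lemma comm_group_unitary_bound:
  fixes A :: "'a monoid"
  assumes "comm_group A" "finite (carrier A)" "CHAR('f::{field,finite}) = 2"
    and "\<And>g. g \<in> carrier A \<Longrightarrow> g [^]\<^bsub>A\<^esub> ((2::nat) ^ N) = \<one>\<^bsub>A\<^esub>"
  shows "(\<forall>x\<in>(normalized_elements A :: ('a \<Rightarrow> 'f) set).
           \<exists>z\<in>normalized_elements A. z \<otimes>\<^bsub>group_algebra A\<^esub> x = single 1 \<one>\<^bsub>A\<^esub>)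
    \<and> card (unitary_subgroup A :: ('a \<Rightarrow> 'f) set) * card (UNIV :: 'f set) * card (fourth_powers A)
       \<le> card (squares A) * card (char2_group_algebra.symmetric A :: ('a \<Rightarrow> 'f) set)"
  using assms(1,2,4)
proof (induction "card (carrier A)" arbitrary: A rule: less_induct)
  case less
  interpret A: comm_group A by (rule less.prems)
  interpret A: char2_group_algebra A "TYPE('f)"
    by unfold_locales (use less.prems assms(3) in auto)
  show ?case
  proof (cases "carrier A = {\<one>\<^bsub>A\<^esub>}")
    \<comment> \<open>In the trivial group 1 is the only normalized element and every element is
      symmetric, so both sides compare 1 or 0 times |F| with |F|.\<close>
    case True
    have FG: "A.FG = {x. \<forall>g. g \<noteq> \<one>\<^bsub>A\<^esub> \<longrightarrow> x g = 0}" unfolding A.FG_def True by simp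
    have V: "x = A.unit" if "x \<in> A.V" for x
      using that unfolding A.V_iff FG A.pair_def True by (auto simp: single_def fun_eq_iff)
    have "A.unit \<otimes>\<^bsub>group_algebra A\<^esub> A.unit = A.unit" by (simp add: A.unit_mul)
    then have 1: "\<forall>x\<in>A.V. \<exists>z\<in>A.V. z \<otimes>\<^bsub>group_algebra A\<^esub> x = A.unit" using V A.V_unit by blast
    have "(unitary_subgroup A :: ('a \<Rightarrow> 'f) set) \<subseteq> {A.unit}" using V by (auto simp: A.unitary_subgroup_eq)
    then have 2: "card (unitary_subgroup A :: ('a \<Rightarrow> 'f) set) \<le> 1" by (metis card_mono card.empty card.insert empty_iff finite.emptyI finite.insertI One_nat_def)
    have "A.symmetric = A.FG"
      using A.alternating_subset(2) by (auto intro!: A.symmetricI simp: True)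
    then have 3: "card A.symmetric = card (UNIV :: 'f set)" using A.card_FG True by simp
    have 4: "card (fourth_powers A) = 1" "card (squares A) = 1" by (simp_all add: fourth_powers_def squares_def True)
    show ?thesis using 1 2 unfolding 3 4 by simp
  next
    case False
    then obtain g where "g \<in> carrier A" "g \<noteq> \<one>\<^bsub>A\<^esub>" by blast
    then obtain c where c: "c \<in> carrier A" "c \<otimes>\<^bsub>A\<^esub> c = \<one>\<^bsub>A\<^esub>" "c \<noteq> \<one>\<^bsub>A\<^esub>"
      using A.exists_involution less.prems(3) by blast
    interpret A: char2_central_involution A "TYPE('f)" c
      by unfold_locales (use c A.m_comm in auto)
    obtain B :: "'a monoid" and \<pi> where B: "comm_group B" "char2_quotient TYPE('f) A B c \<pi>"
      "card (carrier B) < card (carrier A)" by (rule A.exists_quotient)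
    interpret Q: char2_quotient A B "TYPE('f)" c \<pi> by (rule B(2))
    note powB = Q.exponent_image[OF less.prems(3)]
    note IH = less.hyps[OF B(3,1) Q.B.finG powB]
    have units: "\<forall>x\<in>A.V. \<exists>z\<in>A.V. z \<otimes>\<^bsub>group_algebra A\<^esub> x = A.unit"
      using Q.units_step IH by blast
    have bound: "card (unitary_subgroup A :: ('a \<Rightarrow> 'f) set) * card (UNIV :: 'f set) * card (fourth_powers B)
        \<le> \<iota> * card (squares B) * card A.symmetric"
      if "card (A.alternating \<inter> A.invariant) \<le> \<iota> * card A.defects" for \<iota>
      by (rule Q.unitary_bound_step[OF that]) (use IH in blast)
    have sq: "squares A \<subseteq> carrier A" "squares A \<noteq> {}" "\<And>x y. x \<in> squares A \<Longrightarrow> y \<in> squares A \<Longrightarrow> x \<otimes>\<^bsub>A\<^esub> inv\<^bsub>A\<^esub> y \<in> squares A"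
    proof -
      fix x y assume "x \<in> squares A" "y \<in> squares A"
      then obtain g h where gh: "g \<in> carrier A" "x = g \<otimes>\<^bsub>A\<^esub> g" "h \<in> carrier A" "y = h \<otimes>\<^bsub>A\<^esub> h"
        by (auto simp: squares_def)
      have "x \<otimes>\<^bsub>A\<^esub> inv\<^bsub>A\<^esub> y = (g \<otimes>\<^bsub>A\<^esub> inv\<^bsub>A\<^esub> h) \<otimes>\<^bsub>A\<^esub> (g \<otimes>\<^bsub>A\<^esub> inv\<^bsub>A\<^esub> h)"
        using gh by (simp add: A.inv_mult A.m_ac)
      then show "x \<otimes>\<^bsub>A\<^esub> inv\<^bsub>A\<^esub> y \<in> squares A" unfolding squares_def using gh by blast
    qed (auto simp: squares_def)
    have fp: "fourth_powers A \<subseteq> carrier A" "fourth_powers A \<noteq> {}" "\<And>x y. x \<in> fourth_powers A \<Longrightarrow> y \<in> fourth_powers A \<Longrightarrow> x \<otimes>\<^bsub>A\<^esub> inv\<^bsub>A\<^esub> y \<in> fourth_powers A"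
    proof -
      fix x y assume "x \<in> fourth_powers A" "y \<in> fourth_powers A"
      then obtain g h where gh: "g \<in> carrier A" "x = g \<otimes>\<^bsub>A\<^esub> g \<otimes>\<^bsub>A\<^esub> (g \<otimes>\<^bsub>A\<^esub> g)"
        "h \<in> carrier A" "y = h \<otimes>\<^bsub>A\<^esub> h \<otimes>\<^bsub>A\<^esub> (h \<otimes>\<^bsub>A\<^esub> h)"
        by (auto simp: fourth_powers_def)
      let ?k = "g \<otimes>\<^bsub>A\<^esub> inv\<^bsub>A\<^esub> h"
      have "x \<otimes>\<^bsub>A\<^esub> inv\<^bsub>A\<^esub> y = ?k \<otimes>\<^bsub>A\<^esub> ?k \<otimes>\<^bsub>A\<^esub> (?k \<otimes>\<^bsub>A\<^esub> ?k)"
        using gh by (simp add: A.inv_mult A.m_ac)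
      then show "x \<otimes>\<^bsub>A\<^esub> inv\<^bsub>A\<^esub> y \<in> fourth_powers A" unfolding fourth_powers_def using gh by blast
    qed (auto simp: fourth_powers_def)
    have sub: "fourth_powers A \<subseteq> squares A" unfolding fourth_powers_def squares_def by auto
    have csq: "c \<notin> squares A \<Longrightarrow> card (squares B) = card (squares A)"
      "c \<in> squares A \<Longrightarrow> card (squares A) = 2 * card (squares B)"
      unfolding Q.squares_image
      by (rule Q.card_image_\<pi>(1), rule sq(1), rule sq(3), assumption, assumption, rule sq(2), assumption)
         (rule Q.card_image_\<pi>(2), rule sq(1), rule sq(3), assumption, assumption, rule sq(2), assumption)
    have cfp: "c \<notin> fourth_powers A \<Longrightarrow> card (fourth_powers B) = card (fourth_powers A)"
      "c \<in> fourth_powers A \<Longrightarrow> card (fourth_powers A) = 2 * card (fourth_powers B)"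
      unfolding Q.fourth_powers_image
      by (rule Q.card_image_\<pi>(1), rule fp(1), rule fp(3), assumption, assumption, rule fp(2), assumption)
         (rule Q.card_image_\<pi>(2), rule fp(1), rule fp(3), assumption, assumption, rule fp(2), assumption)
    have le1: "card (A.alternating \<inter> A.invariant) \<le> 1 * card A.defects"
      if "\<And>\<alpha> g. g \<in> carrier A \<Longrightarrow> g \<otimes>\<^bsub>A\<^esub> g = c \<Longrightarrow> A.alt \<alpha> g \<in> A.defects"
      using card_mono[OF A.finite_defects A.alternating_invariant_subset_defects[OF that]] by simp
    consider "c \<notin> squares A" | "c \<in> fourth_powers A" | "c \<in> squares A" "c \<notin> fourth_powers A" by blast
    then have "card (unitary_subgroup A :: ('a \<Rightarrow> 'f) set) * card (UNIV :: 'f set) * card (fourth_powers A)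
       \<le> card (squares A) * card A.symmetric"
    proof cases
      case 1
      \<comment> \<open>Vacuous, as no g has square c.\<close>
      have "A.alt \<alpha> g \<in> A.defects" if "g \<in> carrier A" "g \<otimes>\<^bsub>A\<^esub> g = c" for \<alpha> g
        using 1 that by (auto simp: squares_def)
      moreover have "c \<notin> fourth_powers A" using 1 sub by blast
      ultimately show ?thesis using bound[OF le1] csq(1)[OF 1] cfp(1) by simp
    next
      case 2
      then obtain t where t: "t \<in> carrier A" "t \<otimes>\<^bsub>A\<^esub> t \<otimes>\<^bsub>A\<^esub> (t \<otimes>\<^bsub>A\<^esub> t) = c" by (auto simp: fourth_powers_def)
      have "A.alt \<alpha> g \<in> A.defects" if "g \<in> carrier A" "g \<otimes>\<^bsub>A\<^esub> g = c" for \<alpha> g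
        by (rule A.alt_defects_of_fourth_power[OF t that])
      moreover have "c \<in> squares A" using 2 sub by blast
      ultimately show ?thesis using bound[OF le1] csq(2) cfp(2)[OF 2] by simp
    next
      case 3
      then obtain z where z: "z \<in> carrier A" "z \<otimes>\<^bsub>A\<^esub> z = c" by (auto simp: squares_def)
      have "card (A.alternating \<inter> A.invariant) \<le> 2 * card A.defects"
        by (rule A.card_le_defects_square[OF z]) (use z A.m_comm in auto)
      from bound[OF this] show ?thesis using csq(2)[OF 3(1)] cfp(1)[OF 3(2)] by simp
    qed
    then show ?thesis using units by blast
  qed
qed

text \<open>In the abelian quotient B by c the two alternatives of \<open>cover\<close> become one,
  so the squares of B lie in at most |R| cosets of its fourth powers. The number of fourth powers
  then cancels from the bound for B.\<close>

lemma (in char2_central_involution) unitary_upper_bound: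
  fixes R :: "'a set"
  assumes pow: "\<And>g. g \<in> carrier G \<Longrightarrow> g [^] ((2::nat) ^ N) = \<one>"
    and alt: "\<And>\<alpha> g. g \<in> carrier G \<Longrightarrow> g \<otimes> g = c \<Longrightarrow> alt \<alpha> g \<in> defects"
    and R: "finite R" "R \<subseteq> carrier G"
    and cover: "\<And>g. g \<in> carrier G \<Longrightarrow> \<exists>r\<in>R. \<exists>h\<in>carrier G.
      g \<otimes> g = r \<otimes> (h \<otimes> h \<otimes> (h \<otimes> h)) \<or> g \<otimes> g = c \<otimes> (r \<otimes> (h \<otimes> h \<otimes> (h \<otimes> h)))"
  shows "\<And>x. x \<in> V \<Longrightarrow> \<exists>y\<in>V. y \<star> x = unit"
    and "card (unitary_subgroup G :: ('a \<Rightarrow> 'f) set) * card (UNIV :: 'f set) \<le> card R * card symmetric"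
proof -
  obtain B :: "'a monoid" and \<pi> where B: "comm_group B" "char2_quotient TYPE('f) G B c \<pi>"
    by (rule exists_quotient)
  interpret Q: char2_quotient G B "TYPE('f)" c \<pi> by (rule B(2))
  interpret \<pi>: group_hom G B \<pi> by unfold_locales (rule Q.hom)
  note powB = Q.exponent_image[OF pow]
  note ab = comm_group_unitary_bound[where 'f='f, OF B(1) Q.B.finG char2 powB]
  show "\<exists>y\<in>V. y \<otimes>\<^bsub>group_algebra G\<^esub> x = unit" if "x \<in> V" for x
    using Q.units_step[OF _ that] ab by blast
  let ?P = "card (fourth_powers B)"
  have 1: "card (alternating \<inter> invariant) \<le> 1 * card defects"
    using card_mono[OF finite_defects alternating_invariant_subset_defects[OF alt]] by simp
  have fin: "finite (fourth_powers B)" using Q.B.finG by (simp add: fourth_powers_def)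
  have "squares B \<subseteq> (\<lambda>(r, y). \<pi> r \<otimes>\<^bsub>B\<^esub> y) ` (R \<times> fourth_powers B)"
  proof
    fix b assume "b \<in> squares B"
    then obtain g where g: "g \<in> carrier G" "b = \<pi> (g \<otimes> g)"
      unfolding Q.squares_image by (auto simp: squares_def)
    obtain r h where rh: "r \<in> R" "h \<in> carrier G"
      "g \<otimes> g = r \<otimes> (h \<otimes> h \<otimes> (h \<otimes> h)) \<or> g \<otimes> g = c \<otimes> (r \<otimes> (h \<otimes> h \<otimes> (h \<otimes> h)))"
      using cover[OF g(1)] by blast
    have rG: "r \<in> carrier G" using rh R by blast
    have "\<pi> (r \<otimes> (h \<otimes> h \<otimes> (h \<otimes> h))) = \<pi> (g \<otimes> g)"
      using Q.\<pi>_eq_iff[of "r \<otimes> (h \<otimes> h \<otimes> (h \<otimes> h))" "g \<otimes> g"] rh rG g by auto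
    then have "b = \<pi> r \<otimes>\<^bsub>B\<^esub> (\<pi> h \<otimes>\<^bsub>B\<^esub> \<pi> h \<otimes>\<^bsub>B\<^esub> (\<pi> h \<otimes>\<^bsub>B\<^esub> \<pi> h))"
      using g rG rh(2) by simp
    moreover have "\<pi> h \<otimes>\<^bsub>B\<^esub> \<pi> h \<otimes>\<^bsub>B\<^esub> (\<pi> h \<otimes>\<^bsub>B\<^esub> \<pi> h) \<in> fourth_powers B"
      unfolding fourth_powers_def by (rule imageI) (rule \<pi>.hom_closed[OF rh(2)])
    ultimately show "b \<in> (\<lambda>(r, y). \<pi> r \<otimes>\<^bsub>B\<^esub> y) ` (R \<times> fourth_powers B)"
      using rh(1) by (intro image_eqI[of _ _ "(r, \<pi> h \<otimes>\<^bsub>B\<^esub> \<pi> h \<otimes>\<^bsub>B\<^esub> (\<pi> h \<otimes>\<^bsub>B\<^esub> \<pi> h))"]) auto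
  qed
  then have "card (squares B) \<le> card ((\<lambda>(r, y). \<pi> r \<otimes>\<^bsub>B\<^esub> y) ` (R \<times> fourth_powers B))"
    using R fin by (intro card_mono) auto
  also have "\<dots> \<le> card (R \<times> fourth_powers B)" using R fin by (intro card_image_le) auto
  finally have "card (squares B) \<le> card R * ?P" by (simp add: card_cartesian_product)
  then have "card (squares B) * card Q.B.symmetric \<le> card R * ?P * card Q.B.symmetric"
    by (rule mult_le_mono1)
  then have "card (unitary_subgroup G :: ('a \<Rightarrow> 'f) set) * card (UNIV :: 'f set) * ?P
      \<le> 1 * (card R * ?P) * card symmetric"
    using ab by (intro Q.unitary_bound_step[OF 1]) (meson order.trans)
  moreover have "?P > 0" using fin by (subst card_gt_0_iff) (auto simp: fourth_powers_def)
  ultimately show "card (unitary_subgroup G :: ('a \<Rightarrow> 'f) set) * card (UNIV :: 'f set) \<le> card R * card symmetric"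
    by (simp add: ac_simps)
qed

section \<open>The factors of the central product\<close>

text \<open>A common form for all factors: M_2(u, 1) with b b = 1, and for u = 2 the groups D8 (b b
  = 1) and Q8 (b b = c). The relation a^b = a^(1 + 2^(u-1)) is written as a b = b a c.\<close>

locale modular_factor = group H for H (structure) +
  fixes a b c and u :: nat
  assumes a: "a \<in> carrier H" and b: "b \<in> carrier H" and u: "2 \<le> u"
    and c_eq: "c = a [^] ((2::nat) ^ (u - 1))" and c_neq: "c \<noteq> \<one>"
    and a_pow: "a [^] ((2::nat) ^ u) = \<one>"
    and ab: "a \<otimes> b = b \<otimes> (a \<otimes> c)"
    and bb: "b \<otimes> b = \<one> \<or> b \<otimes> b = c"
    and gen: "carrier H \<subseteq> generate H {a, b}"
begin

lemma c: "c \<in> carrier H"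
  using a by (simp add: c_eq)

lemma cc: "c \<otimes> c = \<one>"
proof -
  have "c \<otimes> c = a [^] ((2::nat) ^ (u - 1) + 2 ^ (u - 1))" using a by (simp add: c_eq nat_pow_mult)
  also have "(2::nat) ^ (u - 1) + 2 ^ (u - 1) = 2 ^ u" using u by (cases u) auto
  finally show ?thesis using a_pow by simp
qed

lemma ac: "a \<otimes> c = c \<otimes> a"
  using a by (simp add: c_eq nat_pow_comm[of a 1, simplified])

lemma c_pow_even: "even k \<Longrightarrow> c [^] (k::nat) = \<one>"
proof -
  assume "even k"
  then obtain j where j: "k = 2 * j" by (elim evenE)
  have "c [^] k = (c [^] (2::nat)) [^] j" unfolding j using c by (simp only: nat_pow_pow)
  also have "c [^] (2::nat) = \<one>" using c cc by (simp add: numeral_2_eq_2)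
  finally show ?thesis by simp
qed

lemma c_pow_odd: "odd k \<Longrightarrow> c [^] (k::nat) = c"
  using c c_pow_even by (auto elim!: oddE)

lemma a_pow_b: "a [^] k \<otimes> b = b \<otimes> (a [^] k \<otimes> c [^] (k::nat))"
proof (induction k)
  case 0
  then show ?case using b by simp
next
  case (Suc k)
  have "a [^] Suc k \<otimes> b = a [^] k \<otimes> (a \<otimes> b)" using a b by (simp add: m_assoc)
  also have "\<dots> = a [^] k \<otimes> b \<otimes> (a \<otimes> c)" using a b c by (simp add: ab m_assoc)
  also have "\<dots> = b \<otimes> (a [^] k \<otimes> (c [^] k \<otimes> a) \<otimes> c)" using a b c by (simp add: Suc m_assoc)
  also have "c [^] k \<otimes> a = a \<otimes> c [^] k" using pow_mult_distrib ac c a by (metis group_commutes_pow)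
  also have "b \<otimes> (a [^] k \<otimes> (a \<otimes> c [^] k) \<otimes> c) = b \<otimes> (a [^] Suc k \<otimes> c [^] Suc k)"
    using a b c by (simp add: m_assoc)
  finally show ?case .
qed

text \<open>The commutation rule for a^k with k = 2^(u-1): the exponent is even because u \<ge> 2,
  so no factor c is left over.\<close>

lemma cb: "b \<otimes> c = c \<otimes> b"
proof -
  have e: "even ((2::nat) ^ (u - 1))" using u by simp
  show ?thesis using a_pow_b[of "2 ^ (u - 1)", folded c_eq, unfolded c_pow_even[OF e]] b c by simp
qed

lemma generate_subgroupI:
  assumes "subgroup K H" "a \<in> K" "b \<in> K"
  shows "K = carrier H"
  using assms gen generate_subgroup_incl[of "{a, b}" K] subgroup.subset by blast

lemma c_central: "x \<in> carrier H \<Longrightarrow> x \<otimes> c = c \<otimes> x"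
proof -
  have "subgroup {x \<in> carrier H. x \<otimes> c = c \<otimes> x} H"
  proof (rule subgroupI)
    fix x y assume "x \<in> {x \<in> carrier H. x \<otimes> c = c \<otimes> x}" "y \<in> {x \<in> carrier H. x \<otimes> c = c \<otimes> x}"
    then have "x \<in> carrier H" "x \<otimes> c = c \<otimes> x" "y \<in> carrier H" "y \<otimes> c = c \<otimes> y" by auto
    then show "x \<otimes> y \<in> {x \<in> carrier H. x \<otimes> c = c \<otimes> x}" using c by simp (metis m_assoc)
  next
    fix x assume "x \<in> {x \<in> carrier H. x \<otimes> c = c \<otimes> x}"
    then have "x \<in> carrier H" "x \<otimes> c = c \<otimes> x" by auto
    then show "inv x \<in> {x \<in> carrier H. x \<otimes> c = c \<otimes> x}" using c by simp (metis inv_closed inv_solve_left inv_solve_right m_assoc m_closed)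
  qed (use c in auto)
  from generate_subgroupI[OF this] show "x \<in> carrier H \<Longrightarrow> x \<otimes> c = c \<otimes> x"
    using a b ac cb by blast
qed

lemma c_left_commute: "x \<in> carrier H \<Longrightarrow> y \<in> carrier H \<Longrightarrow> x \<otimes> (c \<otimes> y) = c \<otimes> (x \<otimes> y)"
  using c c_central[of x] by (simp add: m_assoc[symmetric])

lemma c_cancel: "x \<in> carrier H \<Longrightarrow> c \<otimes> (c \<otimes> x) = x"
  using c cc by (simp add: m_assoc[symmetric])

text \<open>Commuting up to {1, c}. For fixed g the elements h with this property form a subgroup,
  so generators suffice.\<close>

definition commutes_mod :: "'a \<Rightarrow> 'a \<Rightarrow> bool" where
  "commutes_mod g h \<longleftrightarrow> g \<otimes> h = h \<otimes> g \<or> g \<otimes> h = c \<otimes> (h \<otimes> g)"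

lemma commutes_mod_sym: "g \<in> carrier H \<Longrightarrow> h \<in> carrier H \<Longrightarrow> commutes_mod g h \<Longrightarrow> commutes_mod h g"
  unfolding commutes_mod_def using c_cancel[of "h \<otimes> g"] by auto

lemma commutes_mod_mult:
  assumes g: "g \<in> carrier H" and x: "x \<in> carrier H" "commutes_mod g x" and y: "y \<in> carrier H" "commutes_mod g y"
  shows "commutes_mod g (x \<otimes> y)"
proof -
  have 1: "g \<otimes> (x \<otimes> y) = x \<otimes> (g \<otimes> y) \<or> g \<otimes> (x \<otimes> y) = c \<otimes> (x \<otimes> (g \<otimes> y))"
  proof -
    have "g \<otimes> (x \<otimes> y) = g \<otimes> x \<otimes> y" "x \<otimes> (g \<otimes> y) = x \<otimes> g \<otimes> y"
      "c \<otimes> (x \<otimes> (g \<otimes> y)) = c \<otimes> (x \<otimes> g) \<otimes> y"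
      using g x y c by (simp_all add: m_assoc)
    then show ?thesis using x(2) unfolding commutes_mod_def by (elim disjE) simp_all
  qed
  have 2: "x \<otimes> (g \<otimes> y) = x \<otimes> y \<otimes> g \<or> x \<otimes> (g \<otimes> y) = c \<otimes> (x \<otimes> y \<otimes> g)"
    using y(2) g x y c c_left_commute[of x "y \<otimes> g"] unfolding commutes_mod_def by (auto simp: m_assoc)
  have 3: "c \<otimes> (c \<otimes> (x \<otimes> y \<otimes> g)) = x \<otimes> y \<otimes> g" using c_cancel x y g by simp
  show ?thesis unfolding commutes_mod_def using 1 2 3 by metis
qed

lemma commutes_mod_inv:
  assumes g: "g \<in> carrier H" and x: "x \<in> carrier H" "commutes_mod g x"
  shows "commutes_mod g (inv x)"
proof -
  have "inv x \<otimes> (g \<otimes> x) \<otimes> inv x = inv x \<otimes> g" using g x by (simp add: m_assoc)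
  moreover have "inv x \<otimes> (x \<otimes> g) \<otimes> inv x = g \<otimes> inv x" using g x by (simp add: m_assoc[symmetric])
  moreover have "inv x \<otimes> (c \<otimes> (x \<otimes> g)) \<otimes> inv x = c \<otimes> (inv x \<otimes> (x \<otimes> g) \<otimes> inv x)"
    using g x c c_left_commute[of "inv x" "x \<otimes> g"] by (simp add: m_assoc)
  ultimately have "inv x \<otimes> g = g \<otimes> inv x \<or> inv x \<otimes> g = c \<otimes> (g \<otimes> inv x)"
    using x(2) unfolding commutes_mod_def by auto
  then show ?thesis using commutes_mod_sym[of "inv x" g] g x unfolding commutes_mod_def by auto
qed

lemma commutes_mod_generators:
  assumes g: "g \<in> carrier H" and "commutes_mod g a" "commutes_mod g b" and "x \<in> carrier H"
  shows "commutes_mod g x"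
proof -
  have "subgroup {x \<in> carrier H. commutes_mod g x} H"
  proof (rule subgroupI)
    have "\<one> \<in> {x \<in> carrier H. commutes_mod g x}" using g by (simp add: commutes_mod_def)
    then show "{x \<in> carrier H. commutes_mod g x} \<noteq> {}" by blast
  qed (use g commutes_mod_mult commutes_mod_inv in auto)
  from generate_subgroupI[OF this] show ?thesis using assms a b by blast
qed

text \<open>The generator criterion is used twice: for a and b against all x, and then, by symmetry,
  for arbitrary g against a and b.\<close>

lemma commutators:
  assumes "g \<in> carrier H" "h \<in> carrier H"
  shows "g \<otimes> h = h \<otimes> g \<or> g \<otimes> h = c \<otimes> (h \<otimes> g)"
proof -
  have ba: "commutes_mod a b" using ab a b c cb c_left_commute[of b a] by (simp add: commutes_mod_def ac)
  have A: "commutes_mod a x" if "x \<in> carrier H" for x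
    by (rule commutes_mod_generators[OF a _ ba that]) (simp add: commutes_mod_def)
  have B: "commutes_mod b x" if "x \<in> carrier H" for x
    by (rule commutes_mod_generators[OF b commutes_mod_sym[OF a b ba] _ that]) (simp add: commutes_mod_def)
  have "commutes_mod g h"
    by (rule commutes_mod_generators[OF assms(1) commutes_mod_sym[OF a assms(1) A[OF assms(1)]]
          commutes_mod_sym[OF b assms(1) B[OF assms(1)]] assms(2)])
  then show ?thesis by (simp add: commutes_mod_def)
qed

lemma not_commuting: "a \<otimes> b \<noteq> b \<otimes> a"
  using ab a b c c_neq by (simp add: m_assoc[symmetric])

text \<open>The link to \<open>central_product\<close>, which selects the elements to be identified
  as the nontrivial members of the derived subgroups.\<close>

lemma derived_eq: "derived H (carrier H) = {\<one>, c}"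
proof
  have sub: "subgroup {\<one>, c} H"
    using c cc by (intro subgroupI) (auto simp: inv_equality)
  have "derived_set H (carrier H) \<subseteq> {\<one>, c}"
  proof
    fix x assume "x \<in> derived_set H (carrier H)"
    then obtain g h where gh: "g \<in> carrier H" "h \<in> carrier H" "x = g \<otimes> h \<otimes> inv g \<otimes> inv h" by auto
    have e: "x = g \<otimes> h \<otimes> inv (h \<otimes> g)" using gh by (simp add: inv_mult_group m_assoc)
    from commutators[OF gh(1,2)] show "x \<in> {\<one>, c}"
    proof
      assume "g \<otimes> h = c \<otimes> (h \<otimes> g)"
      then have "x = c \<otimes> ((h \<otimes> g) \<otimes> inv (h \<otimes> g))" unfolding e using gh c by (simp only: m_assoc m_closed inv_closed)
      then show ?thesis using gh c by simp
    qed (use gh e in simp)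
  qed
  then show "derived H (carrier H) \<subseteq> {\<one>, c}"
    unfolding derived_def using generate_subgroup_incl[OF _ sub] by blast
  have e: "a \<otimes> b \<otimes> inv a \<otimes> inv b = c"
  proof -
    have ba: "a \<otimes> b = c \<otimes> (b \<otimes> a)" using ab a b c c_left_commute[of b a] by (simp add: ac)
    have "a \<otimes> b \<otimes> inv a \<otimes> inv b = a \<otimes> b \<otimes> inv (b \<otimes> a)" using a b by (simp add: inv_mult_group m_assoc)
    also have "\<dots> = c \<otimes> (b \<otimes> a) \<otimes> inv (b \<otimes> a)" by (simp only: ba)
    also have "\<dots> = c \<otimes> ((b \<otimes> a) \<otimes> inv (b \<otimes> a))" using a b c by (simp only: m_assoc m_closed inv_closed)
    finally show ?thesis using a b c by simp
  qed
  have "a \<otimes> b \<otimes> inv a \<otimes> inv b \<in> derived_set H (carrier H)" using a b by blast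
  then have "c \<in> derived H (carrier H)" unfolding e derived_def by (rule generate.incl)
  moreover have "\<one> \<in> derived H (carrier H)" unfolding derived_def by (rule generate.one)
  ultimately show "{\<one>, c} \<subseteq> derived H (carrier H)" by simp
qed

text \<open>A factor c arising when b^j is moved past a^k is again a power of a, so these products
  are closed under multiplication. The inverses of the generators are a^(2^u - 1) and b^3.\<close>

lemma normal_form:
  assumes "x \<in> carrier H"
  shows "\<exists>i j. x = a [^] (i::nat) \<otimes> b [^] (j::nat)"
proof -
  let ?T = "{x. \<exists>i j. x = a [^] (i::nat) \<otimes> b [^] (j::nat)}"
  have mult: "x \<otimes> y \<in> ?T" if xT: "x \<in> ?T" and yT: "y \<in> ?T" for x y
  proof -
    obtain i j where x: "x = a [^] (i::nat) \<otimes> b [^] (j::nat)" using xT by blast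
    obtain k l where y: "y = a [^] (k::nat) \<otimes> b [^] (l::nat)" using yT by blast
    let ?ai = "a [^] i" and ?bj = "b [^] j" and ?ak = "a [^] k" and ?bl = "b [^] l"
    have car: "?ai \<in> carrier H" "?bj \<in> carrier H" "?ak \<in> carrier H" "?bl \<in> carrier H" using a b by auto
    have xy: "x \<otimes> y = ?ai \<otimes> (?bj \<otimes> ?ak) \<otimes> ?bl" unfolding x y using car by (simp add: m_assoc)
    from commutators[OF car(2,3)] show ?thesis
    proof
      assume "?bj \<otimes> ?ak = ?ak \<otimes> ?bj"
      then have "x \<otimes> y = ?ai \<otimes> ?ak \<otimes> (?bj \<otimes> ?bl)" unfolding xy using car by (simp add: m_assoc)
      then have "x \<otimes> y = a [^] (i + k) \<otimes> b [^] (j + l)" using a b by (simp add: nat_pow_mult)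
      then show ?thesis by blast
    next
      assume "?bj \<otimes> ?ak = c \<otimes> (?ak \<otimes> ?bj)"
      then have "x \<otimes> y = c \<otimes> (?ai \<otimes> ?ak) \<otimes> (?bj \<otimes> ?bl)"
        unfolding xy using car c c_left_commute[OF car(1), of "?ak \<otimes> ?bj"] by (simp add: m_assoc)
      then have "x \<otimes> y = a [^] (2 ^ (u - 1) + (i + k)) \<otimes> b [^] (j + l)"
        unfolding c_eq using a b by (simp only: nat_pow_mult)
      then show ?thesis by blast
    qed
  qed
  have ainv: "inv a \<in> ?T"
  proof -
    have "a [^] ((2::nat) ^ u - 1) \<otimes> a = \<one>"
      using a a_pow nat_pow_Suc[of a "2 ^ u - 1"] by simp
    then have "inv a = a [^] ((2::nat) ^ u - 1) \<otimes> b [^] (0::nat)" using a by (simp add: inv_equality)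
    then show ?thesis by blast
  qed
  have binv: "inv b \<in> ?T"
  proof -
    have "b [^] (3::nat) \<otimes> b = b \<otimes> b \<otimes> (b \<otimes> b)" using b by (simp add: numeral_3_eq_3 m_assoc)
    also have "\<dots> = \<one>" using bb cc by auto
    finally have "inv b = a [^] (0::nat) \<otimes> b [^] (3::nat)" using a b by (simp add: inv_equality)
    then show ?thesis by blast
  qed
  have "x \<in> ?T" if "x \<in> generate H {a, b}" for x
    using that
  proof (induction rule: generate.induct)
    case one
    have "\<one> = a [^] (0::nat) \<otimes> b [^] (0::nat)" using a b by simp
    then show ?case by blast
  next
    case (incl h)
    have "a = a [^] (1::nat) \<otimes> b [^] (0::nat)" "b = a [^] (0::nat) \<otimes> b [^] (1::nat)" using a b by simp_all
    then show ?case using incl by blast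
  next
    case (inv h)
    then show ?case using ainv binv by blast
  next
    case (eng h1 h2)
    then show ?case using mult by blast
  qed
  then show ?thesis using assms gen by blast
qed

lemma finite_carrier: "finite (carrier H)"
proof -
  have b4: "b [^] (4::nat) = \<one>"
  proof -
    have "b [^] (4::nat) = b \<otimes> b \<otimes> (b \<otimes> b)" using b by (simp add: numeral_eq_Suc m_assoc)
    then show ?thesis using bb cc by auto
  qed
  have red: "x [^] k = x [^] (k mod m)" if "x \<in> carrier H" "x [^] m = \<one>" for x and k m :: nat
  proof -
    have "x [^] k = x [^] (m * (k div m) + k mod m)" by simp
    also have "\<dots> = (x [^] m) [^] (k div m) \<otimes> x [^] (k mod m)" using that(1) by (simp only: nat_pow_mult nat_pow_pow)
    finally show ?thesis using that by simp
  qed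
  have "carrier H \<subseteq> (\<lambda>(i, j). a [^] i \<otimes> b [^] j) ` ({..<(2::nat) ^ u} \<times> {..<4::nat})"
  proof
    fix x assume "x \<in> carrier H"
    then obtain i j where "x = a [^] (i::nat) \<otimes> b [^] (j::nat)" using normal_form by blast
    then have "x = a [^] (i mod 2 ^ u) \<otimes> b [^] (j mod 4)"
      using red[OF a a_pow, of i] red[OF b b4, of j] by simp
    then show "x \<in> (\<lambda>(i, j). a [^] i \<otimes> b [^] j) ` ({..<(2::nat) ^ u} \<times> {..<4::nat})"
      by (intro image_eqI[of _ _ "(i mod 2 ^ u, j mod 4)"]) auto
  qed
  then show ?thesis by (rule finite_subset) simp
qed

text \<open>Reordering the square of a^i b^j costs at most one c, and b^(2j) is 1 or c.\<close>

lemma square_cases: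
  assumes "x \<in> carrier H"
  shows "\<exists>i::nat. x \<otimes> x = a [^] (2 * i) \<or> x \<otimes> x = c \<otimes> a [^] (2 * i)"
proof -
  obtain i j where x: "x = a [^] (i::nat) \<otimes> b [^] (j::nat)" using normal_form assms by blast
  let ?a = "a [^] i" and ?b = "b [^] j"
  have car: "?a \<in> carrier H" "?b \<in> carrier H" using a b by auto
  have bj: "?b \<otimes> ?b = \<one> \<or> ?b \<otimes> ?b = c"
  proof -
    have "?b \<otimes> ?b = b [^] (j * 2)" using b by (simp add: nat_pow_mult mult_2_right)
    also have "\<dots> = (b [^] (2::nat)) [^] j" using b by (metis mult.commute nat_pow_pow)
    also have "b [^] (2::nat) = b \<otimes> b" using b by (simp add: numeral_2_eq_2)
    finally have e: "?b \<otimes> ?b = (b \<otimes> b) [^] j" .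
    show ?thesis using bb c_pow_even[of j] c_pow_odd[of j] unfolding e by (auto simp: nat_pow_one)
  qed
  have aa: "?a \<otimes> ?a = a [^] (2 * i)" using a by (simp add: nat_pow_mult mult_2)
  have xx: "x \<otimes> x = ?a \<otimes> (?b \<otimes> ?a) \<otimes> ?b" unfolding x using car by (simp add: m_assoc)
  have "x \<otimes> x = ?a \<otimes> ?a \<otimes> (?b \<otimes> ?b) \<or> x \<otimes> x = c \<otimes> (?a \<otimes> ?a \<otimes> (?b \<otimes> ?b))"
    using commutators[OF car(2,1)]
  proof
    assume "?b \<otimes> ?a = ?a \<otimes> ?b"
    then show ?thesis unfolding xx using car by (simp add: m_assoc)
  next
    assume "?b \<otimes> ?a = c \<otimes> (?a \<otimes> ?b)"
    then show ?thesis unfolding xx using car c c_left_commute[OF car(1), of "?a \<otimes> ?b"] by (simp add: m_assoc)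
  qed
  then have "x \<otimes> x = a [^] (2 * i) \<otimes> (?b \<otimes> ?b) \<or> x \<otimes> x = c \<otimes> (a [^] (2 * i) \<otimes> (?b \<otimes> ?b))"
    unfolding aa .
  moreover have A: "a [^] (2 * i) \<in> carrier H" using a by simp
  moreover note c_central[OF A] c_cancel[OF A]
  ultimately have "x \<otimes> x = a [^] (2 * i) \<or> x \<otimes> x = c \<otimes> a [^] (2 * i)" using bj by (metis r_one)
  then show ?thesis by blast
qed

lemma square_cases_order_8:
  assumes "u = 2" "x \<in> carrier H"
  shows "x \<otimes> x = \<one> \<or> x \<otimes> x = c"
proof -
  obtain i :: nat where i: "x \<otimes> x = a [^] (2 * i) \<or> x \<otimes> x = c \<otimes> a [^] (2 * i)" using square_cases[OF assms(2)] by (elim exE)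
  have "a [^] (2 * i) = c [^] i" unfolding c_eq using a by (simp add: assms(1) nat_pow_pow)
  then show ?thesis using i c cc c_pow_even[of i] c_pow_odd[of i] by (cases "even i") auto
qed

lemma b_pow_even: "b [^] (2 * j) = (b \<otimes> b) [^] (j::nat)"
proof -
  have "b [^] (2 * j) = (b [^] (2::nat)) [^] j" using b by (simp only: nat_pow_pow)
  also have "b [^] (2::nat) = b \<otimes> b" using b by (simp add: numeral_2_eq_2)
  finally show ?thesis .
qed

text \<open>In the normal form, commuting with b forces i to be even and commuting with a forces j
  to be even; what remains is 1 or c.\<close>

lemma central_square:
  assumes u2: "u = 2" and x: "x \<in> carrier H" and xa: "x \<otimes> a = a \<otimes> x" and xb: "x \<otimes> b = b \<otimes> x"
  shows "x \<otimes> x = \<one>"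
proof -
  obtain i j where x_eq: "x = a [^] (i::nat) \<otimes> b [^] (j::nat)" using normal_form[OF x] by (elim exE)
  let ?a = "a [^] i" and ?b = "b [^] j"
  have car: "?a \<in> carrier H" "?b \<in> carrier H" using a b by auto
  have bbj: "?b \<otimes> b = b \<otimes> ?b" using b by (simp add: nat_pow_comm[of b _ 1, simplified])
  have aai: "?a \<otimes> a = a \<otimes> ?a" using a by (simp add: nat_pow_comm[of a _ 1, simplified])
  have "?a \<otimes> b \<otimes> ?b = b \<otimes> ?a \<otimes> ?b" using xb car b bbj unfolding x_eq by (simp add: m_assoc)
  then have "?a \<otimes> b = b \<otimes> ?a" using car b by simp
  then have "even i" using a_pow_b[of i] c_pow_odd[of i] car b c c_neq by auto
  then obtain i' where "i = 2 * i'" by (elim evenE)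
  then have ai: "?a = c [^] i'" unfolding c_eq using a by (simp add: u2 nat_pow_pow)
  have "?a \<otimes> (?b \<otimes> a) = ?a \<otimes> (a \<otimes> ?b)" using xa car a aai unfolding x_eq by (simp add: m_assoc[symmetric])
  then have ba: "?b \<otimes> a = a \<otimes> ?b" using car a by simp
  have "even j"
  proof (rule ccontr)
    assume "odd j"
    then obtain j' where j: "j = Suc (2 * j')" by (elim oddE) simp
    have "b [^] (2 * j') = \<one> \<or> b [^] (2 * j') = c"
      unfolding b_pow_even using bb c_pow_even[of j'] c_pow_odd[of j'] by (auto simp: nat_pow_one)
    then have "?b = b \<or> ?b = c \<otimes> b" using b by (auto simp: j)
    then have "b \<otimes> a = a \<otimes> b" using ba a b c c_left_commute[OF a b] by (auto simp: m_assoc)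
    then show False using not_commuting by simp
  qed
  then obtain j' where "j = 2 * j'" by (elim evenE)
  then have bj: "?b = (b \<otimes> b) [^] j'" by (simp only: b_pow_even)
  have "?a = \<one> \<or> ?a = c" unfolding ai using c_pow_even[of i'] c_pow_odd[of i'] by blast
  moreover have "?b = \<one> \<or> ?b = c"
    unfolding bj using bb c_pow_even[of j'] c_pow_odd[of j'] by (auto simp: nat_pow_one)
  ultimately have "x = \<one> \<or> x = c" using c cc by (auto simp: x_eq)
  then show ?thesis using cc by auto
qed

text \<open>In a dihedral factor b and a b are two involutions that generate the group, so a
  noncentral element fails to commute with one of them.\<close>

lemma involution_ab:
  assumes "u = 2" "b \<otimes> b = \<one>"
  shows "a \<otimes> b \<otimes> (a \<otimes> b) = \<one>"
proof -
  have aa: "a \<otimes> a = c" using a assms(1) by (simp add: c_eq numeral_2_eq_2)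
  have "a \<otimes> b \<otimes> (a \<otimes> b) = b \<otimes> (a \<otimes> c) \<otimes> (a \<otimes> b)" by (simp only: ab)
  also have "\<dots> = b \<otimes> (c \<otimes> (a \<otimes> a) \<otimes> b)" using a b c by (simp add: ac m_assoc)
  also have "\<dots> = \<one>" using b assms(2) by (simp add: aa cc)
  finally show ?thesis .
qed

end

section \<open>Words acting on a concrete model of the factors\<close>

definition eval_word :: "('x \<Rightarrow> bool \<Rightarrow> 's \<Rightarrow> 's) \<Rightarrow> 'x word \<Rightarrow> 's \<Rightarrow> 's" where
  "eval_word \<phi> w = foldr (\<lambda>(x, e) f. \<phi> x e \<circ> f) w id"

lemma eval_word_Nil [simp]: "eval_word \<phi> [] = id"
  and eval_word_Cons [simp]: "eval_word \<phi> ((x, e) # w) = \<phi> x e \<circ> eval_word \<phi> w"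
  by (simp_all add: eval_word_def)

lemma eval_word_append: "eval_word \<phi> (v @ w) = eval_word \<phi> v \<circ> eval_word \<phi> w"
  by (induction v) (auto simp: o_assoc)

text \<open>The universal property of a presentation: if inverse letters cancel and both sides of
  each relation act alike, the action depends only on the class of the word.\<close>

lemma eval_word_eq:
  assumes "word_eq R v w" "\<And>x e. \<phi> x e \<circ> \<phi> x (\<not> e) = id"
    "\<And>r s. (r, s) \<in> R \<Longrightarrow> eval_word \<phi> r = eval_word \<phi> s"
  shows "eval_word \<phi> v = eval_word \<phi> w"
  using assms(1)
proof (induction rule: word_eq.induct)
  case (cancel x e)
  then show ?case using assms(2)[of x e] by simp
qed (simp_all add: eval_word_append assms(3))

text \<open>The monomial representation \<open>a \<mapsto> diag(\<omega>, -\<omega>)\<close>, \<open>b \<mapsto>\<close> (possibly signed) transposition, written as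
  an action on the union of the two coordinate lines. Central elements act by scalars, which shows that
  \<open>c = a\<^bsup>2^(u-1)\<^esup>\<close>, acting as \<open>-1\<close>, is not trivial in the presented group.\<close>

definition model :: "nat \<Rightarrow> bool \<Rightarrow> gen2 \<Rightarrow> bool \<Rightarrow> bool \<times> complex \<Rightarrow> bool \<times> complex" where
  "model u \<epsilon> x e = (\<lambda>(s, z). case x of
     gen_a \<Rightarrow> (s, (if s then -1 else 1) * (if e then cis (pi / 2 ^ (u - 1)) else inverse (cis (pi / 2 ^ (u - 1)))) * z)
   | gen_b \<Rightarrow> (\<not> s, if \<epsilon> \<and> s = e then - z else z))"

lemma model_inverse: "model u \<epsilon> x e \<circ> model u \<epsilon> x (\<not> e) = id"
  by (cases x; cases e) (auto simp: model_def fun_eq_iff cis_mult)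

lemma model_wpow:
  "eval_word (model u \<epsilon>) (wpow gen_a k) (s, z) = (s, ((if s then -1 else 1) * cis (pi / 2 ^ (u - 1))) ^ k * z)"
  by (induction k) (auto simp: wpow_def model_def)

lemma cis_power_half: "cis (pi / 2 ^ k) ^ (2 ^ k) = -1"
  by (simp add: DeMoivre)

lemma model_wpow_half: "2 \<le> u \<Longrightarrow> eval_word (model u \<epsilon>) (wpow gen_a (2 ^ (u - 1))) = (\<lambda>(s, z). (s, - z))"
  by (auto simp: fun_eq_iff model_wpow power_mult_distrib cis_power_half)

lemma model_wpow_full: "2 \<le> u \<Longrightarrow> eval_word (model u \<epsilon>) (wpow gen_a (2 ^ u)) = id"
proof -
  assume u: "2 \<le> u"
  have "(2::nat) ^ u = 2 ^ (u - 1) + 2 ^ (u - 1)" using u by (cases u) auto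
  then have "wpow gen_a (2 ^ u) = wpow gen_a (2 ^ (u - 1)) @ wpow gen_a (2 ^ (u - 1))"
    by (simp add: wpow_def replicate_add)
  then show ?thesis by (auto simp: fun_eq_iff eval_word_append model_wpow_half[OF u, unfolded One_nat_def])
qed

text \<open>Conjugation by b exchanges \<omega> and -\<omega>, the possible signs of b cancelling;
  the resulting factor -1 is the action of a^(2^(u-1)).\<close>

lemma model_conj: "2 \<le> u \<Longrightarrow> eval_word (model u \<epsilon>) conj_ab = eval_word (model u \<epsilon>) (wpow gen_a (1 + 2 ^ (u - 1)))"
proof -
  assume u: "2 \<le> u"
  have "wpow gen_a (1 + 2 ^ (u - 1)) = (gen_a, True) # wpow gen_a (2 ^ (u - 1))" by (simp add: wpow_def)
  then show ?thesis
    by (auto simp: conj_ab_def model_wpow_half[OF u, unfolded One_nat_def] fun_eq_iff) (auto simp: model_def)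
qed

text \<open>With \<epsilon> the sign changes on exactly one of the two passages between the
  coordinate lines, so b b acts as -1.\<close>

lemma model_bb: "2 \<le> u \<Longrightarrow> eval_word (model u \<epsilon>) (wpow gen_b 2) = eval_word (model u \<epsilon>) (if \<epsilon> then wpow gen_a (2 ^ (u - 1)) else [])"
proof -
  assume u: "2 \<le> u"
  have "wpow gen_b 2 = [(gen_b, True), (gen_b, True)]" by (simp add: wpow_def numeral_2_eq_2)
  then show ?thesis
    by (auto simp: model_wpow_half[OF u, unfolded One_nat_def] fun_eq_iff) (auto simp: model_def)
qed

section \<open>The presented groups as modular factors\<close>

lemma presented_group_carrier: "carrier (presented_group R) = range (word_class R)"
  and presented_group_one: "\<one>\<^bsub>presented_group R\<^esub> = word_class R []"
  by (simp_all add: presented_group_def)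

lemma word_class_carrier [simp]: "word_class R w \<in> carrier (presented_group R)"
  by (simp add: presented_group_carrier)

lemma word_class_wpow:
  "word_class R (wpow x i) = word_class R [(x, True)] [^]\<^bsub>presented_group R\<^esub> (i::nat)"
proof -
  interpret group "presented_group R" by (rule group_presented_group)
  show ?thesis
  proof (induction i)
    case 0
    then show ?case by (simp add: wpow_def presented_group_one)
  next
    case (Suc i)
    have "wpow x (Suc i) = wpow x i @ [(x, True)]" by (simp add: wpow_def replicate_append_same)
    then show ?case using Suc by (simp add: presented_group_mult[symmetric])
  qed
qed

lemma word_class_inv: "word_class R [(x, False)] = inv\<^bsub>presented_group R\<^esub> (word_class R [(x, True)])"
proof -
  interpret group "presented_group R" by (rule group_presented_group)
  have "word_class R [(x, False)] \<otimes>\<^bsub>presented_group R\<^esub> word_class R [(x, True)] = \<one>\<^bsub>presented_group R\<^esub>"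
    using word_eq.cancel[of R x False] by (simp add: presented_group_one word_class_eq_iff)
  from inv_equality[OF this] show ?thesis by simp
qed

lemma presented_group_generate:
  "carrier (presented_group R) \<subseteq> generate (presented_group R) {word_class R [(gen_a, True)], word_class R [(gen_b, True)]}"
proof -
  let ?S = "{word_class R [(gen_a, True)], word_class R [(gen_b, True)]}"
  have letter: "word_class R [(x, e)] \<in> generate (presented_group R) ?S" for x e
    by (cases x; cases e) (auto simp: word_class_inv intro: generate.incl generate.inv)
  have "word_class R w \<in> generate (presented_group R) ?S" for w
  proof (induction w)
    case Nil
    then show ?case using generate.one[of "presented_group R" ?S] by (simp add: presented_group_one)
  next
    case (Cons l w)
    obtain x e where l: "l = (x, e)" by force
    show ?case using generate.eng[OF letter[of x e] Cons] by (simp add: l)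
  qed
  then show ?thesis by (auto simp: presented_group_carrier)
qed

text \<open>The equations of the locale follow from the relations. That c is not 1 cannot be derived
  from relations and is read off the action, where c changes the sign of the coordinate.\<close>

lemma modular_factor_presented_group:
  fixes R :: "(gen2 word \<times> gen2 word) set"
  defines "A \<equiv> word_class R [(gen_a, True)]" and "B \<equiv> word_class R [(gen_b, True)]"
  assumes u: "2 \<le> u"
    and aa: "A [^]\<^bsub>presented_group R\<^esub> ((2::nat) ^ u) = \<one>\<^bsub>presented_group R\<^esub>"
    and bb: "B \<otimes>\<^bsub>presented_group R\<^esub> B = (if \<epsilon> then A [^]\<^bsub>presented_group R\<^esub> ((2::nat) ^ (u - 1)) else \<one>\<^bsub>presented_group R\<^esub>)"
    and ab: "word_class R conj_ab = A [^]\<^bsub>presented_group R\<^esub> (1 + (2::nat) ^ (u - 1))"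
    and R: "\<And>r s. (r, s) \<in> R \<Longrightarrow> eval_word (model u \<epsilon>) r = eval_word (model u \<epsilon>) s"
  shows "modular_factor (presented_group R) A B (A [^]\<^bsub>presented_group R\<^esub> ((2::nat) ^ (u - 1))) u"
proof -
  let ?P = "presented_group R"
  interpret group ?P by (rule group_presented_group)
  have car: "A \<in> carrier ?P" "B \<in> carrier ?P" by (simp_all add: A_def B_def)
  have "word_class R conj_ab = inv\<^bsub>?P\<^esub> B \<otimes>\<^bsub>?P\<^esub> (A \<otimes>\<^bsub>?P\<^esub> B)"
    unfolding A_def B_def word_class_inv[symmetric] by (simp add: conj_ab_def)
  then have "A \<otimes>\<^bsub>?P\<^esub> B = B \<otimes>\<^bsub>?P\<^esub> A [^]\<^bsub>?P\<^esub> (1 + (2::nat) ^ (u - 1))"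
    using ab car by (metis inv_solve_left m_closed nat_pow_closed)
  also have "A [^]\<^bsub>?P\<^esub> (1 + (2::nat) ^ (u - 1)) = A \<otimes>\<^bsub>?P\<^esub> A [^]\<^bsub>?P\<^esub> ((2::nat) ^ (u - 1))"
    using car nat_pow_mult[OF car(1), of 1] by simp
  finally have ab': "A \<otimes>\<^bsub>?P\<^esub> B = B \<otimes>\<^bsub>?P\<^esub> (A \<otimes>\<^bsub>?P\<^esub> A [^]\<^bsub>?P\<^esub> ((2::nat) ^ (u - 1)))" .
  have "A [^]\<^bsub>?P\<^esub> ((2::nat) ^ (u - 1)) \<noteq> \<one>\<^bsub>?P\<^esub>"
  proof
    assume "A [^]\<^bsub>?P\<^esub> ((2::nat) ^ (u - 1)) = \<one>\<^bsub>?P\<^esub>"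
    then have "word_eq R (wpow gen_a (2 ^ (u - 1))) []"
      by (simp add: A_def word_class_wpow[symmetric] presented_group_one word_class_eq_iff)
    then have "eval_word (model u \<epsilon>) (wpow gen_a (2 ^ (u - 1))) = eval_word (model u \<epsilon>) []"
      using model_inverse R by (rule eval_word_eq)
    then have "(\<lambda>(s::bool, z::complex). (s, - z)) = id" by (simp add: model_wpow_half[OF u, unfolded One_nat_def])
    from fun_cong[OF this, of "(True, 1)"] show False by simp
  qed
  then show ?thesis
    using car u aa bb ab' presented_group_generate[of R, folded A_def B_def]
    by unfold_locales (auto split: if_splits)
qed

text \<open>The character f is the exponent sum of a modulo 4. The conjugation relation has sums 1
  and 1 + 2^(u-1) on its two sides, which agree modulo 4 once 3 \<le> u.\<close>

lemma modular_factor_M2: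
  assumes u: "2 \<le> u"
  shows "\<exists>a b c. modular_factor (M2 u 1) a b c u \<and> b \<otimes>\<^bsub>M2 u 1\<^esub> b = \<one>\<^bsub>M2 u 1\<^esub>
    \<and> (3 \<le> u \<longrightarrow> (\<exists>f\<in>carrier (M2 u 1) \<rightarrow> {0..<4::int}. f a = 1 \<and>
         (\<forall>x\<in>carrier (M2 u 1). \<forall>y\<in>carrier (M2 u 1). f (x \<otimes>\<^bsub>M2 u 1\<^esub> y) = (f x + f y) mod 4)))"
proof -
  define R where "R = {(wpow gen_a (2 ^ u), []), (wpow gen_b (2 ^ 1), []),
      (conj_ab, wpow gen_a (1 + 2 ^ (u - 1)))}"
  have M2: "M2 u 1 = presented_group R" by (simp add: M2_def R_def)
  interpret group "presented_group R" by (rule group_presented_group)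
  have r: "word_class R v = word_class R w" if "(v, w) \<in> R" for v w
    using that by (simp add: word_class_eq_iff word_eq.relation)
  have 1: "word_class R [(gen_a, True)] [^]\<^bsub>presented_group R\<^esub> ((2::nat) ^ u) = \<one>\<^bsub>presented_group R\<^esub>"
    unfolding word_class_wpow[symmetric] presented_group_one by (rule r) (simp add: R_def)
  have "word_class R (wpow gen_b 2) = \<one>\<^bsub>presented_group R\<^esub>"
    unfolding presented_group_one by (rule r) (simp add: R_def)
  then have 2: "word_class R [(gen_b, True)] \<otimes>\<^bsub>presented_group R\<^esub> word_class R [(gen_b, True)] = \<one>\<^bsub>presented_group R\<^esub>"
    by (simp add: wpow_def numeral_2_eq_2)
  have 3: "word_class R conj_ab = word_class R [(gen_a, True)] [^]\<^bsub>presented_group R\<^esub> (1 + (2::nat) ^ (u - 1))"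
    unfolding word_class_wpow[symmetric] by (rule r) (simp add: R_def)
  have mf: "modular_factor (presented_group R) (word_class R [(gen_a, True)]) (word_class R [(gen_b, True)])
     (word_class R [(gen_a, True)] [^]\<^bsub>presented_group R\<^esub> ((2::nat) ^ (u - 1))) u"
    by (rule modular_factor_presented_group[where \<epsilon> = False, OF u 1 _ 3])
       (use u 2 model_wpow_full model_conj model_bb[of u False] in \<open>auto simp: R_def\<close>)
  have "\<exists>f\<in>carrier (presented_group R) \<rightarrow> {0..<4::int}. f (word_class R [(gen_a, True)]) = 1 \<and>
     (\<forall>x\<in>carrier (presented_group R). \<forall>y\<in>carrier (presented_group R). f (x \<otimes>\<^bsub>presented_group R\<^esub> y) = (f x + f y) mod 4)"
    if u3: "3 \<le> u"
  proof -
    define weight :: "gen2 word \<Rightarrow> int" where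
      "weight w = (\<Sum>(x, e)\<leftarrow>w. if x = gen_a then if e then 1 else -1 else 0)" for w
    have wpow: "weight (wpow gen_a k) = int k" "weight (wpow gen_b k) = 0" for k
      by (induction k) (auto simp: weight_def wpow_def)
    have app: "weight (v @ w) = weight v + weight w" for v w by (simp add: weight_def)
    have d: "(4::int) dvd 2 ^ (u - 1)" "(4::int) dvd 2 ^ u"
      using u3 le_imp_power_dvd[of 2 "u - 1" "2::int"] le_imp_power_dvd[of 2 u "2::int"] by auto
    have inv: "weight v mod 4 = weight w mod 4" if "word_eq R v w" for v w
      using that
    proof (induction rule: word_eq.induct)
      case (append v v' w w')
      then show ?case by (simp add: app) (metis mod_add_cong)
    next
      case (cancel x e)
      then show ?case by (simp add: weight_def)
    next
      case (relation r s)
      have "weight conj_ab = 1" by (simp add: conj_ab_def weight_def)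
      moreover have "(1 + 2 ^ (u - 1)) mod 4 = (1::int)" using d(1) by presburger
      ultimately show ?case using relation d(2)
        by (auto simp: R_def wpow) (auto simp: weight_def)
    qed auto
    \<comment> \<open>The weight is read off an arbitrary word of the class; \<open>inv\<close>
      makes the choice irrelevant.\<close>
    define f where "f x = weight (SOME w. x = word_class R w) mod 4" for x
    have f: "f (word_class R w) = weight w mod 4" for w
    proof -
      have "word_class R w = word_class R (SOME v. word_class R w = word_class R v)" by (rule someI) (rule HOL.refl)
      then show ?thesis unfolding f_def using inv by (simp add: word_class_eq_iff)
    qed
    show ?thesis
    proof (intro bexI conjI ballI)
      show "f (word_class R [(gen_a, True)]) = 1" by (simp add: f weight_def)
      show "f (x \<otimes>\<^bsub>presented_group R\<^esub> y) = (f x + f y) mod 4"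
        if "x \<in> carrier (presented_group R)" "y \<in> carrier (presented_group R)" for x y
        using that by (auto simp: presented_group_carrier f app mod_add_eq)
      show "f \<in> carrier (presented_group R) \<rightarrow> {0..<4}" by (auto simp: f_def)
    qed
  qed
  then show ?thesis unfolding M2 using mf 2 by blast
qed

text \<open>D8 and Q8 differ only in the value of b b. The relation a^b = a^-1 takes the common form
  because a^-1 = a^3 = a^(1 + 2^(2-1)).\<close>

lemma modular_factor_order_8:
  fixes \<epsilon> :: bool
  defines "R \<equiv> {(wpow gen_a 4, []), (wpow gen_b 2, if \<epsilon> then wpow gen_a 2 else []), (conj_ab, [(gen_a, False)])}"
  shows "\<exists>a b c. modular_factor (presented_group R) a b c 2 \<and>
    (\<not> \<epsilon> \<longrightarrow> b \<otimes>\<^bsub>presented_group R\<^esub> b = \<one>\<^bsub>presented_group R\<^esub>)"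
proof -
  interpret group "presented_group R" by (rule group_presented_group)
  let ?A = "word_class R [(gen_a, True)]" and ?B = "word_class R [(gen_b, True)]"
  have r: "word_class R v = word_class R w" if "(v, w) \<in> R" for v w
    using that by (simp add: word_class_eq_iff word_eq.relation)
  have 1: "?A [^]\<^bsub>presented_group R\<^esub> ((2::nat) ^ 2) = \<one>\<^bsub>presented_group R\<^esub>"
    unfolding word_class_wpow[symmetric] presented_group_one by (rule r) (simp add: R_def)
  have "word_class R (wpow gen_b 2) = word_class R (if \<epsilon> then wpow gen_a 2 else [])"
    by (rule r) (simp add: R_def)
  then have 2: "?B \<otimes>\<^bsub>presented_group R\<^esub> ?B =
      (if \<epsilon> then ?A [^]\<^bsub>presented_group R\<^esub> ((2::nat) ^ (2 - 1)) else \<one>\<^bsub>presented_group R\<^esub>)"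
    by (auto simp: word_class_wpow[symmetric] presented_group_one) (simp_all add: wpow_def numeral_2_eq_2)
  have "?A [^]\<^bsub>presented_group R\<^esub> (3::nat) \<otimes>\<^bsub>presented_group R\<^esub> ?A = \<one>\<^bsub>presented_group R\<^esub>"
    using 1 by (simp add: nat_pow_Suc[symmetric])
  from inv_equality[OF this] have "inv\<^bsub>presented_group R\<^esub> ?A = ?A [^]\<^bsub>presented_group R\<^esub> (3::nat)" by simp
  moreover have "word_class R conj_ab = word_class R [(gen_a, False)]" by (rule r) (simp add: R_def)
  moreover have "1 + (2::nat) ^ (2 - 1) = 3" by simp
  ultimately have 3: "word_class R conj_ab = ?A [^]\<^bsub>presented_group R\<^esub> (1 + (2::nat) ^ (2 - 1))"
    by (simp only: word_class_inv)
  have "eval_word (model 2 \<epsilon>) conj_ab = eval_word (model 2 \<epsilon>) [(gen_a, False)]"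
    by (auto simp: conj_ab_def fun_eq_iff model_def)
  moreover have "eval_word (model 2 \<epsilon>) (wpow gen_a 4) = id"
    using model_wpow_full[of 2 \<epsilon>] by simp
  moreover have "eval_word (model 2 \<epsilon>) (wpow gen_b 2) = eval_word (model 2 \<epsilon>) (if \<epsilon> then wpow gen_a 2 else [])"
    using model_bb[of 2 \<epsilon>] by simp
  ultimately have "modular_factor (presented_group R) ?A ?B (?A [^]\<^bsub>presented_group R\<^esub> ((2::nat) ^ (2 - 1))) 2"
    by (intro modular_factor_presented_group[where \<epsilon> = \<epsilon>, OF _ 1 2 3]) (auto simp: R_def)
  then show ?thesis using 2 by (intro exI[of _ ?A] exI[of _ ?B] exI) auto
qed

lemma modular_factor_D8: "\<exists>a b c. modular_factor D8 a b c 2 \<and> b \<otimes>\<^bsub>D8\<^esub> b = \<one>\<^bsub>D8\<^esub>"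
  using modular_factor_order_8[of False] by (simp add: D8_def)

lemma modular_factor_Q8: "\<exists>a b c. modular_factor Q8 a b c 2"
  using modular_factor_order_8[of True] by (auto simp: Q8_def)

section \<open>The central product\<close>

locale central_product_factors =
  fixes Hs :: "'x monoid list" and a b c :: "nat \<Rightarrow> 'x" and u :: "nat \<Rightarrow> nat"
  assumes factor: "i < length Hs \<Longrightarrow> modular_factor (Hs ! i) (a i) (b i) (c i) (u i)"
    and nonempty: "0 < length Hs"
begin

lemma factor_group: "i < length Hs \<Longrightarrow> group (Hs ! i)"
  by (rule modular_factor.axioms(1)[OF factor])

lemma factor_closed:
  "i < length Hs \<Longrightarrow> a i \<in> carrier (Hs ! i)" "i < length Hs \<Longrightarrow> b i \<in> carrier (Hs ! i)"
  "i < length Hs \<Longrightarrow> c i \<in> carrier (Hs ! i)" "i < length Hs \<Longrightarrow> \<one>\<^bsub>Hs ! i\<^esub> \<in> carrier (Hs ! i)"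
  using modular_factor.a[OF factor] modular_factor.b[OF factor] modular_factor.c[OF factor]
    group.is_monoid[OF factor_group] monoid.one_closed by simp_all

definition P :: "(nat \<Rightarrow> 'x) monoid" where
  "P = product_group {..<length Hs} (\<lambda>i. Hs ! i)"

sublocale P: group P
  unfolding P_def by (rule product_group) (simp add: factor_group)

lemma P_closed: "x \<in> carrier P \<Longrightarrow> i < length Hs \<Longrightarrow> x i \<in> carrier (Hs ! i)"
  by (auto simp: P_def)

lemma P_mult: "i < length Hs \<Longrightarrow> (x \<otimes>\<^bsub>P\<^esub> y) i = x i \<otimes>\<^bsub>Hs ! i\<^esub> y i"
  by (simp add: P_def)

lemma P_one: "i < length Hs \<Longrightarrow> \<one>\<^bsub>P\<^esub> i = \<one>\<^bsub>Hs ! i\<^esub>"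
  by (simp add: P_def)

lemma P_inv: "x \<in> carrier P \<Longrightarrow> i < length Hs \<Longrightarrow> (inv\<^bsub>P\<^esub> x) i = inv\<^bsub>Hs ! i\<^esub> (x i)"
  unfolding P_def by (subst inv_product_group) (auto simp: factor_group)

lemma P_ext:
  assumes "x \<in> carrier P" "y \<in> carrier P" "\<And>i. i < length Hs \<Longrightarrow> x i = y i"
  shows "x = y"
  using assms unfolding P_def carrier_product_group by (intro PiE_ext) auto

definition emb :: "nat \<Rightarrow> 'x \<Rightarrow> nat \<Rightarrow> 'x" where
  "emb = embed_factor Hs"

lemma emb_apply: "j < length Hs \<Longrightarrow> emb i x j = (if j = i then x else \<one>\<^bsub>Hs ! j\<^esub>)"
  by (simp add: emb_def embed_factor_def)

lemma emb_closed: "i < length Hs \<Longrightarrow> x \<in> carrier (Hs ! i) \<Longrightarrow> emb i x \<in> carrier P"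
  using factor_closed(4) by (auto simp: emb_def embed_factor_def P_def)

definition identifications :: "(nat \<Rightarrow> 'x) set" where
  "identifications = {emb i (c i) \<otimes>\<^bsub>P\<^esub> inv\<^bsub>P\<^esub> (emb j (c j)) | i j. i < length Hs \<and> j < length Hs}"

definition N :: "(nat \<Rightarrow> 'x) set" where
  "N = generate P identifications"

lemma central_product_eq: "central_product Hs = P Mod N"
proof -
  have d: "derived (Hs ! i) (carrier (Hs ! i)) - {\<one>\<^bsub>Hs ! i\<^esub>} = {c i}" if "i < length Hs" for i
    using modular_factor.derived_eq[OF factor[OF that]] modular_factor.c_neq[OF factor[OF that]] by auto
  have "{emb i x \<otimes>\<^bsub>P\<^esub> inv\<^bsub>P\<^esub> (emb j y) | i j x y.
      i < length Hs \<and> j < length Hs \<and>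
      x \<in> derived (Hs ! i) (carrier (Hs ! i)) - {\<one>\<^bsub>Hs ! i\<^esub>} \<and>
      y \<in> derived (Hs ! j) (carrier (Hs ! j)) - {\<one>\<^bsub>Hs ! j\<^esub>}} = identifications"
    (is "?L = _")
  proof
    show "?L \<subseteq> identifications"
    proof
      fix v assume "v \<in> ?L"
      then obtain i j x y where v: "v = emb i x \<otimes>\<^bsub>P\<^esub> inv\<^bsub>P\<^esub> (emb j y)" and ij: "i < length Hs" "j < length Hs"
        and xy: "x \<in> derived (Hs ! i) (carrier (Hs ! i)) - {\<one>\<^bsub>Hs ! i\<^esub>}"
          "y \<in> derived (Hs ! j) (carrier (Hs ! j)) - {\<one>\<^bsub>Hs ! j\<^esub>}" by blast
      have "x = c i" "y = c j" using xy unfolding d[OF ij(1)] d[OF ij(2)] by auto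
      then show "v \<in> identifications" unfolding identifications_def v using ij by blast
    qed
    show "identifications \<subseteq> ?L"
    proof
      fix v assume "v \<in> identifications"
      then obtain i j where v: "v = emb i (c i) \<otimes>\<^bsub>P\<^esub> inv\<^bsub>P\<^esub> (emb j (c j))" and ij: "i < length Hs" "j < length Hs"
        unfolding identifications_def by blast
      have "c i \<in> derived (Hs ! i) (carrier (Hs ! i)) - {\<one>\<^bsub>Hs ! i\<^esub>}"
        "c j \<in> derived (Hs ! j) (carrier (Hs ! j)) - {\<one>\<^bsub>Hs ! j\<^esub>}"
        unfolding d[OF ij(1)] d[OF ij(2)] by auto
      then show "v \<in> ?L" using v ij by blast
    qed
  qed
  then show ?thesis
    unfolding central_product_def Let_def N_def P_def[symmetric] emb_def by simp
qed

text \<open>A central subgroup of P in which x x = 1. It contains N and all commutators of P, so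
  every ambiguity met later lies in it.\<close>

definition K :: "(nat \<Rightarrow> 'x) set" where
  "K = {x \<in> carrier P. \<forall>i<length Hs. x i = \<one>\<^bsub>Hs ! i\<^esub> \<or> x i = c i}"

lemma K_P: "K \<subseteq> carrier P"
  by (auto simp: K_def)

lemma K_mult:
  assumes x: "x \<in> K" and y: "y \<in> K"
  shows "x \<otimes>\<^bsub>P\<^esub> y \<in> K"
proof -
  have "(x \<otimes>\<^bsub>P\<^esub> y) i = \<one>\<^bsub>Hs ! i\<^esub> \<or> (x \<otimes>\<^bsub>P\<^esub> y) i = c i" if i: "i < length Hs" for i
  proof -
    interpret modular_factor "Hs ! i" "a i" "b i" "c i" "u i" by (rule factor[OF i])
    have "x i = \<one>\<^bsub>Hs ! i\<^esub> \<or> x i = c i" "y i = \<one>\<^bsub>Hs ! i\<^esub> \<or> y i = c i" using x y i by (auto simp: K_def)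
    then show ?thesis unfolding P_mult[OF i] using cc c by auto
  qed
  then show ?thesis using x y by (auto simp: K_def)
qed

lemma K_square:
  assumes x: "x \<in> K"
  shows "x \<otimes>\<^bsub>P\<^esub> x = \<one>\<^bsub>P\<^esub>"
proof (rule P_ext)
  fix i assume i: "i < length Hs"
  interpret modular_factor "Hs ! i" "a i" "b i" "c i" "u i" by (rule factor[OF i])
  have "x i = \<one>\<^bsub>Hs ! i\<^esub> \<or> x i = c i" using x i by (auto simp: K_def)
  then show "(x \<otimes>\<^bsub>P\<^esub> x) i = \<one>\<^bsub>P\<^esub> i" unfolding P_mult[OF i] P_one[OF i] using cc by auto
qed (use x in \<open>auto simp: K_def\<close>)

lemma K_inv: "x \<in> K \<Longrightarrow> inv\<^bsub>P\<^esub> x = x"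
  using K_square K_P P.inv_equality by blast

lemma K_central:
  assumes x: "x \<in> K" and y: "y \<in> carrier P"
  shows "y \<otimes>\<^bsub>P\<^esub> x = x \<otimes>\<^bsub>P\<^esub> y"
proof (rule P_ext)
  fix i assume i: "i < length Hs"
  interpret modular_factor "Hs ! i" "a i" "b i" "c i" "u i" by (rule factor[OF i])
  have "x i = \<one>\<^bsub>Hs ! i\<^esub> \<or> x i = c i" using x i by (auto simp: K_def)
  then show "(y \<otimes>\<^bsub>P\<^esub> x) i = (x \<otimes>\<^bsub>P\<^esub> y) i"
    unfolding P_mult[OF i] using c_central P_closed[OF y i] by auto
qed (use x y in \<open>auto simp: K_def\<close>)

lemma emb_K: "i < length Hs \<Longrightarrow> emb i (c i) \<in> K"
  using emb_closed factor_closed(3) by (auto simp: K_def emb_apply)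

text \<open>A character that is trivial on \<open>N\<close> but not on \<open>c\<close>: the identification of the derived subgroups
  does not kill them.\<close>

definition sign :: "(nat \<Rightarrow> 'x) \<Rightarrow> int" where
  "sign x = (\<Prod>i<length Hs. if x i = \<one>\<^bsub>Hs ! i\<^esub> then 1 else -1)"

lemma sign_mult:
  assumes x: "x \<in> K" and y: "y \<in> K"
  shows "sign (x \<otimes>\<^bsub>P\<^esub> y) = sign x * sign y"
  unfolding sign_def prod.distrib[symmetric]
proof (rule prod.cong[OF HOL.refl])
  fix i assume "i \<in> {..<length Hs}"
  then have i: "i < length Hs" by simp
  interpret modular_factor "Hs ! i" "a i" "b i" "c i" "u i" by (rule factor[OF i])
  have "x i = \<one>\<^bsub>Hs ! i\<^esub> \<or> x i = c i" "y i = \<one>\<^bsub>Hs ! i\<^esub> \<or> y i = c i" using x y i by (auto simp: K_def)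
  then show "(if (x \<otimes>\<^bsub>P\<^esub> y) i = \<one>\<^bsub>Hs ! i\<^esub> then 1 else -1) =
      (if x i = \<one>\<^bsub>Hs ! i\<^esub> then 1 else -1) * (if y i = \<one>\<^bsub>Hs ! i\<^esub> then 1 else (-1::int))"
    unfolding P_mult[OF i] using cc c c_neq by auto
qed

lemma sign_emb:
  assumes i: "i < length Hs"
  shows "sign (emb i (c i)) = -1"
proof -
  have "sign (emb i (c i)) = (\<Prod>j<length Hs. if j = i then -1 else 1)"
    unfolding sign_def using modular_factor.c_neq[OF factor[OF i]] by (intro prod.cong) (auto simp: emb_apply)
  then show ?thesis using i by simp
qed

text \<open>Each identification is a product of two elements of sign -1.\<close>

lemma N_K: "x \<in> N \<Longrightarrow> x \<in> K \<and> sign x = 1"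
  unfolding N_def
proof (induction rule: generate.induct)
  case one
  have "\<one>\<^bsub>P\<^esub> \<in> K" by (auto simp: K_def P_one)
  moreover have "sign \<one>\<^bsub>P\<^esub> = 1" by (auto simp: sign_def P_one)
  ultimately show ?case by simp
next
  case (incl h)
  then obtain i j where h: "h = emb i (c i) \<otimes>\<^bsub>P\<^esub> inv\<^bsub>P\<^esub> (emb j (c j))" "i < length Hs" "j < length Hs"
    unfolding identifications_def by blast
  have "h = emb i (c i) \<otimes>\<^bsub>P\<^esub> emb j (c j)" using h K_inv emb_K by simp
  then show ?case using h K_mult emb_K sign_mult sign_emb by simp
next
  case (inv h)
  then obtain i j where h: "h = emb i (c i) \<otimes>\<^bsub>P\<^esub> inv\<^bsub>P\<^esub> (emb j (c j))" "i < length Hs" "j < length Hs"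
    unfolding identifications_def by blast
  have e: "h = emb i (c i) \<otimes>\<^bsub>P\<^esub> emb j (c j)" using h K_inv emb_K by simp
  then have "h \<in> K" using h K_mult emb_K by simp
  then show ?case using e h K_mult emb_K sign_mult sign_emb K_inv by simp
next
  case (eng h1 h2)
  then show ?case using K_mult sign_mult by simp
qed

lemma N_subgroup: "subgroup N P"
  unfolding N_def
proof (rule P.generate_is_subgroup)
  show "identifications \<subseteq> carrier P"
    unfolding identifications_def using emb_closed factor_closed(3) by auto
qed

lemma N_normal: "normal N P"
proof (rule P.normal_invI[OF N_subgroup])
  fix x h assume x: "x \<in> carrier P" and h: "h \<in> N"
  have hK: "h \<in> K" using N_K h by blast
  have "x \<otimes>\<^bsub>P\<^esub> h \<otimes>\<^bsub>P\<^esub> inv\<^bsub>P\<^esub> x = h \<otimes>\<^bsub>P\<^esub> x \<otimes>\<^bsub>P\<^esub> inv\<^bsub>P\<^esub> x" using K_central[OF hK x] by simp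
  also have "\<dots> = h" using x hK K_P by (simp add: P.m_assoc subset_iff)
  finally show "x \<otimes>\<^bsub>P\<^esub> h \<otimes>\<^bsub>P\<^esub> inv\<^bsub>P\<^esub> x \<in> N" using h by simp
qed

sublocale N: normal N P
  by (rule N_normal)

end

text \<open>G is described as the direct product of \<alpha>(P) and the cyclic group of d: N is the
  kernel of \<alpha>, M the order of d, and \<tau> the coordinate in \<int>/M. As d has finite
  order, natural exponents s reach all of its powers.\<close>

locale central_product_group = central_product_factors Hs a b c u + group G
  for Hs :: "'x monoid list" and a b c u and G :: "'g monoid" (structure) +
  fixes \<alpha> :: "(nat \<Rightarrow> 'x) \<Rightarrow> 'g" and d :: 'g and M :: nat and \<tau> :: "'g \<Rightarrow> int"
  assumes \<alpha>_hom: "\<alpha> \<in> hom P G" and d: "d \<in> carrier G" "d [^] M = \<one>" "1 < M"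
    and d_central: "\<And>g. g \<in> carrier G \<Longrightarrow> g \<otimes> d = d \<otimes> g"
    and decompose: "\<And>g. g \<in> carrier G \<Longrightarrow> \<exists>p\<in>carrier P. \<exists>s::nat. g = \<alpha> p \<otimes> d [^] s"
    and \<alpha>_one_iff: "\<And>p s. p \<in> carrier P \<Longrightarrow> \<alpha> p \<otimes> d [^] (s::nat) = \<one> \<longleftrightarrow> p \<in> N \<and> M dvd s"
    and \<tau>_mult: "\<And>g h. g \<in> carrier G \<Longrightarrow> h \<in> carrier G \<Longrightarrow> \<tau> (g \<otimes> h) = (\<tau> g + \<tau> h) mod int M"
    and \<tau>_d: "\<tau> d = 1" and \<tau>_\<alpha>: "\<And>p. p \<in> carrier P \<Longrightarrow> \<tau> (\<alpha> p) = 0"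

text \<open>Everything is transported along the isomorphism \<phi> with inverse \<psi>: \<kappa>
  projects P onto its quotient by N, \<alpha> is \<kappa> followed by the embedding of the first
  factor, d corresponds to 1 in the cyclic factor, and \<tau> is the second coordinate.\<close>

lemma (in central_product_factors) exists_decomposition:
  fixes G :: "'g monoid"
  assumes G: "group G" and iso: "G \<cong> central_product Hs \<times>\<times> integer_mod_group M" and M: "1 < M"
  shows "\<exists>\<alpha> d \<tau>. central_product_group Hs a b c u G \<alpha> d M \<tau>"
proof -
  let ?Q = "central_product Hs" and ?Z = "integer_mod_group M"
  interpret G: group G by (rule G)
  have Q: "group ?Q" unfolding central_product_eq by (rule N.factorgroup_is_group)
  interpret Q: group ?Q by (rule Q)
  have QZ: "group (?Q \<times>\<times> ?Z)" by (rule DirProd_group[OF Q group_integer_mod_group])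
  interpret QZ: group "?Q \<times>\<times> ?Z" by (rule QZ)
  obtain \<phi> where \<phi>: "\<phi> \<in> iso G (?Q \<times>\<times> ?Z)" using iso unfolding is_iso_def by blast
  have \<phi>_hom: "\<phi> \<in> hom G (?Q \<times>\<times> ?Z)" and bij: "bij_betw \<phi> (carrier G) (carrier (?Q \<times>\<times> ?Z))"
    using \<phi> by (auto simp: iso_def)
  have \<phi>_mult: "\<phi> (g \<otimes>\<^bsub>G\<^esub> h) = \<phi> g \<otimes>\<^bsub>?Q \<times>\<times> ?Z\<^esub> \<phi> h" if "g \<in> carrier G" "h \<in> carrier G" for g h
    using \<phi>_hom that by (rule hom_mult)
  have inj: "g = h" if "\<phi> g = \<phi> h" "g \<in> carrier G" "h \<in> carrier G" for g h
    using bij that by (auto simp: bij_betw_def dest: inj_onD)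
  define \<psi> where "\<psi> = inv_into (carrier G) \<phi>"
  have \<psi>: "\<psi> y \<in> carrier G" "\<phi> (\<psi> y) = y" if "y \<in> carrier (?Q \<times>\<times> ?Z)" for y
    using that bij unfolding \<psi>_def bij_betw_def by (auto intro: inv_into_into f_inv_into_f)
  define \<kappa> where "\<kappa> p = N #>\<^bsub>P\<^esub> p" for p
  have \<kappa>_hom: "\<kappa> \<in> hom P ?Q" unfolding \<kappa>_def central_product_eq by (rule N.r_coset_hom_Mod)
  have \<kappa>_surj: "carrier ?Q = \<kappa> ` carrier P"
    unfolding central_product_eq FactGroup_def RCOSETS_def \<kappa>_def by auto
  have \<kappa>_one: "\<kappa> p = \<one>\<^bsub>?Q\<^esub> \<longleftrightarrow> p \<in> N" if "p \<in> carrier P" for p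
    unfolding central_product_eq \<kappa>_def one_FactGroup
    using that P.coset_join1[OF _ that N_subgroup] P.coset_join2[OF that N_subgroup] N.subset by blast
  have \<kappa>_closed: "\<kappa> p \<in> carrier ?Q" if "p \<in> carrier P" for p using that \<kappa>_surj by blast
  have Z: "0 \<in> carrier ?Z" "1 \<in> carrier ?Z" using M by (auto simp: carrier_integer_mod_group)
  define \<alpha> where "\<alpha> p = \<psi> (\<kappa> p, 0)" for p
  define d where "d = \<psi> (\<one>\<^bsub>?Q\<^esub>, 1)"
  have \<alpha>: "\<alpha> p \<in> carrier G" "\<phi> (\<alpha> p) = (\<kappa> p, 0)" if "p \<in> carrier P" for p
    using \<psi>[of "(\<kappa> p, 0)"] \<kappa>_closed[OF that] Z by (auto simp: \<alpha>_def)
  have d: "d \<in> carrier G" "\<phi> d = (\<one>\<^bsub>?Q\<^esub>, 1)"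
    using \<psi>[of "(\<one>\<^bsub>?Q\<^esub>, 1)"] Z by (auto simp: d_def)
  have d_pow: "\<phi> (d [^]\<^bsub>G\<^esub> s) = (\<one>\<^bsub>?Q\<^esub>, int s mod int M)" for s :: nat
  proof (induction s)
    case 0
    have "\<phi> \<one>\<^bsub>G\<^esub> = \<one>\<^bsub>?Q \<times>\<times> ?Z\<^esub>" by (rule hom_one[OF \<phi>_hom G QZ])
    then show ?case by simp
  next
    case (Suc s)
    then show ?case using d by (simp add: \<phi>_mult mod_simps add.commute)
  qed
  have \<alpha>d: "\<phi> (\<alpha> p \<otimes>\<^bsub>G\<^esub> d [^]\<^bsub>G\<^esub> s) = (\<kappa> p, int s mod int M)" if "p \<in> carrier P" for p and s :: nat
    using \<alpha>[OF that] d \<kappa>_closed[OF that] by (simp add: \<phi>_mult d_pow)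
  have one: "\<phi> \<one>\<^bsub>G\<^esub> = (\<one>\<^bsub>?Q\<^esub>, 0)" using hom_one[OF \<phi>_hom G QZ] by simp
  have "central_product_group Hs a b c u G \<alpha> d M (\<lambda>g. snd (\<phi> g))"
  proof
    show "\<alpha> \<in> hom P G"
    proof (rule homI)
      fix p q assume pq: "p \<in> carrier P" "q \<in> carrier P"
      have "\<phi> (\<alpha> (p \<otimes>\<^bsub>P\<^esub> q)) = \<phi> (\<alpha> p \<otimes>\<^bsub>G\<^esub> \<alpha> q)"
        using \<alpha> pq hom_mult[OF \<kappa>_hom pq] by (simp add: \<phi>_mult)
      then show "\<alpha> (p \<otimes>\<^bsub>P\<^esub> q) = \<alpha> p \<otimes>\<^bsub>G\<^esub> \<alpha> q" using inj \<alpha> pq by simp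
    qed (rule \<alpha>(1))
    show "d \<in> carrier G" by (rule d(1))
    show "d [^]\<^bsub>G\<^esub> M = \<one>\<^bsub>G\<^esub>" using inj[of "d [^]\<^bsub>G\<^esub> M" "\<one>\<^bsub>G\<^esub>"] d one by (simp add: d_pow)
    show "1 < M" by (rule M)
    show "g \<otimes>\<^bsub>G\<^esub> d = d \<otimes>\<^bsub>G\<^esub> g" if g: "g \<in> carrier G" for g
    proof -
      obtain q z where qz: "\<phi> g = (q, z)" by force
      have "(q, z) \<in> carrier (?Q \<times>\<times> ?Z)" using bij g qz by (metis bij_betwE)
      then have "\<phi> (g \<otimes>\<^bsub>G\<^esub> d) = \<phi> (d \<otimes>\<^bsub>G\<^esub> g)" using g d by (simp add: \<phi>_mult qz add.commute)
      then show ?thesis using inj g d by simp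
    qed
    show "\<exists>p\<in>carrier P. \<exists>s::nat. g = \<alpha> p \<otimes>\<^bsub>G\<^esub> d [^]\<^bsub>G\<^esub> s" if g: "g \<in> carrier G" for g
    proof -
      obtain q z where qz: "\<phi> g = (q, z)" by force
      have qz': "q \<in> carrier ?Q" "0 \<le> z" "z < int M"
        using bij_betwE[OF bij] g qz M by (auto simp: carrier_integer_mod_group)
      obtain p where p: "p \<in> carrier P" "q = \<kappa> p" using qz'(1) \<kappa>_surj by blast
      obtain s where s: "z = int s" using qz'(2) by (rule nonneg_int_cases)
      have "\<phi> g = \<phi> (\<alpha> p \<otimes>\<^bsub>G\<^esub> d [^]\<^bsub>G\<^esub> s)" using qz' by (simp add: qz \<alpha>d[OF p(1)] p(2) s)
      then show ?thesis using inj g \<alpha>(1)[OF p(1)] d(1) p(1) by (metis G.m_closed G.nat_pow_closed)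
    qed
    show "\<alpha> p \<otimes>\<^bsub>G\<^esub> d [^]\<^bsub>G\<^esub> s = \<one>\<^bsub>G\<^esub> \<longleftrightarrow> p \<in> N \<and> M dvd s" if p: "p \<in> carrier P" for p and s :: nat
    proof -
      have "\<alpha> p \<otimes>\<^bsub>G\<^esub> d [^]\<^bsub>G\<^esub> s = \<one>\<^bsub>G\<^esub> \<longleftrightarrow> \<phi> (\<alpha> p \<otimes>\<^bsub>G\<^esub> d [^]\<^bsub>G\<^esub> s) = \<phi> \<one>\<^bsub>G\<^esub>"
        using inj \<alpha>(1)[OF p] d(1) by (metis G.m_closed G.nat_pow_closed G.one_closed)
      also have "\<dots> \<longleftrightarrow> p \<in> N \<and> int s mod int M = 0" unfolding \<alpha>d[OF p] one using \<kappa>_one[OF p] by simp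
      also have "int s mod int M = 0 \<longleftrightarrow> M dvd s" by (metis int_dvd_int_iff mod_eq_0_iff_dvd)
      finally show ?thesis .
    qed
    show "snd (\<phi> (g \<otimes>\<^bsub>G\<^esub> h)) = (snd (\<phi> g) + snd (\<phi> h)) mod int M" if "g \<in> carrier G" "h \<in> carrier G" for g h
      using \<phi>_mult[OF that] by (simp add: mult_DirProd')
    show "snd (\<phi> d) = 1" using d by simp
    show "snd (\<phi> (\<alpha> p)) = 0" if "p \<in> carrier P" for p using \<alpha>[OF that] by simp
  qed
  then show ?thesis by blast
qed

section \<open>Commutators, squares, involutions and characters of G\<close>

context central_product_group
begin

text \<open>The common image of all the c i; it is not trivial because \<open>sign\<close> keeps
  \<open>emb 0 (c 0)\<close> out of N.\<close>

definition z :: 'g where "z = \<alpha> (emb 0 (c 0))"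
definition A :: 'g where "A = \<alpha> (emb 0 (a 0))"

lemma \<alpha>_closed: "p \<in> carrier P \<Longrightarrow> \<alpha> p \<in> carrier G"
  using \<alpha>_hom by (rule hom_in_carrier)

lemma \<alpha>_mult: "p \<in> carrier P \<Longrightarrow> q \<in> carrier P \<Longrightarrow> \<alpha> (p \<otimes>\<^bsub>P\<^esub> q) = \<alpha> p \<otimes> \<alpha> q"
  using \<alpha>_hom by (rule hom_mult)

lemma \<alpha>_one: "\<alpha> \<one>\<^bsub>P\<^esub> = \<one>"
  using \<alpha>_hom P.is_group is_group by (rule hom_one)

lemma \<alpha>_eq_one_iff: "p \<in> carrier P \<Longrightarrow> \<alpha> p = \<one> \<longleftrightarrow> p \<in> N"
  using \<alpha>_one_iff[of p 0] \<alpha>_closed[of p] by simp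

lemma dpow_closed: "d [^] (s::nat) \<in> carrier G"
  using d by simp

lemma dpow_central: "g \<in> carrier G \<Longrightarrow> g \<otimes> d [^] (s::nat) = d [^] s \<otimes> g"
proof (induction s)
  case (Suc s)
  have "g \<otimes> (d [^] s \<otimes> d) = d [^] s \<otimes> (g \<otimes> d)" using Suc d(1) by (simp add: m_assoc[symmetric])
  also have "\<dots> = d [^] s \<otimes> (d \<otimes> g)" by (simp only: d_central[OF Suc.prems])
  also have "\<dots> = d [^] s \<otimes> d \<otimes> g" using Suc.prems d(1) by (simp add: m_assoc)
  finally show ?case by simp
qed simp

lemma emb_mult:
  assumes "i < length Hs" "x \<in> carrier (Hs ! i)" "y \<in> carrier (Hs ! i)"
  shows "emb i (x \<otimes>\<^bsub>Hs ! i\<^esub> y) = emb i x \<otimes>\<^bsub>P\<^esub> emb i y"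
proof (rule P_ext)
  interpret Hi: group "Hs ! i" using assms(1) by (rule factor_group)
  show "emb i (x \<otimes>\<^bsub>Hs ! i\<^esub> y) \<in> carrier P" "emb i x \<otimes>\<^bsub>P\<^esub> emb i y \<in> carrier P"
    using assms emb_closed by auto
  fix j assume j: "j < length Hs"
  interpret j: group "Hs ! j" using j by (rule factor_group)
  show "emb i (x \<otimes>\<^bsub>Hs ! i\<^esub> y) j = (emb i x \<otimes>\<^bsub>P\<^esub> emb i y) j"
    using j by (simp add: P_mult emb_apply)
qed

lemma emb_one: "i < length Hs \<Longrightarrow> emb i \<one>\<^bsub>Hs ! i\<^esub> = \<one>\<^bsub>P\<^esub>"
  using factor_closed(4) emb_closed by (intro P_ext) (auto simp: emb_apply P_one)

lemma \<alpha>_emb_pow: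
  assumes i: "i < length Hs" and x: "x \<in> carrier (Hs ! i)"
  shows "\<alpha> (emb i (x [^]\<^bsub>Hs ! i\<^esub> (k::nat))) = \<alpha> (emb i x) [^] k"
proof (induction k)
  case 0
  then show ?case using i by (simp add: emb_one \<alpha>_one)
next
  case (Suc k)
  interpret Hi: group "Hs ! i" using i by (rule factor_group)
  show ?case using Suc i x emb_closed by (simp add: emb_mult \<alpha>_mult)
qed

lemma A: "A \<in> carrier G"
  unfolding A_def using nonempty emb_closed factor_closed \<alpha>_closed by simp

lemma z: "z \<in> carrier G" "z \<otimes> z = \<one>" "z \<noteq> \<one>"
proof -
  have e: "emb 0 (c 0) \<in> K" using emb_K nonempty by simp
  then have eP: "emb 0 (c 0) \<in> carrier P" using K_P by blast
  show "z \<in> carrier G" unfolding z_def using eP by (rule \<alpha>_closed)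
  show "z \<otimes> z = \<one>" unfolding z_def \<alpha>_mult[OF eP eP, symmetric] K_square[OF e] by (rule \<alpha>_one)
  show "z \<noteq> \<one>"
    unfolding z_def \<alpha>_eq_one_iff[OF eP] using N_K[of "emb 0 (c 0)"] sign_emb[OF nonempty] by auto
qed

lemma \<alpha>_emb_c: "i < length Hs \<Longrightarrow> \<alpha> (emb i (c i)) = z"
proof -
  assume i: "i < length Hs"
  have e: "emb i (c i) \<in> carrier P" "emb 0 (c 0) \<in> carrier P" using i nonempty emb_closed factor_closed(3) by auto
  have "emb i (c i) \<otimes>\<^bsub>P\<^esub> inv\<^bsub>P\<^esub> (emb 0 (c 0)) \<in> N"
    unfolding N_def identifications_def using i nonempty by (intro generate.incl) blast
  then have "emb i (c i) \<otimes>\<^bsub>P\<^esub> emb 0 (c 0) \<in> N" using K_inv[OF emb_K[OF nonempty]] by simp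
  then have "\<alpha> (emb i (c i)) \<otimes> z = \<one>"
    unfolding z_def using e by (simp add: \<alpha>_mult[symmetric] \<alpha>_eq_one_iff)
  then have "\<alpha> (emb i (c i)) = inv z" using \<alpha>_closed[OF e(1)] z(1) by (simp add: inv_equality)
  then show ?thesis using z by (simp add: inv_equality)
qed

text \<open>An element of K is the product of its coordinates, each of which \<alpha> sends to 1 or
  z; coordinates are split off one at a time.\<close>

lemma \<alpha>_K:
  assumes "x \<in> K"
  shows "\<alpha> x = \<one> \<or> \<alpha> x = z"
proof -
  have "\<alpha> x = \<one> \<or> \<alpha> x = z"
    if "finite J" "J \<subseteq> {..<length Hs}" "x \<in> K" "\<And>i. i < length Hs \<Longrightarrow> i \<notin> J \<Longrightarrow> x i = \<one>\<^bsub>Hs ! i\<^esub>" for J x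
    using that
  proof (induction J arbitrary: x rule: finite_induct)
    case empty
    then have "x = \<one>\<^bsub>P\<^esub>" using K_P by (intro P_ext) (auto simp: P_one)
    then show ?case by (simp add: \<alpha>_one)
  next
    case (insert j J)
    then have j: "j < length Hs" by simp
    define y where "y = (\<lambda>i\<in>{..<length Hs}. if i = j then \<one>\<^bsub>Hs ! i\<^esub> else x i)"
    have xP: "x \<in> carrier P" using insert.prems(2) K_P by blast
    have yP: "y \<in> carrier P"
      using P_closed[OF xP] factor_closed(4) by (auto simp: y_def P_def)
    have yK: "y \<in> K" using insert.prems(2) yP by (auto simp: K_def y_def)
    have e: "emb j (x j) \<in> carrier P" using emb_closed[OF j P_closed[OF xP j]] .
    have "x = emb j (x j) \<otimes>\<^bsub>P\<^esub> y"
    proof (rule P_ext)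
      fix i assume i: "i < length Hs"
      interpret Hi: group "Hs ! i" using i by (rule factor_group)
      interpret Hj: group "Hs ! j" using j by (rule factor_group)
      show "x i = (emb j (x j) \<otimes>\<^bsub>P\<^esub> y) i" using i P_closed[OF xP i] by (cases "i = j") (simp_all add: P_mult emb_apply y_def)
    qed (use xP yP e in auto)
    then have "\<alpha> x = \<alpha> (emb j (x j)) \<otimes> \<alpha> y" using \<alpha>_mult[OF e yP] by simp
    moreover have "\<alpha> y = \<one> \<or> \<alpha> y = z"
    proof (rule insert.IH[OF _ yK])
      show "J \<subseteq> {..<length Hs}" using insert.prems(1) by simp
      show "y i = \<one>\<^bsub>Hs ! i\<^esub>" if "i < length Hs" "i \<notin> J" for i
        using that insert.prems(3) by (simp add: y_def)
    qed
    moreover have "x j = \<one>\<^bsub>Hs ! j\<^esub> \<or> x j = c j" using insert.prems(2) j by (auto simp: K_def)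
    then have "\<alpha> (emb j (x j)) = \<one> \<or> \<alpha> (emb j (x j)) = z"
      using emb_one[OF j] \<alpha>_one \<alpha>_emb_c[OF j] by auto
    ultimately show ?case using z by auto
  qed
  from this[of "{..<length Hs}" x] show ?thesis using assms by simp
qed

lemma z_central:
  assumes g: "g \<in> carrier G"
  shows "g \<otimes> z = z \<otimes> g"
proof -
  obtain p s where p: "p \<in> carrier P" "g = \<alpha> p \<otimes> d [^] (s::nat)" using decompose[OF g] by blast
  have e: "emb 0 (c 0) \<in> K" using emb_K nonempty by simp
  have eP: "emb 0 (c 0) \<in> carrier P" using e K_P by blast
  have pz: "\<alpha> p \<otimes> z = z \<otimes> \<alpha> p"
    unfolding z_def using K_central[OF e p(1)] \<alpha>_mult[OF p(1) eP] \<alpha>_mult[OF eP p(1)] by simp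
  have "g \<otimes> z = \<alpha> p \<otimes> (d [^] s \<otimes> z)" unfolding p(2) using \<alpha>_closed[OF p(1)] z(1) dpow_closed by (simp add: m_assoc)
  also have "\<dots> = \<alpha> p \<otimes> z \<otimes> d [^] s" using dpow_central[OF z(1)] \<alpha>_closed[OF p(1)] z(1) dpow_closed by (simp add: m_assoc)
  also have "\<dots> = z \<otimes> g" unfolding pz p(2) using \<alpha>_closed[OF p(1)] z(1) dpow_closed by (simp add: m_assoc)
  finally show ?thesis .
qed

lemma product_decomposed:
  assumes p: "p \<in> carrier P" and q: "q \<in> carrier P"
  shows "\<alpha> p \<otimes> d [^] (s::nat) \<otimes> (\<alpha> q \<otimes> d [^] (t::nat)) = \<alpha> (p \<otimes>\<^bsub>P\<^esub> q) \<otimes> d [^] (s + t)"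
proof -
  have "\<alpha> p \<otimes> d [^] s \<otimes> (\<alpha> q \<otimes> d [^] t) = \<alpha> p \<otimes> (d [^] s \<otimes> \<alpha> q) \<otimes> d [^] t"
    using \<alpha>_closed p q dpow_closed by (simp add: m_assoc)
  also have "\<dots> = \<alpha> p \<otimes> (\<alpha> q \<otimes> d [^] s) \<otimes> d [^] t" using dpow_central[OF \<alpha>_closed[OF q]] by simp
  also have "\<dots> = \<alpha> p \<otimes> \<alpha> q \<otimes> (d [^] s \<otimes> d [^] t)" using \<alpha>_closed p q dpow_closed by (simp add: m_assoc)
  finally show ?thesis using d(1) \<alpha>_mult[OF p q] by (simp add: nat_pow_mult)
qed

text \<open>The powers of d are central, and the commutator of the P-parts lies in K coordinate by
  coordinate, so \<alpha> sends it to 1 or z.\<close>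

lemma commutators_G:
  assumes g: "g \<in> carrier G" and h: "h \<in> carrier G"
  shows "g \<otimes> h = h \<otimes> g \<or> g \<otimes> h = z \<otimes> (h \<otimes> g)"
proof -
  obtain p s where p: "p \<in> carrier P" "g = \<alpha> p \<otimes> d [^] (s::nat)" using decompose[OF g] by blast
  obtain q t where q: "q \<in> carrier P" "h = \<alpha> q \<otimes> d [^] (t::nat)" using decompose[OF h] by blast
  define w where "w = p \<otimes>\<^bsub>P\<^esub> q \<otimes>\<^bsub>P\<^esub> inv\<^bsub>P\<^esub> (q \<otimes>\<^bsub>P\<^esub> p)"
  have wP: "w \<in> carrier P" using p q by (simp add: w_def)
  have "w i = \<one>\<^bsub>Hs ! i\<^esub> \<or> w i = c i" if i: "i < length Hs" for i
  proof -
    interpret Hi: modular_factor "Hs ! i" "a i" "b i" "c i" "u i" by (rule factor[OF i])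
    have pi: "p i \<in> carrier (Hs ! i)" and qi: "q i \<in> carrier (Hs ! i)" using p q P_closed i by auto
    have w: "w i = p i \<otimes>\<^bsub>Hs ! i\<^esub> q i \<otimes>\<^bsub>Hs ! i\<^esub> inv\<^bsub>Hs ! i\<^esub> (q i \<otimes>\<^bsub>Hs ! i\<^esub> p i)"
      using p q i by (simp only: w_def P_mult P_inv P.m_closed)
    from Hi.commutators[OF pi qi] show ?thesis
    proof
      assume "p i \<otimes>\<^bsub>Hs ! i\<^esub> q i = q i \<otimes>\<^bsub>Hs ! i\<^esub> p i"
      then show ?thesis unfolding w using pi qi by (simp del: Hi.inv_mult_group)
    next
      assume e: "p i \<otimes>\<^bsub>Hs ! i\<^esub> q i = c i \<otimes>\<^bsub>Hs ! i\<^esub> (q i \<otimes>\<^bsub>Hs ! i\<^esub> p i)"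
      have "w i = c i \<otimes>\<^bsub>Hs ! i\<^esub> ((q i \<otimes>\<^bsub>Hs ! i\<^esub> p i) \<otimes>\<^bsub>Hs ! i\<^esub> inv\<^bsub>Hs ! i\<^esub> (q i \<otimes>\<^bsub>Hs ! i\<^esub> p i))"
        unfolding w e using pi qi Hi.c by (simp only: Hi.m_assoc Hi.m_closed Hi.inv_closed)
      also have "\<dots> = c i" using pi qi Hi.c by (simp only: Hi.r_inv Hi.m_closed Hi.r_one)
      finally show ?thesis by simp
    qed
  qed
  then have "w \<in> K" using wP by (simp add: K_def)
  then have "\<alpha> w = \<one> \<or> \<alpha> w = z" by (rule \<alpha>_K)
  moreover have "p \<otimes>\<^bsub>P\<^esub> q = w \<otimes>\<^bsub>P\<^esub> (q \<otimes>\<^bsub>P\<^esub> p)"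
    using p q by (simp add: w_def P.m_assoc)
  then have "g \<otimes> h = \<alpha> w \<otimes> \<alpha> (q \<otimes>\<^bsub>P\<^esub> p) \<otimes> d [^] (s + t)"
    unfolding p(2) q(2) product_decomposed[OF p(1) q(1)] using wP p q by (simp add: \<alpha>_mult)
  moreover have "h \<otimes> g = \<alpha> (q \<otimes>\<^bsub>P\<^esub> p) \<otimes> d [^] (s + t)"
    unfolding p(2) q(2) product_decomposed[OF q(1) p(1)] by (simp add: add.commute)
  moreover have "\<alpha> (q \<otimes>\<^bsub>P\<^esub> p) \<in> carrier G" using \<alpha>_closed p q by simp
  ultimately show ?thesis using z(1) dpow_closed by (auto simp: m_assoc)
qed

lemma A_pow: "A [^] (k::nat) = \<alpha> (emb 0 (a 0 [^]\<^bsub>Hs ! 0\<^esub> k))"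
  unfolding A_def using \<alpha>_emb_pow[OF nonempty factor_closed(1)[OF nonempty]] by simp

lemma A_pow_half: "A [^] ((2::nat) ^ (u 0 - 1)) = z"
  unfolding A_pow z_def modular_factor.c_eq[OF factor[OF nonempty]] by simp

lemma A_pow_full: "A [^] ((2::nat) ^ u 0) = \<one>"
  unfolding A_pow modular_factor.a_pow[OF factor[OF nonempty]] emb_one[OF nonempty] by (rule \<alpha>_one)

lemma u0: "2 \<le> u 0"
  by (rule modular_factor.u[OF factor[OF nonempty]])

text \<open>In the factors with u = 2 all squares are 1 or c. Hence p p differs from the embedded
  power of a 0 only by an element of K, that is, by 1 or z in G.\<close>

lemma square_G:
  assumes u: "\<And>i. 0 < i \<Longrightarrow> i < length Hs \<Longrightarrow> u i = 2" and g: "g \<in> carrier G"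
  shows "\<exists>(i::nat) (s::nat). g \<otimes> g = A [^] (2 * i) \<otimes> d [^] (2 * s) \<or> g \<otimes> g = z \<otimes> (A [^] (2 * i) \<otimes> d [^] (2 * s))"
proof -
  obtain p s where p: "p \<in> carrier P" "g = \<alpha> p \<otimes> d [^] (s::nat)" using decompose[OF g] by blast
  interpret H0: modular_factor "Hs ! 0" "a 0" "b 0" "c 0" "u 0" by (rule factor[OF nonempty])
  have p0: "p 0 \<in> carrier (Hs ! 0)" by (rule P_closed[OF p(1) nonempty])
  obtain i :: nat where i: "p 0 \<otimes>\<^bsub>Hs ! 0\<^esub> p 0 = a 0 [^]\<^bsub>Hs ! 0\<^esub> (2 * i) \<or>
      p 0 \<otimes>\<^bsub>Hs ! 0\<^esub> p 0 = c 0 \<otimes>\<^bsub>Hs ! 0\<^esub> a 0 [^]\<^bsub>Hs ! 0\<^esub> (2 * i)" using H0.square_cases[OF p0] by (elim exE)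
  let ?x = "a 0 [^]\<^bsub>Hs ! 0\<^esub> (2 * i)"
  have x: "?x \<in> carrier (Hs ! 0)" using H0.a by simp
  let ?e = "emb 0 ?x"
  have e: "?e \<in> carrier P" by (rule emb_closed[OF nonempty x])
  define w where "w = p \<otimes>\<^bsub>P\<^esub> p \<otimes>\<^bsub>P\<^esub> inv\<^bsub>P\<^esub> ?e"
  have wP: "w \<in> carrier P" using p e by (simp add: w_def)
  have "w j = \<one>\<^bsub>Hs ! j\<^esub> \<or> w j = c j" if j: "j < length Hs" for j
  proof (cases "j = 0")
    case True
    have "w 0 = p 0 \<otimes>\<^bsub>Hs ! 0\<^esub> p 0 \<otimes>\<^bsub>Hs ! 0\<^esub> inv\<^bsub>Hs ! 0\<^esub> ?x"
      using p e nonempty by (simp only: w_def P_mult P_inv P.m_closed emb_apply if_True HOL.simp_thms)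
    moreover have "c 0 \<otimes>\<^bsub>Hs ! 0\<^esub> ?x \<otimes>\<^bsub>Hs ! 0\<^esub> inv\<^bsub>Hs ! 0\<^esub> ?x = c 0" using x H0.c by (simp only: H0.m_assoc H0.inv_closed H0.r_inv H0.r_one)
    ultimately show ?thesis using i x True by auto
  next
    case False
    interpret Hj: modular_factor "Hs ! j" "a j" "b j" "c j" "u j" by (rule factor[OF j])
    have "w j = p j \<otimes>\<^bsub>Hs ! j\<^esub> p j \<otimes>\<^bsub>Hs ! j\<^esub> inv\<^bsub>Hs ! j\<^esub> \<one>\<^bsub>Hs ! j\<^esub>"
      using p e j False by (simp only: w_def P_mult P_inv P.m_closed emb_apply if_False)
    then show ?thesis using Hj.square_cases_order_8[OF u P_closed[OF p(1) j]] False j P_closed[OF p(1) j] by auto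
  qed
  then have "w \<in> K" using wP by (simp add: K_def)
  then have w: "\<alpha> w = \<one> \<or> \<alpha> w = z" by (rule \<alpha>_K)
  have "p \<otimes>\<^bsub>P\<^esub> p = w \<otimes>\<^bsub>P\<^esub> ?e" using p e by (simp add: w_def P.m_assoc)
  then have "g \<otimes> g = \<alpha> w \<otimes> \<alpha> ?e \<otimes> d [^] (s + s)"
    unfolding p(2) product_decomposed[OF p(1) p(1)] using wP e by (simp add: \<alpha>_mult)
  then have "g \<otimes> g = \<alpha> w \<otimes> (A [^] (2 * i) \<otimes> d [^] (2 * s))"
    unfolding A_pow using \<alpha>_closed wP e dpow_closed by (simp add: m_assoc mult_2)
  then show ?thesis using w A dpow_closed by (intro exI[of _ i] exI[of _ s]) auto
qed

lemma A_dpow_pow: "(A [^] (i::nat) \<otimes> d [^] (s::nat)) [^] (k::nat) = A [^] (i * k) \<otimes> d [^] (s * k)"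
proof -
  have Ai: "A [^] i \<in> carrier G" using A by simp
  show ?thesis using pow_mult_distrib[OF dpow_central[OF Ai, of s] Ai dpow_closed, of k] A d(1) by (simp add: nat_pow_pow)
qed

lemma exponent_G:
  assumes u: "\<And>i. 0 < i \<Longrightarrow> i < length Hs \<Longrightarrow> u i = 2" and g: "g \<in> carrier G" and M: "M = 2 ^ e"
  shows "g [^] ((2::nat) ^ (1 + (u 0 + e))) = \<one>"
proof -
  let ?r = "(2::nat) ^ (u 0 + e)"
  obtain i s :: nat where gg: "g \<otimes> g = A [^] (2 * i) \<otimes> d [^] (2 * s) \<or> g \<otimes> g = z \<otimes> (A [^] (2 * i) \<otimes> d [^] (2 * s))"
    using square_G[OF u g] by blast
  let ?w = "A [^] (2 * i) \<otimes> d [^] (2 * s)"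
  have w: "?w \<in> carrier G" using A dpow_closed by simp
  have "?w [^] ?r = \<one>"
  proof -
    have 1: "2 * i * ?r = 2 ^ u 0 * (2 * i * 2 ^ e)" "2 * s * ?r = M * (2 * s * 2 ^ u 0)"
      by (simp_all add: power_add M)
    have "A [^] (2 * i * ?r) = \<one>" unfolding 1 using A by (simp only: nat_pow_pow[symmetric] A_pow_full nat_pow_one)
    moreover have "d [^] (2 * s * ?r) = \<one>" unfolding 1 using d by (simp only: nat_pow_pow[symmetric] nat_pow_one)
    ultimately show ?thesis by (simp add: A_dpow_pow)
  qed
  moreover have "z [^] ?r = \<one>"
  proof -
    have e: "?r = 2 * 2 ^ (u 0 + e - 1)" using u0 by (cases "u 0 + e") auto
    have "z [^] (2::nat) = \<one>" using z by (simp add: numeral_2_eq_2)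
    then show ?thesis unfolding e using z(1) by (simp only: nat_pow_pow[symmetric] nat_pow_one)
  qed
  ultimately have "(g \<otimes> g) [^] ?r = \<one>"
    using gg pow_mult_distrib[OF z_central[OF w, symmetric] z(1) w, of ?r] by auto
  moreover have "g [^] (2::nat) = g \<otimes> g" using g by (simp add: numeral_2_eq_2)
  ultimately have "(g [^] (2::nat)) [^] ?r = \<one>" by simp
  then have "g [^] (2 * ?r) = \<one>" using g by (simp only: nat_pow_pow)
  then show ?thesis by simp
qed

lemma fourth_power_A_dpow:
  defines "h i s \<equiv> A [^] (i::nat) \<otimes> d [^] (s::nat)"
  shows "h i s \<otimes> h i s \<otimes> (h i s \<otimes> h i s) = A [^] (4 * i) \<otimes> d [^] (4 * s)"
proof -
  have h: "h i s \<in> carrier G" using A dpow_closed by (simp add: h_def)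
  have "h i s \<otimes> h i s \<otimes> (h i s \<otimes> h i s) = h i s [^] (4::nat)" using h by (simp add: numeral_eq_Suc m_assoc)
  then show ?thesis by (simp add: h_def A_dpow_pow mult.commute)
qed

lemma A_dpow_mult: "A [^] (i::nat) \<otimes> d [^] (s::nat) \<otimes> (A [^] (j::nat) \<otimes> d [^] (t::nat)) = A [^] (i + j) \<otimes> d [^] (s + t)"
proof -
  have Aj: "A [^] j \<in> carrier G" "A [^] i \<in> carrier G" using A by simp_all
  have "A [^] i \<otimes> d [^] s \<otimes> (A [^] j \<otimes> d [^] t) = A [^] i \<otimes> (d [^] s \<otimes> A [^] j) \<otimes> d [^] t"
    using Aj dpow_closed by (simp add: m_assoc)
  also have "\<dots> = A [^] i \<otimes> (A [^] j \<otimes> d [^] s) \<otimes> d [^] t" using dpow_central[OF Aj(1)] by simp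
  also have "\<dots> = A [^] i \<otimes> A [^] j \<otimes> (d [^] s \<otimes> d [^] t)" using Aj dpow_closed by (simp add: m_assoc)
  finally show ?thesis using A d(1) by (simp add: nat_pow_mult)
qed

text \<open>Division of i and s by 2: the quotients form a fourth power, the remainders one of four
  representatives.\<close>

lemma square_cover:
  assumes u: "\<And>i. 0 < i \<Longrightarrow> i < length Hs \<Longrightarrow> u i = 2" and g: "g \<in> carrier G"
  shows "\<exists>r\<in>(\<lambda>(i, s). A [^] (2 * i) \<otimes> d [^] (2 * s)) ` ({0, 1::nat} \<times> {0, 1::nat}). \<exists>h\<in>carrier G.
    g \<otimes> g = r \<otimes> (h \<otimes> h \<otimes> (h \<otimes> h)) \<or> g \<otimes> g = z \<otimes> (r \<otimes> (h \<otimes> h \<otimes> (h \<otimes> h)))"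
proof -
  obtain i s :: nat where gg: "g \<otimes> g = A [^] (2 * i) \<otimes> d [^] (2 * s) \<or> g \<otimes> g = z \<otimes> (A [^] (2 * i) \<otimes> d [^] (2 * s))"
    using square_G[OF u g] by blast
  let ?h = "A [^] (i div 2) \<otimes> d [^] (s div 2)"
  let ?r = "A [^] (2 * (i mod 2)) \<otimes> d [^] (2 * (s mod 2))"
  have i: "2 * (i mod 2) + 4 * (i div 2) = 2 * i" "2 * (s mod 2) + 4 * (s div 2) = 2 * s" by presburger+
  have "?r \<otimes> (?h \<otimes> ?h \<otimes> (?h \<otimes> ?h)) = A [^] (2 * i) \<otimes> d [^] (2 * s)"
    unfolding fourth_power_A_dpow unfolding A_dpow_mult i ..
  moreover have "?h \<in> carrier G" using A dpow_closed by simp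
  moreover have "?r \<in> (\<lambda>(i, s). A [^] (2 * i) \<otimes> d [^] (2 * s)) ` ({0, 1::nat} \<times> {0, 1::nat})"
    by (rule image_eqI[of _ _ "(i mod 2, s mod 2)"]) auto
  ultimately show ?thesis using gg by metis
qed

text \<open>Now A A = z, so the A-part of a square is absorbed by the factor z and only the parity
  of the exponent of d remains.\<close>

lemma square_cover_order_8:
  assumes u: "\<And>i. i < length Hs \<Longrightarrow> u i = 2" and g: "g \<in> carrier G"
  shows "\<exists>r\<in>(\<lambda>s. d [^] (2 * s)) ` {0, 1::nat}. \<exists>h\<in>carrier G.
    g \<otimes> g = r \<otimes> (h \<otimes> h \<otimes> (h \<otimes> h)) \<or> g \<otimes> g = z \<otimes> (r \<otimes> (h \<otimes> h \<otimes> (h \<otimes> h)))"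
proof -
  obtain i s :: nat where gg: "g \<otimes> g = A [^] (2 * i) \<otimes> d [^] (2 * s) \<or> g \<otimes> g = z \<otimes> (A [^] (2 * i) \<otimes> d [^] (2 * s))"
    using square_G[OF u g] by blast
  have "A [^] (2::nat) = z" using A_pow_half u[OF nonempty] by simp
  then have Ai: "A [^] (2 * i) = z [^] i" using A by (metis nat_pow_pow)
  have "z [^] i = \<one> \<or> z [^] i = z"
    by (induction i) (use z in auto)
  then have gg': "g \<otimes> g = d [^] (2 * s) \<or> g \<otimes> g = z \<otimes> d [^] (2 * s)"
    using gg dpow_closed z by (auto simp: Ai m_assoc[symmetric])
  let ?h = "A [^] (0::nat) \<otimes> d [^] (s div 2)"
  let ?r = "d [^] (2 * (s mod 2))"
  have s: "2 * (s mod 2) + 4 * (s div 2) = 2 * s" by presburger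
  have "?r \<otimes> (?h \<otimes> ?h \<otimes> (?h \<otimes> ?h)) = d [^] (2 * s)"
    unfolding fourth_power_A_dpow using d(1) by (simp add: nat_pow_mult s)
  moreover have "?h \<in> carrier G" using A dpow_closed by simp
  moreover have "?r \<in> (\<lambda>s. d [^] (2 * s)) ` {0, 1::nat}"
    by (rule image_eqI[of _ _ "s mod 2"]) auto
  ultimately show ?thesis using gg' by metis
qed

lemma fourth_root_z:
  assumes "3 \<le> u 0"
  shows "\<exists>t\<in>carrier G. t \<otimes> t \<otimes> (t \<otimes> t) = z"
proof -
  let ?t = "A [^] ((2::nat) ^ (u 0 - 3))"
  have t: "?t \<in> carrier G" using A by simp
  have "?t \<otimes> ?t \<otimes> (?t \<otimes> ?t) = ?t [^] (4::nat)" using t by (simp add: numeral_eq_Suc m_assoc)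
  also have "\<dots> = A [^] ((2::nat) ^ (u 0 - 3) * 4)" using A by (simp only: nat_pow_pow)
  also have "(2::nat) ^ (u 0 - 3) * 4 = 2 ^ (u 0 - 3 + 2)" by (simp add: power_add)
  also have "u 0 - 3 + 2 = u 0 - 1" using assms by simp
  finally show ?thesis using t A_pow_half by metis
qed

text \<open>If y is an involution in G with g y = z y g, then the square of g y is z g g = z z =
  1.\<close>

lemma involution_of_noncommuting:
  assumes p: "p \<in> carrier P" and y: "y \<in> carrier P" and i: "i < length Hs"
    and py: "p \<otimes>\<^bsub>P\<^esub> y = emb i (c i) \<otimes>\<^bsub>P\<^esub> (y \<otimes>\<^bsub>P\<^esub> p)" and yy: "\<alpha> (y \<otimes>\<^bsub>P\<^esub> y) = \<one>"
    and g: "g = \<alpha> p \<otimes> d [^] (s::nat)" "g \<otimes> g = z"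
  shows "\<exists>y\<in>carrier G. y \<otimes> y = \<one> \<and> g \<otimes> y \<otimes> (g \<otimes> y) = \<one>"
proof -
  let ?y = "\<alpha> y"
  have Y: "?y \<in> carrier G" "?y \<otimes> ?y = \<one>" using \<alpha>_closed[OF y] yy \<alpha>_mult[OF y y] by auto
  have gG: "g \<in> carrier G" using g \<alpha>_closed[OF p] dpow_closed by simp
  have e: "emb i (c i) \<in> carrier P" using emb_closed factor_closed(3) i by simp
  have "\<alpha> p \<otimes> ?y = z \<otimes> (?y \<otimes> \<alpha> p)"
    using arg_cong[OF py, of \<alpha>] \<alpha>_mult p y e \<alpha>_emb_c[OF i] by simp
  moreover have "g \<otimes> ?y = \<alpha> p \<otimes> ?y \<otimes> d [^] s"
    unfolding g(1) using dpow_central[OF Y(1), of s] \<alpha>_closed[OF p] Y(1) dpow_closed by (simp add: m_assoc)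
  ultimately have gy: "g \<otimes> ?y = z \<otimes> (?y \<otimes> g)"
    unfolding g(1) using \<alpha>_closed[OF p] Y(1) dpow_closed z(1) by (simp add: m_assoc)
  have "g \<otimes> ?y \<otimes> (g \<otimes> ?y) = z \<otimes> (?y \<otimes> g) \<otimes> (g \<otimes> ?y)" by (simp only: gy)
  also have "\<dots> = z \<otimes> (?y \<otimes> (g \<otimes> g) \<otimes> ?y)" using gG Y(1) z(1) by (simp add: m_assoc)
  also have "\<dots> = z \<otimes> (z \<otimes> (?y \<otimes> ?y))" using z_central[OF Y(1)] Y(1) z(1) by (simp add: g(2) m_assoc)
  finally have "g \<otimes> ?y \<otimes> (g \<otimes> ?y) = \<one>" using Y z by simp
  then show ?thesis using Y by blast
qed

text \<open>An involution not commuting with g is built in a coordinate where p is not central. If b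
  i is an involution, b i or a i b i will do. A quaternion coordinate has no noncentral involution;
  there an element w of square c i is combined with a 0, of square c 0, provided p 0 is central, and
  otherwise the first coordinate serves. If p is central everywhere, g g is a power of d and cannot
  be z.\<close>

lemma exists_noncommuting_involution:
  assumes u: "\<And>i. i < length Hs \<Longrightarrow> u i = 2" and b0: "b 0 \<otimes>\<^bsub>Hs ! 0\<^esub> b 0 = \<one>\<^bsub>Hs ! 0\<^esub>"
    and g: "g \<in> carrier G" "g \<otimes> g = z"
  shows "\<exists>y\<in>carrier G. y \<otimes> y = \<one> \<and> g \<otimes> y \<otimes> (g \<otimes> y) = \<one>"
proof -
  obtain p s where p: "p \<in> carrier P" "g = \<alpha> p \<otimes> d [^] (s::nat)" using decompose[OF g(1)] by blast
  define noncentral where "noncentral i \<longleftrightarrow> (\<exists>w\<in>{a i, b i}. p i \<otimes>\<^bsub>Hs ! i\<^esub> w \<noteq> w \<otimes>\<^bsub>Hs ! i\<^esub> p i)" for i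
  consider i where "i < length Hs" "b i \<otimes>\<^bsub>Hs ! i\<^esub> b i = \<one>\<^bsub>Hs ! i\<^esub>" "noncentral i"
    | i where "i < length Hs" "b i \<otimes>\<^bsub>Hs ! i\<^esub> b i \<noteq> \<one>\<^bsub>Hs ! i\<^esub>" "noncentral i" "\<not> noncentral 0"
    | "\<And>i. i < length Hs \<Longrightarrow> \<not> noncentral i"
    using b0 nonempty by blast
  then show ?thesis
  proof cases
    case (1 i)
    interpret Hi: modular_factor "Hs ! i" "a i" "b i" "c i" "u i" by (rule factor[OF 1(1)])
    have pi: "p i \<in> carrier (Hs ! i)" by (rule P_closed[OF p(1) 1(1)])
    obtain w where w: "w \<in> carrier (Hs ! i)" "w \<otimes>\<^bsub>Hs ! i\<^esub> w = \<one>\<^bsub>Hs ! i\<^esub>" "p i \<otimes>\<^bsub>Hs ! i\<^esub> w \<noteq> w \<otimes>\<^bsub>Hs ! i\<^esub> p i"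
    proof (cases "p i \<otimes>\<^bsub>Hs ! i\<^esub> b i = b i \<otimes>\<^bsub>Hs ! i\<^esub> p i")
      case True
      then have na: "p i \<otimes>\<^bsub>Hs ! i\<^esub> a i \<noteq> a i \<otimes>\<^bsub>Hs ! i\<^esub> p i" using 1(3) by (auto simp: noncentral_def)
      have "p i \<otimes>\<^bsub>Hs ! i\<^esub> (a i \<otimes>\<^bsub>Hs ! i\<^esub> b i) \<noteq> a i \<otimes>\<^bsub>Hs ! i\<^esub> b i \<otimes>\<^bsub>Hs ! i\<^esub> p i"
      proof
        assume "p i \<otimes>\<^bsub>Hs ! i\<^esub> (a i \<otimes>\<^bsub>Hs ! i\<^esub> b i) = a i \<otimes>\<^bsub>Hs ! i\<^esub> b i \<otimes>\<^bsub>Hs ! i\<^esub> p i"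
        then have "p i \<otimes>\<^bsub>Hs ! i\<^esub> a i \<otimes>\<^bsub>Hs ! i\<^esub> b i = a i \<otimes>\<^bsub>Hs ! i\<^esub> p i \<otimes>\<^bsub>Hs ! i\<^esub> b i"
          using pi Hi.a Hi.b True by (simp add: Hi.m_assoc)
        then show False using na pi Hi.a Hi.b by simp
      qed
      then show ?thesis using that[OF Hi.m_closed[OF Hi.a Hi.b] Hi.involution_ab[OF u[OF 1(1)] 1(2)]] by blast
    next
      case False
      then show ?thesis using that[OF Hi.b 1(2)] by blast
    qed
    have c': "p i \<otimes>\<^bsub>Hs ! i\<^esub> w = c i \<otimes>\<^bsub>Hs ! i\<^esub> (w \<otimes>\<^bsub>Hs ! i\<^esub> p i)" using Hi.commutators[OF pi w(1)] w(3) by blast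
    have y: "emb i w \<in> carrier P" by (rule emb_closed[OF 1(1) w(1)])
    show ?thesis
    proof (rule involution_of_noncommuting[OF p(1) y 1(1) _ _ p(2) g(2)])
      show "\<alpha> (emb i w \<otimes>\<^bsub>P\<^esub> emb i w) = \<one>"
        using emb_mult[OF 1(1) w(1,1)] w(2) emb_one[OF 1(1)] \<alpha>_one by simp
      show "p \<otimes>\<^bsub>P\<^esub> emb i w = emb i (c i) \<otimes>\<^bsub>P\<^esub> (emb i w \<otimes>\<^bsub>P\<^esub> p)"
      proof (rule P_ext)
        fix j assume j: "j < length Hs"
        interpret j: group "Hs ! j" using j by (rule factor_group)
        show "(p \<otimes>\<^bsub>P\<^esub> emb i w) j = (emb i (c i) \<otimes>\<^bsub>P\<^esub> (emb i w \<otimes>\<^bsub>P\<^esub> p)) j"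
          using c' P_closed[OF p(1) j] by (simp add: P_mult[OF j] emb_apply[OF j])
      qed (use p y emb_closed[OF 1(1) Hi.c] in simp_all)
    qed
  next
    case (2 i)
    have i0: "i \<noteq> 0" using 2(3,4) by metis
    interpret Hi: modular_factor "Hs ! i" "a i" "b i" "c i" "u i" by (rule factor[OF 2(1)])
    interpret H0: modular_factor "Hs ! 0" "a 0" "b 0" "c 0" "u 0" by (rule factor[OF nonempty])
    have pi: "p i \<in> carrier (Hs ! i)" by (rule P_closed[OF p(1) 2(1)])
    have aa: "a i \<otimes>\<^bsub>Hs ! i\<^esub> a i = c i" "a 0 \<otimes>\<^bsub>Hs ! 0\<^esub> a 0 = c 0"
      using Hi.a H0.a u[OF 2(1)] u[OF nonempty] by (simp_all add: Hi.c_eq H0.c_eq numeral_2_eq_2)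
    have "b i \<otimes>\<^bsub>Hs ! i\<^esub> b i = c i" using Hi.bb 2(2) by blast
    then obtain w where w: "w \<in> carrier (Hs ! i)" "w \<otimes>\<^bsub>Hs ! i\<^esub> w = c i" "p i \<otimes>\<^bsub>Hs ! i\<^esub> w \<noteq> w \<otimes>\<^bsub>Hs ! i\<^esub> p i"
      using 2(3) aa(1) Hi.a Hi.b unfolding noncentral_def by blast
    have c': "p i \<otimes>\<^bsub>Hs ! i\<^esub> w = c i \<otimes>\<^bsub>Hs ! i\<^esub> (w \<otimes>\<^bsub>Hs ! i\<^esub> p i)" using Hi.commutators[OF pi w(1)] w(3) by blast
    have p0: "p 0 \<otimes>\<^bsub>Hs ! 0\<^esub> a 0 = a 0 \<otimes>\<^bsub>Hs ! 0\<^esub> p 0" using 2(4) by (auto simp: noncentral_def)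
    \<comment> \<open>Both squares have image z, so y y becomes z z = 1, while a 0 commutes with p 0
      and leaves the commutation with p to w.\<close>
    let ?y = "emb i w \<otimes>\<^bsub>P\<^esub> emb 0 (a 0)"
    have e: "emb i w \<in> carrier P" "emb 0 (a 0) \<in> carrier P" "emb i (c i) \<in> carrier P" "emb 0 (c 0) \<in> carrier P"
      using emb_closed 2(1) nonempty w(1) H0.a H0.c Hi.c by auto
    show ?thesis
    proof (rule involution_of_noncommuting[OF p(1) P.m_closed[OF e(1,2)] 2(1) _ _ p(2) g(2)])
      have "?y \<otimes>\<^bsub>P\<^esub> ?y = emb i (c i) \<otimes>\<^bsub>P\<^esub> emb 0 (c 0)"
      proof (rule P_ext)
        fix j assume j: "j < length Hs"
        interpret j: group "Hs ! j" using j by (rule factor_group)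
        show "(?y \<otimes>\<^bsub>P\<^esub> ?y) j = (emb i (c i) \<otimes>\<^bsub>P\<^esub> emb 0 (c 0)) j"
          using w aa i0 H0.a H0.c Hi.c by (auto simp: P_mult[OF j] emb_apply[OF j])
      qed (use e in simp_all)
      then show "\<alpha> (?y \<otimes>\<^bsub>P\<^esub> ?y) = \<one>"
        using \<alpha>_mult[OF e(3,4)] \<alpha>_emb_c[OF 2(1)] \<alpha>_emb_c[OF nonempty] z(2) by simp
      show "p \<otimes>\<^bsub>P\<^esub> ?y = emb i (c i) \<otimes>\<^bsub>P\<^esub> (?y \<otimes>\<^bsub>P\<^esub> p)"
      proof (rule P_ext)
        fix j assume j: "j < length Hs"
        interpret j: group "Hs ! j" using j by (rule factor_group)
        show "(p \<otimes>\<^bsub>P\<^esub> ?y) j = (emb i (c i) \<otimes>\<^bsub>P\<^esub> (?y \<otimes>\<^bsub>P\<^esub> p)) j"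
          using w c' p0 i0 H0.a P_closed[OF p(1) j] by (auto simp: P_mult[OF j] emb_apply[OF j])
      qed (use p e in simp_all)
    qed
  next
    case 3
    have "p \<otimes>\<^bsub>P\<^esub> p = \<one>\<^bsub>P\<^esub>"
    proof (rule P_ext)
      fix i assume i: "i < length Hs"
      interpret Hi: modular_factor "Hs ! i" "a i" "b i" "c i" "u i" by (rule factor[OF i])
      have "p i \<otimes>\<^bsub>Hs ! i\<^esub> p i = \<one>\<^bsub>Hs ! i\<^esub>"
        using 3[OF i] by (intro Hi.central_square[OF u[OF i] P_closed[OF p(1) i]]) (auto simp: noncentral_def)
      then show "(p \<otimes>\<^bsub>P\<^esub> p) i = \<one>\<^bsub>P\<^esub> i" using i by (simp add: P_mult P_one)
    qed (use p in auto)
    then have "d [^] (s + s) = z" using g(2) unfolding p(2) product_decomposed[OF p(1) p(1)] using dpow_closed by (simp add: \<alpha>_one)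
    then have "\<alpha> (emb 0 (c 0)) \<otimes> d [^] (s + s) = \<one>" using z(2) by (simp add: z_def)
    then have "emb 0 (c 0) \<in> N" using \<alpha>_one_iff emb_closed[OF nonempty factor_closed(3)[OF nonempty]] by blast
    then show ?thesis using N_K sign_emb[OF nonempty] by force
  qed
qed

text \<open>F is applied to the first coordinate of the P-part. An element of G determines that
  coordinate up to c 0, which F sends to 0 because 4 divides 2^(u 0 - 1).\<close>

lemma exists_Z4_hom:
  assumes F: "\<And>x y. x \<in> carrier (Hs ! 0) \<Longrightarrow> y \<in> carrier (Hs ! 0) \<Longrightarrow> F (x \<otimes>\<^bsub>Hs ! 0\<^esub> y) = (F x + F y) mod (4::int)"
    and range: "\<And>x. x \<in> carrier (Hs ! 0) \<Longrightarrow> F x \<in> {0..<4}" and Fa: "F (a 0) = 1" and u: "3 \<le> u 0"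
  shows "\<exists>f. (\<forall>g\<in>carrier G. \<forall>h\<in>carrier G. f (g \<otimes> h) = (f g + f h) mod (4::int)) \<and> f A = 1 \<and> f d = 0"
proof -
  interpret H0: modular_factor "Hs ! 0" "a 0" "b 0" "c 0" "u 0" by (rule factor[OF nonempty])
  have zero: "x = 0" if "x = (x + x) mod 4" "0 \<le> x" "x < 4" for x :: int using that by presburger
  have "F \<one>\<^bsub>Hs ! 0\<^esub> = (F \<one>\<^bsub>Hs ! 0\<^esub> + F \<one>\<^bsub>Hs ! 0\<^esub>) mod 4"
    using F[OF H0.one_closed H0.one_closed] unfolding H0.r_one[OF H0.one_closed] .
  then have F1: "F \<one>\<^bsub>Hs ! 0\<^esub> = 0" by (rule zero) (use range[OF H0.one_closed] in auto)
  have Fpow: "F (a 0 [^]\<^bsub>Hs ! 0\<^esub> k) = int k mod 4" for k :: nat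
    by (induction k) (use H0.a in \<open>auto simp: F1 F Fa mod_simps add.commute\<close>)
  have "4 dvd int (2 ^ (u 0 - 1))"
    using le_imp_power_dvd[of 2 "u 0 - 1" "2::int"] u by simp
  then have Fc: "F (c 0) = 0" unfolding H0.c_eq Fpow by simp
  define f where "f g = F ((SOME p. p \<in> carrier P \<and> (\<exists>s::nat. g = \<alpha> p \<otimes> d [^] s)) 0)" for g
  have f: "f (\<alpha> p \<otimes> d [^] (s::nat)) = F (p 0)" if p: "p \<in> carrier P" for p s
  proof -
    define q where "q = (SOME q. q \<in> carrier P \<and> (\<exists>t::nat. \<alpha> p \<otimes> d [^] s = \<alpha> q \<otimes> d [^] t))"
    have "q \<in> carrier P \<and> (\<exists>t::nat. \<alpha> p \<otimes> d [^] s = \<alpha> q \<otimes> d [^] t)"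
      unfolding q_def by (rule someI[where x = p]) (use p in blast)
    then obtain t :: nat where q: "q \<in> carrier P" and t: "\<alpha> p \<otimes> d [^] s = \<alpha> q \<otimes> d [^] t" by blast
    \<comment> \<open>The exponent of the inverse of \<open>d [^] t\<close>, written as a natural
      number.\<close>
    let ?t = "t * (M - 1)"
    have "d [^] (t + ?t) = \<one>"
    proof -
      have e: "t + ?t = M * t" using d(3) by (cases M) auto
      show ?thesis unfolding e using d by (simp only: nat_pow_pow[symmetric] nat_pow_one)
    qed
    then have "\<alpha> q \<otimes> d [^] t \<otimes> (\<alpha> (inv\<^bsub>P\<^esub> q) \<otimes> d [^] ?t) = \<one>"
      using product_decomposed[OF q P.inv_closed[OF q], of t ?t] q \<alpha>_one by simp
    then have "\<alpha> (p \<otimes>\<^bsub>P\<^esub> inv\<^bsub>P\<^esub> q) \<otimes> d [^] (s + ?t) = \<one>"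
      unfolding t[symmetric] product_decomposed[OF p P.inv_closed[OF q]] .
    then have "p \<otimes>\<^bsub>P\<^esub> inv\<^bsub>P\<^esub> q \<in> N" using \<alpha>_one_iff p q by blast
    then have "p \<otimes>\<^bsub>P\<^esub> inv\<^bsub>P\<^esub> q \<in> K" using N_K by blast
    then have w: "p 0 \<otimes>\<^bsub>Hs ! 0\<^esub> inv\<^bsub>Hs ! 0\<^esub> (q 0) = \<one>\<^bsub>Hs ! 0\<^esub> \<or> p 0 \<otimes>\<^bsub>Hs ! 0\<^esub> inv\<^bsub>Hs ! 0\<^esub> (q 0) = c 0"
      using nonempty P_inv[OF q nonempty] by (auto simp: K_def P_mult)
    have pq: "p 0 \<in> carrier (Hs ! 0)" "q 0 \<in> carrier (Hs ! 0)" using P_closed p q nonempty by auto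
    have "p 0 = p 0 \<otimes>\<^bsub>Hs ! 0\<^esub> inv\<^bsub>Hs ! 0\<^esub> (q 0) \<otimes>\<^bsub>Hs ! 0\<^esub> q 0" using pq by (simp add: H0.m_assoc)
    then have "p 0 = q 0 \<or> p 0 = c 0 \<otimes>\<^bsub>Hs ! 0\<^esub> q 0" using w pq by auto
    then have "F (p 0) = F (q 0)" using F[OF H0.c pq(2)] Fc range[OF pq(2)] by auto
    then show ?thesis unfolding f_def q_def by simp
  qed
  have "f (g \<otimes> h) = (f g + f h) mod 4" if g: "g \<in> carrier G" and h: "h \<in> carrier G" for g h
  proof -
    obtain p s where p: "p \<in> carrier P" "g = \<alpha> p \<otimes> d [^] (s::nat)" using decompose[OF g] by blast
    obtain q t where q: "q \<in> carrier P" "h = \<alpha> q \<otimes> d [^] (t::nat)" using decompose[OF h] by blast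
    show ?thesis
      unfolding p(2) q(2) product_decomposed[OF p(1) q(1)] f[OF p(1)] f[OF q(1)] f[OF P.m_closed[OF p(1) q(1)]]
      using F P_closed p(1) q(1) nonempty by (simp add: P_mult)
  qed
  moreover have "f A = 1"
    using f[of "emb 0 (a 0)" 0] emb_closed[OF nonempty H0.a] A Fa nonempty by (simp add: A_def emb_apply)
  moreover have "f d = 0"
    using f[of "\<one>\<^bsub>P\<^esub>" 1] d(1) F1 nonempty by (simp add: \<alpha>_one P_one)
  ultimately show ?thesis by blast
qed

end

section \<open>The orders of the unitary subgroups\<close>

context char2_group_algebra
begin

text \<open>If f g = 1, then f is 3 at inv g, so one of the two places counts; if f g = 0, neither
  does.\<close>

lemma Z4_character_values:
  assumes f: "\<forall>g\<in>carrier G. \<forall>h\<in>carrier G. f (g \<otimes> h) = (f g + f h) mod (4::int)" and g: "g \<in> carrier G"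
  shows "f g = 1 \<Longrightarrow> pair (alt \<gamma> g) (\<lambda>k. if f k = 1 then 1 else 0) = \<gamma>"
    and "f g = 0 \<Longrightarrow> pair (alt \<gamma> g) (\<lambda>k. if f k = 1 then 1 else 0) = 0"
proof -
  have zero: "x = 0" if "x = (x + x) mod 4" for x :: int using that by presburger
  have "f \<one> = (f \<one> + f \<one>) mod 4" using f[rule_format, OF one_closed one_closed] by simp
  then have f1: "f \<one> = 0" by (rule zero)
  have "f (g \<otimes> inv g) = (f g + f (inv g)) mod 4" using f g by blast
  then have i: "(f g + f (inv g)) mod 4 = 0" using g f1 by simp
  have p: "pair (alt \<gamma> g) (\<lambda>k. if f k = 1 then 1 else 0)
      = \<gamma> * (if f g = 1 then 1 else 0) + \<gamma> * (if f (inv g) = 1 then 1 else 0)"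
    using g unfolding alt_def pair_add by (simp only: pair_single inv_closed)
  show "pair (alt \<gamma> g) (\<lambda>k. if f k = 1 then 1 else 0) = \<gamma>" if "f g = 1"
  proof -
    have "f (inv g) \<noteq> 1" using i that by auto
    then show ?thesis unfolding p using that by simp
  qed
  show "pair (alt \<gamma> g) (\<lambda>k. if f k = 1 then 1 else 0) = 0" if "f g = 0"
  proof -
    have "f (inv g) \<noteq> 1" using i that by auto
    then show ?thesis unfolding p using that by simp
  qed
qed

text \<open>Separation makes e injective, because e i = e j would give the pairing value 0, which
  has the form t^2 + t. The bound can then be stated with |J|.\<close>

lemma card_unitary_lower_family:
  fixes J :: "'i set" and e :: "'i \<Rightarrow> 'a \<Rightarrow> 'f"
  assumes units: "\<And>x. x \<in> V \<Longrightarrow> \<exists>y\<in>V. y \<star> x = unit"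
    and e: "\<And>i. i \<in> J \<Longrightarrow> e i \<in> alternating"
    and sep: "\<And>i j. i \<in> J \<Longrightarrow> j \<in> J \<Longrightarrow> i \<noteq> j \<Longrightarrow>
      \<exists>f. (\<forall>g\<in>carrier G. \<forall>h\<in>carrier G. f (g \<otimes> h) = (f g + f h) mod (4::int)) \<and>
        pair (e i + e j) (\<lambda>k. if f k = 1 then 1 else 0) \<notin> range (\<lambda>t. t * t + t)"
  shows "card J * card symmetric \<le> card (UNIV :: 'f set) * card (unitary_subgroup G :: ('a \<Rightarrow> 'f) set)"
proof -
  have "inj_on e J"
  proof (rule inj_onI, rule ccontr)
    fix i j assume ij: "i \<in> J" "j \<in> J" "e i = e j" "i \<noteq> j"
    obtain f :: "'a \<Rightarrow> int" where f: "pair (e i + e j) (\<lambda>k. if f k = 1 then 1 else 0) \<notin> range (\<lambda>t. t * t + t)"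
      using sep[OF ij(1,2,4)] by (elim exE conjE)
    have "pair (e i + e j) (\<lambda>k. if f k = 1 then 1 else 0) = 0 * 0 + 0"
      unfolding ij(3) pair_add by (simp only: double_zero mult_zero_left add_0_left)
    moreover have "0 * 0 + 0 \<in> range (\<lambda>t :: 'f. t * t + t)" by (rule rangeI)
    ultimately show False using f by simp
  qed
  then have "card (e ` J) = card J" by (rule card_image)
  moreover have "card (e ` J) * card symmetric \<le> card (UNIV :: 'f set) * card (unitary_subgroup G :: ('a \<Rightarrow> 'f) set)"
  proof (rule card_unitary_lower[OF units])
    show "e ` J \<subseteq> alternating" using e by blast
    fix v w assume "v \<in> e ` J" "w \<in> e ` J" and ne: "v \<noteq> w"
    then obtain i j where ij: "i \<in> J" "j \<in> J" "v = e i" "w = e j" by blast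
    then have "i \<noteq> j" using ne by blast
    then show "\<exists>f. (\<forall>g\<in>carrier G. \<forall>h\<in>carrier G. f (g \<otimes> h) = (f g + f h) mod (4::int)) \<and>
        pair (v + w) (\<lambda>k. if f k = 1 then 1 else 0) \<notin> range (\<lambda>t. t * t + t)"
      unfolding ij(3,4) by (rule sep[OF ij(1,2)])
  qed
  ultimately show ?thesis by simp
qed

text \<open>The square root of \<open>card_symmetric_square\<close> is taken with real exponents, so
  that no parity argument is involved.\<close>

lemma card_unitary_powr:
  assumes "card (unitary_subgroup G :: ('a \<Rightarrow> 'f) set) * card (UNIV :: 'f set) = r * card symmetric"
  shows "real (card (unitary_subgroup G :: ('a \<Rightarrow> 'f) set)) =
    real r * real (card (UNIV :: 'f set)) powr ((real (order G) + real (card (Omega1 G))) / 2 - 1)"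
proof -
  let ?q = "real (card (UNIV :: 'f set))" and ?s = "real (card symmetric)"
  let ?K = "real (order G) + real (card (Omega1 G))"
  have q: "?q > 0" by (simp add: card_gt_0_iff)
  have \<Omega>: "Omega1 G = {g \<in> carrier G. g \<otimes> g = \<one>}" by (auto simp: Omega1_def numeral_2_eq_2)
  have "?s ^ 2 = ?q ^ (order G + card (Omega1 G))"
    unfolding \<Omega> order_def of_nat_power[symmetric] card_symmetric_square by simp
  also have "\<dots> = ?q powr ?K" using q by (simp add: powr_realpow[symmetric])
  also have "\<dots> = (?q powr (?K / 2)) ^ 2" by (simp add: power2_eq_square powr_add[symmetric])
  finally have s: "?s = ?q powr (?K / 2)" by (simp add: power2_eq_iff_nonneg)
  have "real (card (unitary_subgroup G :: ('a \<Rightarrow> 'f) set)) * ?q = real r * ?s"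
    using assms by (metis of_nat_mult)
  then have "real (card (unitary_subgroup G :: ('a \<Rightarrow> 'f) set)) = real r * (?s / ?q)"
    using q by (simp add: field_simps)
  also have "?s / ?q = ?q powr (?K / 2 - 1)" unfolding s using q by (simp add: powr_diff)
  finally show ?thesis .
qed

end

lemma (in central_product_group) finite_G: "finite (carrier G)"
proof -
  have "finite (carrier P)"
    unfolding P_def carrier_product_group
    by (intro finite_PiE) (auto intro: modular_factor.finite_carrier factor)
  moreover have "carrier G \<subseteq> (\<lambda>(p, s). \<alpha> p \<otimes> d [^] (s::nat)) ` (carrier P \<times> {..<M})"
  proof
    fix g assume "g \<in> carrier G"
    then obtain p s where p: "p \<in> carrier P" "g = \<alpha> p \<otimes> d [^] (s::nat)" using decompose by blast
    have "d [^] s = d [^] (M * (s div M) + s mod M)" by simp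
    also have "\<dots> = (d [^] M) [^] (s div M) \<otimes> d [^] (s mod M)" using d(1) by (simp only: nat_pow_mult nat_pow_pow)
    finally have "d [^] s = d [^] (s mod M)" using d(1,2) by simp
    then show "g \<in> (\<lambda>(p, s). \<alpha> p \<otimes> d [^] (s::nat)) ` (carrier P \<times> {..<M})"
      using p d(3) by (intro image_eqI[of _ _ "(p, s mod M)"]) auto
  qed
  ultimately show ?thesis by (meson finite_SigmaI finite_imageI finite_lessThan finite_subset)
qed

theorem corollary4p15:
  fixes G :: "'a monoid" and n m k l :: nat
  assumes char: "CHAR('f::{field,finite}) = 2"
    and nm: "n \<ge> m" "m \<ge> 1" and k: "k \<ge> 2" and l: "l \<in> {1, 2}"
    and G: "group G"
    and iso: "G \<cong> central_product
                     (M2 (n + 1) 1 # (if l = 1 then D8 else Q8) # replicate (k - 2) D8)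
                   \<times>\<times> integer_mod_group (2 ^ (m + 1))"
  shows "(n = 1 \<and> m = 1 \<longrightarrow>
            real (card (unitary_subgroup G :: ('a \<Rightarrow> 'f) set)) =
              2 * real (card (UNIV :: 'f set)) powr ((real (order G) + real (card (Omega1 G))) / 2 - 1))
       \<and> (n \<ge> 2 \<longrightarrow>
            real (card (unitary_subgroup G :: ('a \<Rightarrow> 'f) set)) =
              4 * real (card (UNIV :: 'f set)) powr ((real (order G) + real (card (Omega1 G))) / 2 - 1))"
proof -
  define Hs where "Hs = M2 (n + 1) 1 # (if l = 1 then D8 else Q8) # replicate (k - 2) D8"
  have u: "2 \<le> n + 1" using nm by simp
  obtain a0 b0 c0 where f0: "modular_factor (M2 (n + 1) 1) a0 b0 c0 (n + 1)"
    and b0: "b0 \<otimes>\<^bsub>M2 (n + 1) 1\<^esub> b0 = \<one>\<^bsub>M2 (n + 1) 1\<^esub>"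
    and F: "3 \<le> n + 1 \<longrightarrow> (\<exists>f\<in>carrier (M2 (n + 1) 1) \<rightarrow> {0..<4::int}. f a0 = 1 \<and>
         (\<forall>x\<in>carrier (M2 (n + 1) 1). \<forall>y\<in>carrier (M2 (n + 1) 1). f (x \<otimes>\<^bsub>M2 (n + 1) 1\<^esub> y) = (f x + f y) mod 4))"
    using modular_factor_M2[OF u] by blast
  obtain a1 b1 c1 where f1: "modular_factor (if l = 1 then D8 else Q8) a1 b1 c1 2"
    using modular_factor_D8 modular_factor_Q8 by (cases "l = 1") auto
  obtain a2 b2 c2 where f2: "modular_factor D8 a2 b2 c2 2"
    using modular_factor_D8 by blast
  define a b c where "a i = (if i = 0 then a0 else if i = 1 then a1 else a2)"
    and "b i = (if i = 0 then b0 else if i = 1 then b1 else b2)"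
    and "c i = (if i = 0 then c0 else if i = 1 then c1 else c2)" for i :: nat
  define u where "u i = (if i = 0 then n + 1 else 2)" for i :: nat
  have factors: "central_product_factors Hs a b c u"
  proof (rule central_product_factors.intro)
    fix i assume i: "i < length Hs"
    consider "i = 0" | "i = 1" | j where "i = Suc (Suc j)" by (metis One_nat_def not0_implies_Suc)
    then show "modular_factor (Hs ! i) (a i) (b i) (c i) (u i)"
      by cases (use f0 f1 f2 i in \<open>auto simp: Hs_def a_def b_def c_def u_def\<close>)
  qed (simp add: Hs_def)
  have Hs0: "Hs ! 0 = M2 (n + 1) 1" by (simp add: Hs_def)
  have M: "1 < (2::nat) ^ (m + 1)" by (rule one_less_power) simp_all
  obtain \<alpha> d \<tau> where cpg: "central_product_group Hs a b c u G \<alpha> d (2 ^ (m + 1)) \<tau>"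
    using central_product_factors.exists_decomposition[OF factors G iso[folded Hs_def] M] by blast
  interpret C: central_product_group Hs a b c u G \<alpha> d "2 ^ (m + 1)" \<tau> by (rule cpg)
  interpret char2_central_involution G "TYPE('f)" C.z
    by unfold_locales (use C.finite_G char C.z C.commutators_G in auto)
  have u_pos: "u i = 2" if "0 < i" for i using that by (simp add: u_def)
  have pow: "g [^]\<^bsub>G\<^esub> ((2::nat) ^ (1 + (u 0 + (m + 1)))) = \<one>\<^bsub>G\<^esub>" if "g \<in> carrier G" for g
    by (rule C.exponent_G[OF u_pos that HOL.refl])
  \<comment> \<open>When f g = 1 for a character f into \<int>/4, the pairing of
    \<open>alt \<gamma> g\<close> with f = 1 is \<gamma>, which no sum of two defects can
    have.\<close>
  obtain \<gamma> :: 'f where \<gamma>: "\<gamma> \<notin> range (\<lambda>t. t * t + t)"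
    using artin_schreier_complement by metis
  \<comment> \<open>The cyclic factor has order 2^(m+1), divisible by 4 since m \<ge> 1, so reducing
    its coordinate modulo 4 gives a character.\<close>
  define f2 where "f2 g = \<tau> g mod 4" for g
  have f2_hom: "\<forall>g\<in>carrier G. \<forall>h\<in>carrier G. f2 (g \<otimes>\<^bsub>G\<^esub> h) = (f2 g + f2 h) mod (4::int)"
  proof (intro ballI)
    fix g h assume gh: "g \<in> carrier G" "h \<in> carrier G"
    have "(4::int) dvd int (2 ^ (m + 1))" using le_imp_power_dvd[of 2 "m + 1" "2::int"] nm by simp
    then show "f2 (g \<otimes>\<^bsub>G\<^esub> h) = (f2 g + f2 h) mod 4"
      unfolding f2_def C.\<tau>_mult[OF gh] by (simp only: mod_mod_cancel mod_add_eq)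
  qed
  have f2_d: "f2 d = 1" by (simp add: f2_def C.\<tau>_d)
  have f2_A: "f2 C.A = 0"
    using C.\<tau>_\<alpha>[OF C.emb_closed[OF C.nonempty C.factor_closed(1)[OF C.nonempty]]] by (simp add: f2_def C.A_def)
  note dG = C.d(1)
  show ?thesis
  proof (intro conjI impI)
    assume "n = 1 \<and> m = 1"
    \<comment> \<open>For n = 1 the first factor has u = 2 as well and behaves like D8.\<close>
    then have u2: "u i = 2" for i by (simp add: u_def)
    have b0': "b 0 \<otimes>\<^bsub>Hs ! 0\<^esub> b 0 = \<one>\<^bsub>Hs ! 0\<^esub>" using b0 by (simp add: b_def Hs0)
    have alt: "alt \<alpha> g \<in> defects" if g: "g \<in> carrier G" "g \<otimes>\<^bsub>G\<^esub> g = C.z" for \<alpha> g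
    proof -
      have "\<exists>y\<in>carrier G. y \<otimes>\<^bsub>G\<^esub> y = \<one>\<^bsub>G\<^esub> \<and> g \<otimes>\<^bsub>G\<^esub> y \<otimes>\<^bsub>G\<^esub> (g \<otimes>\<^bsub>G\<^esub> y) = \<one>\<^bsub>G\<^esub>"
        by (rule C.exists_noncommuting_involution[OF _ b0' g]) (rule u2)
      then show ?thesis using alt_defects_noncommuting[OF g] by blast
    qed
    let ?R = "(\<lambda>s. d [^]\<^bsub>G\<^esub> (2 * s)) ` {0, 1::nat}"
    have R: "?R \<subseteq> carrier G" using dG by auto
    note upper = unitary_upper_bound[OF pow alt _ R C.square_cover_order_8[OF u2]]
    have "card (unitary_subgroup G :: ('a \<Rightarrow> 'f) set) * card (UNIV :: 'f set) \<le> card ?R * card symmetric"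
      by (rule upper(2)) auto
    also have "card ?R \<le> 2" using card_image_le[of "{0, 1::nat}" "\<lambda>s. d [^]\<^bsub>G\<^esub> (2 * s)"] by simp
    finally have le: "card (unitary_subgroup G :: ('a \<Rightarrow> 'f) set) * card (UNIV :: 'f set) \<le> 2 * card symmetric" by simp
    \<comment> \<open>Two elements, 0 and [\<gamma>, d], separated by f2.\<close>
    let ?e = "\<lambda>t. if t then alt \<gamma> d else 0"
    have "card (UNIV :: bool set) * card symmetric \<le> card (UNIV :: 'f set) * card (unitary_subgroup G :: ('a \<Rightarrow> 'f) set)"
    proof (rule card_unitary_lower_family[where e = ?e])
      show "\<exists>y\<in>V. y \<star> x = unit" if "x \<in> V" for x by (rule upper(1)) (simp_all add: that)
    next
      fix i :: bool
      show "?e i \<in> alternating" using alt_alternating[OF dG, of \<gamma>] alternating_add[of "alt \<gamma> d" "alt \<gamma> d"] by simp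
    next
      fix i j :: bool assume "i \<noteq> j"
      then have e: "?e i + ?e j = alt \<gamma> d" by auto
      have "pair (?e i + ?e j) (\<lambda>k. if f2 k = 1 then 1 else 0) \<notin> range (\<lambda>t. t * t + t)"
        unfolding e Z4_character_values(1)[OF f2_hom dG f2_d] by (rule \<gamma>)
      then show "\<exists>f. (\<forall>g\<in>carrier G. \<forall>h\<in>carrier G. f (g \<otimes>\<^bsub>G\<^esub> h) = (f g + f h) mod (4::int)) \<and>
        pair (?e i + ?e j) (\<lambda>k. if f k = 1 then 1 else 0) \<notin> range (\<lambda>t. t * t + t)"
        by (intro exI[of _ f2] conjI f2_hom)
    qed
    then have "card (unitary_subgroup G :: ('a \<Rightarrow> 'f) set) * card (UNIV :: 'f set) = 2 * card symmetric"
      using le by (simp add: mult.commute)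
    from card_unitary_powr[OF this] show "real (card (unitary_subgroup G :: ('a \<Rightarrow> 'f) set)) =
        2 * real (card (UNIV :: 'f set)) powr ((real (order G) + real (card (Omega1 G))) / 2 - 1)" by simp
  next
    assume n: "2 \<le> n"
    then have u3: "3 \<le> u 0" by (simp add: u_def)
    \<comment> \<open>A fourth root of z settles the condition on all g with g g = z at
      once.\<close>
    obtain t where t: "t \<in> carrier G" "t \<otimes>\<^bsub>G\<^esub> t \<otimes>\<^bsub>G\<^esub> (t \<otimes>\<^bsub>G\<^esub> t) = C.z" using C.fourth_root_z[OF u3] by blast
    have alt: "alt \<alpha> g \<in> defects" if "g \<in> carrier G" "g \<otimes>\<^bsub>G\<^esub> g = C.z" for \<alpha> g
      by (rule alt_defects_of_fourth_power[OF t that])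
    let ?R = "(\<lambda>(i, s). C.A [^]\<^bsub>G\<^esub> (2 * i) \<otimes>\<^bsub>G\<^esub> d [^]\<^bsub>G\<^esub> (2 * s)) ` ({0, 1::nat} \<times> {0, 1::nat})"
    have R: "?R \<subseteq> carrier G" using dG C.A by auto
    note upper = unitary_upper_bound[OF pow alt _ R C.square_cover[OF u_pos]]
    have "card (unitary_subgroup G :: ('a \<Rightarrow> 'f) set) * card (UNIV :: 'f set) \<le> card ?R * card symmetric"
      by (rule upper(2)) auto
    also have "card ?R \<le> 4"
      using card_image_le[of "{0, 1::nat} \<times> {0, 1::nat}" "\<lambda>(i, s). C.A [^]\<^bsub>G\<^esub> (2 * i) \<otimes>\<^bsub>G\<^esub> d [^]\<^bsub>G\<^esub> (2 * s)"] by simp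
    finally have le: "card (unitary_subgroup G :: ('a \<Rightarrow> 'f) set) * card (UNIV :: 'f set) \<le> 4 * card symmetric" by simp
    have "\<exists>f. (\<forall>g\<in>carrier G. \<forall>h\<in>carrier G. f (g \<otimes>\<^bsub>G\<^esub> h) = (f g + f h) mod (4::int)) \<and> f C.A = 1 \<and> f d = 0"
    proof -
      obtain F' where F': "F' \<in> carrier (M2 (n + 1) 1) \<rightarrow> {0..<4::int}" "F' a0 = 1"
        "\<forall>x\<in>carrier (M2 (n + 1) 1). \<forall>y\<in>carrier (M2 (n + 1) 1). F' (x \<otimes>\<^bsub>M2 (n + 1) 1\<^esub> y) = (F' x + F' y) mod 4"
        using F n by auto
      show ?thesis
        by (rule C.exists_Z4_hom[of F']) (use F' u3 in \<open>auto simp: a_def Hs0\<close>)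
    qed
    then obtain f1 where f1_hom: "\<forall>g\<in>carrier G. \<forall>h\<in>carrier G. f1 (g \<otimes>\<^bsub>G\<^esub> h) = (f1 g + f1 h) mod (4::int)"
      and f1: "f1 C.A = 1" "f1 d = 0" by blast
    \<comment> \<open>Four elements indexed by two bits: f1 detects the first bit through A, f2 the
      second through d.\<close>
    let ?e = "\<lambda>(s, t). (if s then alt \<gamma> C.A else 0) + (if t then alt \<gamma> d else 0)"
    have pair0: "pair 0 \<phi> = 0" for \<phi> by (simp add: pair_def)
    have p1: "pair (?e (s, t)) (\<lambda>k. if f1 k = 1 then 1 else 0) = (if s then \<gamma> else 0)" for s t
      using Z4_character_values(1)[OF f1_hom C.A f1(1), of \<gamma>] Z4_character_values(2)[OF f1_hom dG f1(2), of \<gamma>]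
      by (auto simp: pair_add pair0)
    have p2: "pair (?e (s, t)) (\<lambda>k. if f2 k = 1 then 1 else 0) = (if t then \<gamma> else 0)" for s t
      using Z4_character_values(2)[OF f2_hom C.A f2_A, of \<gamma>] Z4_character_values(1)[OF f2_hom dG f2_d, of \<gamma>]
      by (auto simp: pair_add pair0)
    have "card (UNIV :: (bool \<times> bool) set) * card symmetric \<le> card (UNIV :: 'f set) * card (unitary_subgroup G :: ('a \<Rightarrow> 'f) set)"
    proof (rule card_unitary_lower_family[where e = ?e])
      show "\<exists>y\<in>V. y \<star> x = unit" if "x \<in> V" for x by (rule upper(1)) (simp_all add: that)
    next
      fix i :: "bool \<times> bool"
      have "0 \<in> alternating" using alternating_add[of "alt \<gamma> d" "alt \<gamma> d"] alt_alternating[OF dG, of \<gamma>] by simp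
      then show "?e i \<in> alternating"
        using alt_alternating[OF dG, of \<gamma>] alt_alternating[OF C.A, of \<gamma>] alternating_add
        by (cases i) simp
    next
      fix i j :: "bool \<times> bool" assume ij: "i \<noteq> j"
      obtain s t s' t' where st: "i = (s, t)" "j = (s', t')" by (cases i; cases j)
      show "\<exists>f. (\<forall>g\<in>carrier G. \<forall>h\<in>carrier G. f (g \<otimes>\<^bsub>G\<^esub> h) = (f g + f h) mod (4::int)) \<and>
        pair (?e i + ?e j) (\<lambda>k. if f k = 1 then 1 else 0) \<notin> range (\<lambda>t. t * t + t)"
      proof (cases "s = s'")
        case False
        then have e: "pair (?e i + ?e j) (\<lambda>k. if f1 k = 1 then 1 else 0) = \<gamma>"
          unfolding pair_add st p1 by auto
        show ?thesis by (rule exI[of _ f1], intro conjI f1_hom) (simp only: e \<gamma> not_False_eq_True)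
      next
        case True
        then have "t \<noteq> t'" using ij st by blast
        then have e: "pair (?e i + ?e j) (\<lambda>k. if f2 k = 1 then 1 else 0) = \<gamma>"
          unfolding pair_add st p2 by auto
        show ?thesis by (rule exI[of _ f2], intro conjI f2_hom) (simp only: e \<gamma> not_False_eq_True)
      qed
    qed
    moreover have "card (UNIV :: (bool \<times> bool) set) = 4" by (simp add: UNIV_Times_UNIV[symmetric] card_cartesian_product del: UNIV_Times_UNIV)
    ultimately have "card (unitary_subgroup G :: ('a \<Rightarrow> 'f) set) * card (UNIV :: 'f set) = 4 * card symmetric"
      using le by (simp add: mult.commute)
    from card_unitary_powr[OF this] show "real (card (unitary_subgroup G :: ('a \<Rightarrow> 'f) set)) =
        4 * real (card (UNIV :: 'f set)) powr ((real (order G) + real (card (Omega1 G))) / 2 - 1)" by simp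
  qed
qed

end
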